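(* Let $G$ be a finite group, let $\mathbf A$ be the category of separable C*-algebras and *-homomorphisms, let $\mathbf B$ be a full subcategory of $\mathbf A$, and let $\mathbf C$ be a category where inductive limits of sequences exist. Let $\mathrm F\colon\mathbf B\to\mathbf C$ be a sequentially continuous functor that classifies homomorphisms, and let $\mathrm F_G\colon\mathbf B_G\to\mathbf C_G$ be the associated functor. Then the restriction of $\mathrm F_G$ to $\mathbf{RB}_G$ classifies isomorphisms. In particular, if $(A,\alpha)$ and $(B,\beta)$ are C*-dynamical systems in $\mathbf{RB}_G$, then $\alpha$ and $\beta$ are conjugate if and only if there exists an isomorphism $\rho\colon\mathrm F_G(A,\alpha)\to\mathrm F_G(B,\beta)$ in $\mathbf C_G$.
   Context: For a C*-algebra $A$, $\widetilde A$ is the C*-algebra obtained by adjoining a unit to $A$ (even if $A$ is unital). If $\alpha$ is an action of $G$ on $A$, $A^\alpha$ is the fixed point algebra. Actions $\alpha$ on $A$ and $\beta$ on $B$ are conjugate if there is an equivariant *-isomorphism $A\to B$. Rokhlin property: an action $\alpha\colon G\to\mathrm{Aut}(A)$ of a finite group $G$ on a (not necessarily unital) C*-algebra $A$ has the Rokhlin property if for every $\varepsilon>0$ and every finite $F\subseteq A$ there exist mutually orthogonal positive contractions $r_g\in A$, $g\in G$, with $\|\alpha_g(r_h)-r_{gh}\|<\varepsilon$ for all $g,h\in G$; $\|r_ga-ar_g\|<\varepsilon$ for all $a\in F$, $g\in G$; and $\|(\sum_{g\in G}r_g)a-a\|<\varepsilon$ for all $a\in F$. Equivariant *-homomorphisms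 $\phi,\psi\colon(A,\alpha)\to(B,\beta)$ satisfy $\phi\sim_{G\text{-}\mathrm{au}}\psi$ if for every finite $F\subseteq A$ and $\varepsilon>0$ there is a unitary $u\in\widetilde{B^\beta}$ with $\|\phi(a)-u^*\psi(a)u\|<\varepsilon$ for all $a\in F$. Categories: $\mathbf B_G$ has as objects the pairs $(A,\alpha)$ with $A$ in $\mathbf B$ and $\alpha\colon G\to\mathrm{Aut}(A)$ an action; its morphisms are all equivariant *-homomorphisms. $\mathbf{RB}_G$ is the full subcategory of $\mathbf B_G$ of those $(A,\alpha)$ for which $\alpha$ has the Rokhlin property. $\mathbf C_G$ has as objects pairs $(C,\gamma)$ with $C$ an object of $\mathbf C$ and $\gamma\colon G\to\mathrm{Aut}(C)$ a group homomorphism; morphisms are the equivariant morphisms of $\mathbf C$. $\mathrm F_G(A,\alpha)=(\mathrm F(A),\mathrm F(\alpha))$ where $\mathrm F(\alpha)_g=\mathrm F(\alpha_g)$, and $\mathrm F_G(\phi)=\mathrm F(\phi)$. A functor $\mathrm E$ from $\mathbf B_G$ (or a full subcategory of it) to a category $\mathbf D$ classifies homomorphisms if (a) for all objects $(A,\alpha),(B,\beta)$ and every morphism $\lambda\colon\mathrm E(A,\alpha)\to\mathrm E(B,\beta)$ in $\mathbf D$ there is a morphism $\phi\colon(A,\alpha)\to(B,\beta)$ with $\mathrm E(\phi)=\lambda$; and (b) for all morphisms $\phi,\psi\colon(A,\alpha)\to(B,\beta)$, $\mathrm E(\phi)=\mathrm E(\psi)$ if and only if $\phi\sim_{G\text{-}\mathrm{au}}\psi$.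 It classifies isomorphisms if (a) and (b) hold with "isomorphism" in place of "morphism" throughout (for $\lambda$, $\phi$, $\psi$). For a functor on $\mathbf B$ these notions are understood with $G$ trivial. A functor $\mathrm F\colon\mathbf C_1\to\mathbf C_2$ is sequentially continuous if whenever $C=\varinjlim(C_n,\theta_n)$ in $\mathbf C_1$ for a sequential direct system, the limit $\varinjlim(\mathrm F(C_n),\mathrm F(\theta_n))$ exists in $\mathbf C_2$ and equals $\mathrm F(C)$. *)

theory Defs
  imports "HOL-Analysis.Analysis" "HOL-Algebra.FiniteProduct"
begin

section \<open>C*-algebras\<close>

record 'a cstar = "'a partial_object" +
  cadd   :: "'a \<Rightarrow> 'a \<Rightarrow> 'a" (infixl "\<boxplus>\<index>" 65)
  czero  :: 'a
  cscale :: "complex \<Rightarrow> 'a \<Rightarrow> 'a" (infixr "\<boxdot>\<index>" 75)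
  cmult  :: "'a \<Rightarrow> 'a \<Rightarrow> 'a" (infixl "\<boxtimes>\<index>" 70)
  cstar  :: "'a \<Rightarrow> 'a"
  cnorm  :: "'a \<Rightarrow> real"

definition additive_monoid :: "'a cstar \<Rightarrow> 'a monoid" where
  "additive_monoid A = \<lparr>carrier = carrier A, monoid.mult = cadd A, one = czero A\<rparr>"

definition csum :: "'a cstar \<Rightarrow> ('i \<Rightarrow> 'a) \<Rightarrow> 'i set \<Rightarrow> 'a" where
  "csum A r I = finprod (additive_monoid A) r I"

definition cminus :: "'a cstar \<Rightarrow> 'a \<Rightarrow> 'a \<Rightarrow> 'a" (infixl "\<boxminus>\<index>" 65) where
  "x \<boxminus>\<^bsub>A\<^esub> y = x \<boxplus>\<^bsub>A\<^esub> ((- 1) \<boxdot>\<^bsub>A\<^esub> y)"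

text \<open>The guard is needed because \<open>Metric_space\<close> asks for nonnegativity and symmetry of the
  distance on the whole type.\<close>

definition cdist :: "'a cstar \<Rightarrow> 'a \<Rightarrow> 'a \<Rightarrow> real" where
  "cdist A x y =
    (if x \<in> carrier A \<and> y \<in> carrier A then cnorm A (x \<boxminus>\<^bsub>A\<^esub> y) else 0)"

locale cstar_algebra =
  fixes A :: "'a cstar" (structure)
  assumes additive: "comm_group (additive_monoid A)"
    and scale_closed: "x \<in> carrier A \<Longrightarrow> s \<boxdot> x \<in> carrier A"
    and scale_add_right:
      "\<lbrakk>x \<in> carrier A; y \<in> carrier A\<rbrakk> \<Longrightarrow> s \<boxdot> (x \<boxplus> y) = s \<boxdot> x \<boxplus> s \<boxdot> y"
    and scale_add_left: "x \<in> carrier A \<Longrightarrow> (s + t) \<boxdot> x = s \<boxdot> x \<boxplus> t \<boxdot> x"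
    and scale_scale: "x \<in> carrier A \<Longrightarrow> s \<boxdot> t \<boxdot> x = (s * t) \<boxdot> x"
    and scale_one: "x \<in> carrier A \<Longrightarrow> 1 \<boxdot> x = x"
    and mult_closed: "\<lbrakk>x \<in> carrier A; y \<in> carrier A\<rbrakk> \<Longrightarrow> x \<boxtimes> y \<in> carrier A"
    and mult_assoc:
      "\<lbrakk>x \<in> carrier A; y \<in> carrier A; z \<in> carrier A\<rbrakk> \<Longrightarrow> x \<boxtimes> y \<boxtimes> z = x \<boxtimes> (y \<boxtimes> z)"
    and mult_add_left:
      "\<lbrakk>x \<in> carrier A; y \<in> carrier A; z \<in> carrier A\<rbrakk> \<Longrightarrow> (x \<boxplus> y) \<boxtimes> z = x \<boxtimes> z \<boxplus> y \<boxtimes> z"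
    and mult_add_right:
      "\<lbrakk>x \<in> carrier A; y \<in> carrier A; z \<in> carrier A\<rbrakk> \<Longrightarrow> x \<boxtimes> (y \<boxplus> z) = x \<boxtimes> y \<boxplus> x \<boxtimes> z"
    and mult_scale_left:
      "\<lbrakk>x \<in> carrier A; y \<in> carrier A\<rbrakk> \<Longrightarrow> (s \<boxdot> x) \<boxtimes> y = s \<boxdot> (x \<boxtimes> y)"
    and mult_scale_right:
      "\<lbrakk>x \<in> carrier A; y \<in> carrier A\<rbrakk> \<Longrightarrow> x \<boxtimes> (s \<boxdot> y) = s \<boxdot> (x \<boxtimes> y)"
    and star_closed: "x \<in> carrier A \<Longrightarrow> cstar A x \<in> carrier A"
    and star_star: "x \<in> carrier A \<Longrightarrow> cstar A (cstar A x) = x"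
    and star_add:
      "\<lbrakk>x \<in> carrier A; y \<in> carrier A\<rbrakk> \<Longrightarrow> cstar A (x \<boxplus> y) = cstar A x \<boxplus> cstar A y"
    and star_scale: "x \<in> carrier A \<Longrightarrow> cstar A (s \<boxdot> x) = cnj s \<boxdot> cstar A x"
    and star_mult:
      "\<lbrakk>x \<in> carrier A; y \<in> carrier A\<rbrakk> \<Longrightarrow> cstar A (x \<boxtimes> y) = cstar A y \<boxtimes> cstar A x"
    and norm_nonneg: "x \<in> carrier A \<Longrightarrow> 0 \<le> cnorm A x"
    and norm_zero_iff: "x \<in> carrier A \<Longrightarrow> cnorm A x = 0 \<longleftrightarrow> x = czero A"
    and norm_triangle:
      "\<lbrakk>x \<in> carrier A; y \<in> carrier A\<rbrakk> \<Longrightarrow> cnorm A (x \<boxplus> y) \<le> cnorm A x + cnorm A y"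
    and norm_scale: "x \<in> carrier A \<Longrightarrow> cnorm A (s \<boxdot> x) = cmod s * cnorm A x"
    and norm_mult:
      "\<lbrakk>x \<in> carrier A; y \<in> carrier A\<rbrakk> \<Longrightarrow> cnorm A (x \<boxtimes> y) \<le> cnorm A x * cnorm A y"
    and cstar_identity: "x \<in> carrier A \<Longrightarrow> cnorm A (cstar A x \<boxtimes> x) = (cnorm A x)\<^sup>2"
    and complete: "Metric_space.mcomplete (carrier A) (cdist A)"

definition separable_cstar_algebra :: "'a cstar \<Rightarrow> bool" where
  "separable_cstar_algebra A \<longleftrightarrow>
    cstar_algebra A \<and> separable_space (Metric_space.mtopology (carrier A) (cdist A))"

text \<open>The forced unitization, with unit \<open>(0, 1)\<close>; \<open>(a, s)\<close> stands for \<open>a + s 1\<close>.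
  If \<open>A\<close> has no unit, its norm is the operator norm of left multiplication by \<open>a + s 1\<close> on \<open>A\<close>,
  which already dominates \<open>\<bar>s\<bar>\<close>.  If \<open>A\<close> is unital with unit \<open>e\<close>, then the unitization is
  \<open>A \<oplus> \<complex>\<close> via \<open>(a, s) \<mapsto> (a + s e, s)\<close>, with the maximum norm.\<close>

definition unitization :: "'a cstar \<Rightarrow> ('a \<times> complex) cstar" where
  "unitization A =
    \<lparr>carrier = carrier A \<times> UNIV,
     cadd = (\<lambda>(a, s) (b, t). (a \<boxplus>\<^bsub>A\<^esub> b, s + t)),
     czero = (czero A, 0),
     cscale = (\<lambda>c (a, s). (c \<boxdot>\<^bsub>A\<^esub> a, c * s)),
     cmult = (\<lambda>(a, s) (b, t).
       (a \<boxtimes>\<^bsub>A\<^esub> b \<boxplus>\<^bsub>A\<^esub> s \<boxdot>\<^bsub>A\<^esub> b \<boxplus>\<^bsub>A\<^esub> t \<boxdot>\<^bsub>A\<^esub> a, s * t)),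
     cstar = (\<lambda>(a, s). (cstar A a, cnj s)),
     cnorm = (\<lambda>(a, s). max (cmod s)
       (SUP b\<in>{b \<in> carrier A. cnorm A b \<le> 1}. cnorm A (a \<boxtimes>\<^bsub>A\<^esub> b \<boxplus>\<^bsub>A\<^esub> s \<boxdot>\<^bsub>A\<^esub> b)))\<rparr>"

definition unitization_one :: "'a cstar \<Rightarrow> 'a \<times> complex" where
  "unitization_one A = (czero A, 1)"

definition unitaries :: "'a cstar \<Rightarrow> ('a \<times> complex) set" where
  "unitaries A = {u \<in> carrier (unitization A).
     cstar (unitization A) u \<boxtimes>\<^bsub>unitization A\<^esub> u = unitization_one A \<and>
     u \<boxtimes>\<^bsub>unitization A\<^esub> cstar (unitization A) u = unitization_one A}"

definition spectrum :: "'a cstar \<Rightarrow> 'a \<Rightarrow> complex set" where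
  "spectrum A a = {s. \<not> (\<exists>y\<in>carrier (unitization A).
     let x = s \<boxdot>\<^bsub>unitization A\<^esub> unitization_one A \<boxminus>\<^bsub>unitization A\<^esub> (a, 0)
     in x \<boxtimes>\<^bsub>unitization A\<^esub> y = unitization_one A \<and>
        y \<boxtimes>\<^bsub>unitization A\<^esub> x = unitization_one A)}"

definition positive :: "'a cstar \<Rightarrow> 'a \<Rightarrow> bool" where
  "positive A a \<longleftrightarrow>
    a \<in> carrier A \<and> cstar A a = a \<and> spectrum A a \<subseteq> complex_of_real ` {0..}"

text \<open>Homomorphisms are extensional, so that equality of functions is equality of morphisms.\<close>

definition star_homs :: "'a cstar \<Rightarrow> 'a cstar \<Rightarrow> ('a \<Rightarrow> 'a) set" where
  "star_homs A B = {\<phi> \<in> carrier A \<rightarrow>\<^sub>E carrier B.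
     (\<forall>x\<in>carrier A. \<forall>y\<in>carrier A. \<phi> (x \<boxplus>\<^bsub>A\<^esub> y) = \<phi> x \<boxplus>\<^bsub>B\<^esub> \<phi> y) \<and>
     (\<forall>s. \<forall>x\<in>carrier A. \<phi> (s \<boxdot>\<^bsub>A\<^esub> x) = s \<boxdot>\<^bsub>B\<^esub> \<phi> x) \<and>
     (\<forall>x\<in>carrier A. \<forall>y\<in>carrier A. \<phi> (x \<boxtimes>\<^bsub>A\<^esub> y) = \<phi> x \<boxtimes>\<^bsub>B\<^esub> \<phi> y) \<and>
     (\<forall>x\<in>carrier A. \<phi> (cstar A x) = cstar B (\<phi> x))}"

section \<open>Categories\<close>

text \<open>Hom-sets are indexed by their end points and need not be disjoint; composition is therefore
  indexed by three objects: \<open>comp C x y z g f\<close> is \<open>g \<circ> f\<close> for \<open>f : x \<rightarrow> y\<close> and \<open>g : y \<rightarrow> z\<close>.\<close>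

record ('o, 'm) category =
  ob    :: "'o set"
  mor   :: "'o \<Rightarrow> 'o \<Rightarrow> 'm set"
  ident :: "'o \<Rightarrow> 'm"
  comp  :: "'o \<Rightarrow> 'o \<Rightarrow> 'o \<Rightarrow> 'm \<Rightarrow> 'm \<Rightarrow> 'm"

definition is_category :: "('o, 'm) category \<Rightarrow> bool" where
  "is_category C \<longleftrightarrow>
    (\<forall>x\<in>ob C. ident C x \<in> mor C x x) \<and>
    (\<forall>x\<in>ob C. \<forall>y\<in>ob C. \<forall>z\<in>ob C. \<forall>f\<in>mor C x y. \<forall>g\<in>mor C y z.
       comp C x y z g f \<in> mor C x z) \<and>
    (\<forall>x\<in>ob C. \<forall>y\<in>ob C. \<forall>f\<in>mor C x y.
       comp C x x y f (ident C x) = f \<and> comp C x y y (ident C y) f = f) \<and>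
    (\<forall>w\<in>ob C. \<forall>x\<in>ob C. \<forall>y\<in>ob C. \<forall>z\<in>ob C.
       \<forall>f\<in>mor C w x. \<forall>g\<in>mor C x y. \<forall>h\<in>mor C y z.
       comp C w y z h (comp C w x y g f) = comp C w x z (comp C x y z h g) f)"

definition isos :: "('o, 'm) category \<Rightarrow> 'o \<Rightarrow> 'o \<Rightarrow> 'm set" where
  "isos C x y = {f \<in> mor C x y. \<exists>g\<in>mor C y x.
     comp C x y x g f = ident C x \<and> comp C y x y f g = ident C y}"

definition Aut :: "('o, 'm) category \<Rightarrow> 'o \<Rightarrow> 'm monoid" where
  "Aut C x = \<lparr>carrier = isos C x x, monoid.mult = comp C x x x, one = ident C x\<rparr>"

definition full_subcategory :: "('o, 'm) category \<Rightarrow> ('o, 'm) category \<Rightarrow> bool" where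
  "full_subcategory B C \<longleftrightarrow>
    ob B \<subseteq> ob C \<and>
    (\<forall>x\<in>ob B. ident B x = ident C x) \<and>
    (\<forall>x\<in>ob B. \<forall>y\<in>ob B. mor B x y = mor C x y) \<and>
    (\<forall>x\<in>ob B. \<forall>y\<in>ob B. \<forall>z\<in>ob B. \<forall>f\<in>mor B x y. \<forall>g\<in>mor B y z.
       comp B x y z g f = comp C x y z g f)"

record ('o1, 'm1, 'o2, 'm2) functor_data =
  fob  :: "'o1 \<Rightarrow> 'o2"
  fmor :: "'o1 \<Rightarrow> 'o1 \<Rightarrow> 'm1 \<Rightarrow> 'm2"

definition is_functor ::
  "('o1, 'm1) category \<Rightarrow> ('o2, 'm2) category \<Rightarrow> ('o1, 'm1, 'o2, 'm2) functor_data \<Rightarrow> bool" where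
  "is_functor C D F \<longleftrightarrow>
    (\<forall>x\<in>ob C. fob F x \<in> ob D) \<and>
    (\<forall>x\<in>ob C. \<forall>y\<in>ob C. \<forall>f\<in>mor C x y. fmor F x y f \<in> mor D (fob F x) (fob F y)) \<and>
    (\<forall>x\<in>ob C. fmor F x x (ident C x) = ident D (fob F x)) \<and>
    (\<forall>x\<in>ob C. \<forall>y\<in>ob C. \<forall>z\<in>ob C. \<forall>f\<in>mor C x y. \<forall>g\<in>mor C y z.
       fmor F x z (comp C x y z g f) =
       comp D (fob F x) (fob F y) (fob F z) (fmor F y z g) (fmor F x y f))"

subsection \<open>Inductive limits of sequences\<close>

definition direct_sequence ::
  "('o, 'm) category \<Rightarrow> (nat \<Rightarrow> 'o) \<Rightarrow> (nat \<Rightarrow> 'm) \<Rightarrow> bool" where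
  "direct_sequence C X \<theta> \<longleftrightarrow> (\<forall>n. X n \<in> ob C \<and> \<theta> n \<in> mor C (X n) (X (Suc n)))"

definition cocone ::
  "('o, 'm) category \<Rightarrow> (nat \<Rightarrow> 'o) \<Rightarrow> (nat \<Rightarrow> 'm) \<Rightarrow> 'o \<Rightarrow> (nat \<Rightarrow> 'm) \<Rightarrow> bool" where
  "cocone C X \<theta> L \<iota> \<longleftrightarrow>
    L \<in> ob C \<and>
    (\<forall>n. \<iota> n \<in> mor C (X n) L \<and> comp C (X n) (X (Suc n)) L (\<iota> (Suc n)) (\<theta> n) = \<iota> n)"

definition inductive_limit ::
  "('o, 'm) category \<Rightarrow> (nat \<Rightarrow> 'o) \<Rightarrow> (nat \<Rightarrow> 'm) \<Rightarrow> 'o \<Rightarrow> (nat \<Rightarrow> 'm) \<Rightarrow> bool" where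
  "inductive_limit C X \<theta> L \<iota> \<longleftrightarrow>
    cocone C X \<theta> L \<iota> \<and>
    (\<forall>L' \<iota>'. cocone C X \<theta> L' \<iota>' \<longrightarrow>
      (\<exists>!u. u \<in> mor C L L' \<and> (\<forall>n. comp C (X n) L L' u (\<iota> n) = \<iota>' n)))"

definition has_inductive_limits :: "('o, 'm) category \<Rightarrow> bool" where
  "has_inductive_limits C \<longleftrightarrow>
    (\<forall>X \<theta>. direct_sequence C X \<theta> \<longrightarrow> (\<exists>L \<iota>. inductive_limit C X \<theta> L \<iota>))"

definition sequentially_continuous ::
  "('o1, 'm1) category \<Rightarrow> ('o2, 'm2) category \<Rightarrow> ('o1, 'm1, 'o2, 'm2) functor_data \<Rightarrow> bool" where
  "sequentially_continuous C D F \<longleftrightarrow>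
    (\<forall>X \<theta> L \<iota>. direct_sequence C X \<theta> \<and> inductive_limit C X \<theta> L \<iota> \<longrightarrow>
      inductive_limit D (\<lambda>n. fob F (X n)) (\<lambda>n. fmor F (X n) (X (Suc n)) (\<theta> n))
        (fob F L) (\<lambda>n. fmor F (X n) L (\<iota> n)))"

subsection \<open>Equivariant categories\<close>

text \<open>The same construction yields both \<open>\<^bold>B\<^sub>G\<close> and \<open>\<^bold>C\<^sub>G\<close>.\<close>

definition equivariant_category ::
  "'g monoid \<Rightarrow> ('o, 'm) category \<Rightarrow> ('o \<times> ('g \<Rightarrow> 'm), 'm) category" where
  "equivariant_category G C =
    \<lparr>ob = {(x, \<gamma>). x \<in> ob C \<and> \<gamma> \<in> hom G (Aut C x) \<inter> extensional (carrier G)},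
     mor = (\<lambda>(x, \<gamma>) (y, \<delta>). {f \<in> mor C x y.
       \<forall>g\<in>carrier G. comp C x x y f (\<gamma> g) = comp C x y y (\<delta> g) f}),
     ident = (\<lambda>(x, \<gamma>). ident C x),
     comp = (\<lambda>(x, _) (y, _) (z, _). comp C x y z)\<rparr>"

definition equivariant_functor ::
  "'g monoid \<Rightarrow> ('o1, 'm1, 'o2, 'm2) functor_data \<Rightarrow>
   ('o1 \<times> ('g \<Rightarrow> 'm1), 'm1, 'o2 \<times> ('g \<Rightarrow> 'm2), 'm2) functor_data" where
  "equivariant_functor G F =
    \<lparr>fob = (\<lambda>(x, \<alpha>). (fob F x, \<lambda>g\<in>carrier G. fmor F x x (\<alpha> g))),
     fmor = (\<lambda>(x, _) (y, _). fmor F x y)\<rparr>"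

section \<open>Dynamical systems and classification\<close>

definition separable_cstar_category :: "('a cstar, 'a \<Rightarrow> 'a) category" where
  "separable_cstar_category =
    \<lparr>ob = {A. separable_cstar_algebra A},
     mor = star_homs,
     ident = (\<lambda>A. \<lambda>x\<in>carrier A. x),
     comp = (\<lambda>A _ _ \<psi> \<phi>. compose (carrier A) \<psi> \<phi>)\<rparr>"

definition fixed_point_algebra :: "'g monoid \<Rightarrow> 'a cstar \<Rightarrow> ('g \<Rightarrow> 'a \<Rightarrow> 'a) \<Rightarrow> 'a cstar" where
  "fixed_point_algebra G A \<alpha> = A\<lparr>carrier := {a \<in> carrier A. \<forall>g\<in>carrier G. \<alpha> g a = a}\<rparr>"

definition rokhlin_property :: "'g monoid \<Rightarrow> 'a cstar \<Rightarrow> ('g \<Rightarrow> 'a \<Rightarrow> 'a) \<Rightarrow> bool" where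
  "rokhlin_property G A \<alpha> \<longleftrightarrow>
    (\<forall>\<epsilon>>0. \<forall>F. finite F \<and> F \<subseteq> carrier A \<longrightarrow>
      (\<exists>r. (\<forall>g\<in>carrier G. positive A (r g) \<and> cnorm A (r g) \<le> 1) \<and>
           (\<forall>g\<in>carrier G. \<forall>h\<in>carrier G. g \<noteq> h \<longrightarrow> r g \<boxtimes>\<^bsub>A\<^esub> r h = czero A) \<and>
           (\<forall>g\<in>carrier G. \<forall>h\<in>carrier G. cnorm A (\<alpha> g (r h) \<boxminus>\<^bsub>A\<^esub> r (g \<otimes>\<^bsub>G\<^esub> h)) < \<epsilon>) \<and>
           (\<forall>a\<in>F. \<forall>g\<in>carrier G. cnorm A (r g \<boxtimes>\<^bsub>A\<^esub> a \<boxminus>\<^bsub>A\<^esub> a \<boxtimes>\<^bsub>A\<^esub> r g) < \<epsilon>) \<and>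
           (\<forall>a\<in>F. cnorm A (csum A r (carrier G) \<boxtimes>\<^bsub>A\<^esub> a \<boxminus>\<^bsub>A\<^esub> a) < \<epsilon>)))"

definition rokhlin_category ::
  "'g monoid \<Rightarrow> ('a cstar, 'a \<Rightarrow> 'a) category \<Rightarrow>
   ('a cstar \<times> ('g \<Rightarrow> 'a \<Rightarrow> 'a), 'a \<Rightarrow> 'a) category" where
  "rokhlin_category G B = (equivariant_category G B)
    \<lparr>ob := {(A, \<alpha>) \<in> ob (equivariant_category G B). rokhlin_property G A \<alpha>}\<rparr>"

text \<open>Here \<open>U\<close> is a subalgebra of \<open>B\<close>: the fixed point algebra in the equivariant case, and
  \<open>B\<close> itself, which is the fixed point algebra of the trivial group, in the nonequivariant case.\<close>

definition approx_unitarily_equivalent ::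
  "'a cstar \<Rightarrow> 'a cstar \<Rightarrow> 'a cstar \<Rightarrow> ('a \<Rightarrow> 'a) \<Rightarrow> ('a \<Rightarrow> 'a) \<Rightarrow> bool" where
  "approx_unitarily_equivalent U A B \<phi> \<psi> \<longleftrightarrow>
    (\<forall>F. \<forall>\<epsilon>>0. finite F \<and> F \<subseteq> carrier A \<longrightarrow>
      (\<exists>u\<in>unitaries U. \<forall>a\<in>F.
        cnorm (unitization B) ((\<phi> a, 0) \<boxminus>\<^bsub>unitization B\<^esub>
          cstar (unitization B) u \<boxtimes>\<^bsub>unitization B\<^esub> (\<psi> a, 0) \<boxtimes>\<^bsub>unitization B\<^esub> u) < \<epsilon>))"

definition au_equiv :: "'a cstar \<Rightarrow> 'a cstar \<Rightarrow> ('a \<Rightarrow> 'a) \<Rightarrow> ('a \<Rightarrow> 'a) \<Rightarrow> bool" where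
  "au_equiv A B = approx_unitarily_equivalent B A B"

definition G_au_equiv ::
  "'g monoid \<Rightarrow> 'a cstar \<times> ('g \<Rightarrow> 'a \<Rightarrow> 'a) \<Rightarrow> 'a cstar \<times> ('g \<Rightarrow> 'a \<Rightarrow> 'a) \<Rightarrow>
   ('a \<Rightarrow> 'a) \<Rightarrow> ('a \<Rightarrow> 'a) \<Rightarrow> bool" where
  "G_au_equiv G = (\<lambda>(A, \<alpha>) (B, \<beta>).
     approx_unitarily_equivalent (fixed_point_algebra G B \<beta>) A B)"

definition conjugate ::
  "'g monoid \<Rightarrow> 'a cstar \<times> ('g \<Rightarrow> 'a \<Rightarrow> 'a) \<Rightarrow> 'a cstar \<times> ('g \<Rightarrow> 'a \<Rightarrow> 'a) \<Rightarrow> bool" where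
  "conjugate G = (\<lambda>(A, \<alpha>) (B, \<beta>).
     \<exists>\<phi>\<in>star_homs A B. bij_betw \<phi> (carrier A) (carrier B) \<and>
       (\<forall>g\<in>carrier G. \<forall>a\<in>carrier A. \<phi> (\<alpha> g a) = \<beta> g (\<phi> a)))"

text \<open>The relation \<open>R\<close> is the approximate unitary equivalence that goes with the domain of the
  functor: \<^const>\<open>au_equiv\<close> or \<open>G_au_equiv G\<close>.\<close>

definition classifies_homomorphisms ::
  "('o1, 'm1) category \<Rightarrow> ('o2, 'm2) category \<Rightarrow> ('o1, 'm1, 'o2, 'm2) functor_data \<Rightarrow>
   ('o1 \<Rightarrow> 'o1 \<Rightarrow> 'm1 \<Rightarrow> 'm1 \<Rightarrow> bool) \<Rightarrow> bool" where
  "classifies_homomorphisms X D E R \<longleftrightarrow>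
    is_functor X D E \<and>
    (\<forall>x\<in>ob X. \<forall>y\<in>ob X. \<forall>l\<in>mor D (fob E x) (fob E y). \<exists>\<phi>\<in>mor X x y. fmor E x y \<phi> = l) \<and>
    (\<forall>x\<in>ob X. \<forall>y\<in>ob X. \<forall>\<phi>\<in>mor X x y. \<forall>\<psi>\<in>mor X x y.
       fmor E x y \<phi> = fmor E x y \<psi> \<longleftrightarrow> R x y \<phi> \<psi>)"

definition classifies_isomorphisms ::
  "('o1, 'm1) category \<Rightarrow> ('o2, 'm2) category \<Rightarrow> ('o1, 'm1, 'o2, 'm2) functor_data \<Rightarrow>
   ('o1 \<Rightarrow> 'o1 \<Rightarrow> 'm1 \<Rightarrow> 'm1 \<Rightarrow> bool) \<Rightarrow> bool" where
  "classifies_isomorphisms X D E R \<longleftrightarrow>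
    is_functor X D E \<and>
    (\<forall>x\<in>ob X. \<forall>y\<in>ob X. \<forall>l\<in>isos D (fob E x) (fob E y). \<exists>\<phi>\<in>isos X x y. fmor E x y \<phi> = l) \<and>
    (\<forall>x\<in>ob X. \<forall>y\<in>ob X. \<forall>\<phi>\<in>isos X x y. \<forall>\<psi>\<in>isos X x y.
       fmor E x y \<phi> = fmor E x y \<psi> \<longleftrightarrow> R x y \<phi> \<psi>)"

section \<open>Basic facts\<close>

lemma (in cstar_algebra) add_closed: "\<lbrakk>x \<in> carrier A; y \<in> carrier A\<rbrakk> \<Longrightarrow> x \<boxplus> y \<in> carrier A"
  using monoid.m_closed[OF group.is_monoid[OF comm_group.axioms(2)[OF additive]], of x y]
  by (simp add: additive_monoid_def)

lemma (in cstar_algebra) zero_closed: "czero A \<in> carrier A"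
  using monoid.one_closed[OF group.is_monoid[OF comm_group.axioms(2)[OF additive]]]
  by (simp add: additive_monoid_def)

lemma (in cstar_algebra) add_zero: "x \<in> carrier A \<Longrightarrow> x \<boxplus> czero A = x"
  using monoid.r_one[OF group.is_monoid[OF comm_group.axioms(2)[OF additive]], of x]
  by (simp add: additive_monoid_def)

lemma (in cstar_algebra) add_assoc:
  "\<lbrakk>x \<in> carrier A; y \<in> carrier A; z \<in> carrier A\<rbrakk> \<Longrightarrow> x \<boxplus> y \<boxplus> z = x \<boxplus> (y \<boxplus> z)"
  using monoid.m_assoc[OF group.is_monoid[OF comm_group.axioms(2)[OF additive]], of x y z]
  by (simp add: additive_monoid_def)

lemma (in cstar_algebra) add_commute:
  "\<lbrakk>x \<in> carrier A; y \<in> carrier A\<rbrakk> \<Longrightarrow> x \<boxplus> y = y \<boxplus> x"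
  using comm_monoid.m_comm[OF comm_group.axioms(1)[OF additive], of x y]
  by (simp add: additive_monoid_def)

lemma (in cstar_algebra) zero_scale: "x \<in> carrier A \<Longrightarrow> 0 \<boxdot> x = czero A"
  by (metis norm_scale norm_zero_iff scale_closed mult_zero_left norm_zero)

lemma (in cstar_algebra) minus_self: "x \<in> carrier A \<Longrightarrow> x \<boxminus> x = czero A"
  unfolding cminus_def
  by (metis scale_add_left scale_one zero_scale add.right_inverse)

lemma (in cstar_algebra) minus_closed: "\<lbrakk>x \<in> carrier A; y \<in> carrier A\<rbrakk> \<Longrightarrow> x \<boxminus> y \<in> carrier A"
  by (simp add: cminus_def add_closed scale_closed)

lemma (in cstar_algebra) minus_add_cancel:
  assumes "x \<in> carrier A" "y \<in> carrier A" shows "(x \<boxminus> y) \<boxplus> y = x"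
proof -
  have "((- 1) \<boxdot> y) \<boxplus> y = czero A"
    using minus_self[OF assms(2)] assms by (simp add: cminus_def add_commute scale_closed)
  then show ?thesis using assms by (simp add: cminus_def add_assoc scale_closed add_zero)
qed

lemma (in cstar_algebra) Metric_space_cdist: "Metric_space (carrier A) (cdist A)"
proof
  show "0 \<le> cdist A x y" for x y
    by (simp add: cdist_def norm_nonneg minus_closed)
  show "cdist A x y = cdist A y x" for x y
  proof (cases "x \<in> carrier A \<and> y \<in> carrier A")
    case True
    then have "(- 1) \<boxdot> (x \<boxminus> y) = y \<boxminus> x"
      by (simp add: cminus_def scale_add_right scale_closed scale_scale scale_one add_commute)
    then have "cnorm A (y \<boxminus> x) = cnorm A (x \<boxminus> y)"
      using norm_scale[of "x \<boxminus> y" "- 1"] True by (simp add: minus_closed)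
    then show ?thesis by (simp add: cdist_def)
  qed (auto simp: cdist_def)
  show "cdist A x y = 0 \<longleftrightarrow> x = y" if "x \<in> carrier A" "y \<in> carrier A" for x y
  proof -
    have "x \<boxminus> y = czero A \<Longrightarrow> x = y"
      using minus_add_cancel[OF that] that by (metis add_commute add_zero zero_closed)
    then show ?thesis
      using that by (auto simp: cdist_def norm_zero_iff minus_closed minus_self)
  qed
  show "cdist A x z \<le> cdist A x y + cdist A y z"
    if "x \<in> carrier A" "y \<in> carrier A" "z \<in> carrier A" for x y z
  proof -
    have "x \<boxminus> z = (x \<boxminus> y) \<boxplus> (y \<boxminus> z)"
      using that minus_add_cancel[of x y]
      by (metis add_assoc cminus_def minus_closed scale_closed)
    then show ?thesis
      using norm_triangle[of "x \<boxminus> y" "y \<boxminus> z"] that by (simp add: cdist_def minus_closed)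
  qed
qed

lemma (in cstar_algebra) norm_star:
  assumes "x \<in> carrier A" shows "cnorm A (cstar A x) = cnorm A x"
proof -
  have le: "cnorm A y \<le> cnorm A (cstar A y)" if y: "y \<in> carrier A" for y
  proof (cases "cnorm A y = 0")
    case True then show ?thesis using norm_nonneg star_closed y by simp
  next
    case False
    have "cnorm A y * cnorm A y \<le> cnorm A (cstar A y) * cnorm A y"
      using norm_mult[of "cstar A y" y] cstar_identity[OF y] star_closed y
      by (simp add: power2_eq_square)
    then show ?thesis using False norm_nonneg[OF y] by (simp add: mult_le_cancel_right)
  qed
  show ?thesis using le[OF assms] le[OF star_closed[OF assms]] star_star[OF assms] by simp
qed

lemma (in cstar_algebra) norm_unitization:
  assumes x: "x \<in> carrier A"
  shows "cnorm (unitization A) (x, 0) = cnorm A x"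
proof -
  let ?S = "{b \<in> carrier A. cnorm A b \<le> 1}"
  have eq: "x \<boxtimes> b \<boxplus> 0 \<boxdot> b = x \<boxtimes> b" if "b \<in> carrier A" for b
    using that x by (simp add: zero_scale add_zero mult_closed)
  have ub: "cnorm A (x \<boxtimes> b \<boxplus> 0 \<boxdot> b) \<le> cnorm A x" if "b \<in> ?S" for b
  proof -
    have "cnorm A (x \<boxtimes> b) \<le> cnorm A x * cnorm A b" using that x by (simp add: norm_mult)
    also have "\<dots> \<le> cnorm A x * 1" using that norm_nonneg[OF x] by (intro mult_left_mono) auto
    finally show ?thesis using that eq by simp
  qed
  have z: "cnorm A (czero A) = 0" using norm_zero_iff zero_closed by blast
  have ne: "czero A \<in> ?S" using z zero_closed by simp
  have sup: "(SUP b\<in>?S. cnorm A (x \<boxtimes> b \<boxplus> 0 \<boxdot> b)) = cnorm A x"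
  proof (rule cSup_eq_maximum)
    show "cnorm A x \<in> (\<lambda>b. cnorm A (x \<boxtimes> b \<boxplus> 0 \<boxdot> b)) ` ?S"
    proof (cases "cnorm A x = 0")
      case True
      then have "cnorm A (x \<boxtimes> czero A \<boxplus> 0 \<boxdot> czero A) = cnorm A x"
        using ub[OF ne] norm_nonneg[of "x \<boxtimes> czero A"] eq[OF zero_closed] mult_closed x zero_closed
        by simp
      then show ?thesis using ne by (metis (no_types, lifting) image_eqI)
    next
      case False
      define b where "b = complex_of_real (inverse (cnorm A x)) \<boxdot> cstar A x"
      have pos: "cnorm A x > 0" using False norm_nonneg[OF x] by simp
      have b: "b \<in> carrier A" by (simp add: b_def scale_closed star_closed x)
      have nb: "cnorm A b = 1"
        using pos by (simp add: b_def norm_scale star_closed x norm_star norm_inverse)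
      have "cnorm A (x \<boxtimes> cstar A x) = (cnorm A x)\<^sup>2"
        using cstar_identity[OF star_closed[OF x]] by (simp add: star_star x norm_star)
      then have "cnorm A (x \<boxtimes> b) = cnorm A x"
        using pos by (simp add: b_def mult_scale_right star_closed x norm_scale mult_closed
            power2_eq_square norm_inverse)
      then show ?thesis using b nb eq[OF b] by (intro image_eqI[of _ _ b]) auto
    qed
    show "y \<le> cnorm A x" if "y \<in> (\<lambda>b. cnorm A (x \<boxtimes> b \<boxplus> 0 \<boxdot> b)) ` ?S" for y
      using that ub by blast
  qed
  then show ?thesis using norm_nonneg[OF x] by (simp add: unitization_def)
qed

lemma is_category_separable_cstar: "is_category separable_cstar_category"
proof -
  have id: "(\<lambda>x\<in>carrier A. x) \<in> star_homs A A" if "separable_cstar_algebra A" for A :: "'a cstar"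
  proof -
    interpret cstar_algebra A using that by (simp add: separable_cstar_algebra_def)
    show ?thesis by (auto simp: star_homs_def add_closed scale_closed mult_closed star_closed)
  qed
  have cm: "compose (carrier A) \<psi> \<phi> \<in> star_homs A D"
    if "separable_cstar_algebra A" "\<phi> \<in> star_homs A B" "\<psi> \<in> star_homs B D"
    for A B D :: "'a cstar" and \<phi> \<psi>
  proof -
    interpret cstar_algebra A using that by (simp add: separable_cstar_algebra_def)
    show ?thesis using that
      by (auto simp: star_homs_def compose_def add_closed scale_closed mult_closed star_closed
          PiE_iff)
  qed
  have idc: "compose (carrier A) \<phi> (\<lambda>x\<in>carrier A. x) = \<phi>"
    "compose (carrier A) (\<lambda>x\<in>carrier B. x) \<phi> = \<phi>" if "\<phi> \<in> star_homs A B"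
    for A B :: "'a cstar" and \<phi>
  proof -
    have "\<phi> \<in> carrier A \<rightarrow> carrier B" "\<phi> \<in> extensional (carrier A)"
      using that by (auto simp: star_homs_def PiE_def)
    then show "compose (carrier A) \<phi> (\<lambda>x\<in>carrier A. x) = \<phi>"
      "compose (carrier A) (\<lambda>x\<in>carrier B. x) \<phi> = \<phi>"
      by (simp_all add: compose_Id Id_compose)
  qed
  have assoc: "compose (carrier A) \<omega> (compose (carrier A) \<psi> \<phi>) =
      compose (carrier A) (compose (carrier B) \<omega> \<psi>) \<phi>"
    if "\<phi> \<in> star_homs A B" for A B :: "'a cstar" and \<phi> \<psi> \<omega> :: "'a \<Rightarrow> 'a"
  proof -
    have "\<phi> \<in> carrier A \<rightarrow> carrier B" using that by (auto simp: star_homs_def)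
    then show ?thesis by (rule compose_assoc)
  qed
  show ?thesis
    unfolding is_category_def
    by (intro conjI ballI)
       (simp_all add: separable_cstar_category_def id cm idc assoc)
qed

lemma isos_separable_cstar:
  assumes "separable_cstar_algebra A" "separable_cstar_algebra B"
  shows "isos separable_cstar_category A B =
    {\<phi> \<in> star_homs A B. bij_betw \<phi> (carrier A) (carrier B)}"
proof (intro equalityI subsetI)
  fix \<phi> assume "\<phi> \<in> isos separable_cstar_category A B"
  then obtain \<psi> where h: "\<phi> \<in> star_homs A B" "\<psi> \<in> star_homs B A"
    "compose (carrier A) \<psi> \<phi> = (\<lambda>x\<in>carrier A. x)" "compose (carrier B) \<phi> \<psi> = (\<lambda>x\<in>carrier B. x)"
    by (auto simp: isos_def separable_cstar_category_def)
  have "bij_betw \<phi> (carrier A) (carrier B)"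
  proof (rule bij_betwI[where g = \<psi>])
    show "\<phi> \<in> carrier A \<rightarrow> carrier B" "\<psi> \<in> carrier B \<rightarrow> carrier A"
      using h by (auto simp: star_homs_def)
    show "\<psi> (\<phi> x) = x" if "x \<in> carrier A" for x
      using fun_cong[OF h(3), of x] that by (simp add: compose_def)
    show "\<phi> (\<psi> x) = x" if "x \<in> carrier B" for x
      using fun_cong[OF h(4), of x] that by (simp add: compose_def)
  qed
  then show "\<phi> \<in> {\<phi> \<in> star_homs A B. bij_betw \<phi> (carrier A) (carrier B)}" using h by simp
next
  fix \<phi> assume "\<phi> \<in> {\<phi> \<in> star_homs A B. bij_betw \<phi> (carrier A) (carrier B)}"
  then have \<phi>: "\<phi> \<in> star_homs A B" and bij: "bij_betw \<phi> (carrier A) (carrier B)" by auto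
  interpret A: cstar_algebra A using assms by (simp add: separable_cstar_algebra_def)
  interpret B: cstar_algebra B using assms by (simp add: separable_cstar_algebra_def)
  define \<psi> where "\<psi> = restrict (inv_into (carrier A) \<phi>) (carrier B)"
  have \<psi>: "\<psi> (\<phi> x) = x" if "x \<in> carrier A" for x
    using that bij by (simp add: \<psi>_def bij_betw_apply bij_betw_inv_into_left)
  have surj: "\<exists>x\<in>carrier A. y = \<phi> x" if "y \<in> carrier B" for y
    using that bij by (auto simp: bij_betw_def)
  have ext: "\<psi> \<in> carrier B \<rightarrow>\<^sub>E carrier A"
    using bij by (auto simp: \<psi>_def bij_betw_def inv_into_into)
  have hom: "\<phi> (x \<boxplus>\<^bsub>A\<^esub> y) = \<phi> x \<boxplus>\<^bsub>B\<^esub> \<phi> y" "\<phi> (x \<boxtimes>\<^bsub>A\<^esub> y) = \<phi> x \<boxtimes>\<^bsub>B\<^esub> \<phi> y"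
     "\<phi> (s \<boxdot>\<^bsub>A\<^esub> x) = s \<boxdot>\<^bsub>B\<^esub> \<phi> x" "\<phi> (cstar A x) = cstar B (\<phi> x)"
    if "x \<in> carrier A" "y \<in> carrier A" for x y s
    using \<phi> that by (auto simp: star_homs_def)
  have 1: "\<psi> (y \<boxplus>\<^bsub>B\<^esub> z) = \<psi> y \<boxplus>\<^bsub>A\<^esub> \<psi> z" if "y \<in> carrier B" "z \<in> carrier B" for y z
    by (metis surj \<psi> hom(1) A.add_closed that)
  have 2: "\<psi> (y \<boxtimes>\<^bsub>B\<^esub> z) = \<psi> y \<boxtimes>\<^bsub>A\<^esub> \<psi> z" if "y \<in> carrier B" "z \<in> carrier B" for y z
    by (metis surj \<psi> hom(2) A.mult_closed that)
  have 3: "\<psi> (s \<boxdot>\<^bsub>B\<^esub> z) = s \<boxdot>\<^bsub>A\<^esub> \<psi> z" if "z \<in> carrier B" for s z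
    by (metis surj \<psi> hom(3) A.scale_closed that)
  have 4: "\<psi> (cstar B z) = cstar A (\<psi> z)" if "z \<in> carrier B" for z
    by (metis surj \<psi> hom(4) A.star_closed that)
  have "\<psi> \<in> star_homs B A" using ext 1 2 3 4 by (auto simp: star_homs_def)
  moreover have "compose (carrier A) \<psi> \<phi> = (\<lambda>x\<in>carrier A. x)"
    using \<psi> by (auto simp: compose_def fun_eq_iff restrict_def)
  moreover have "compose (carrier B) \<phi> \<psi> = (\<lambda>x\<in>carrier B. x)"
  proof -
    have "\<phi> (\<psi> y) = y" if "y \<in> carrier B" for y using surj[OF that] \<psi> by auto
    then show ?thesis by (auto simp: compose_def fun_eq_iff restrict_def)
  qed
  ultimately show "\<phi> \<in> isos separable_cstar_category A B"
    using \<phi> by (auto simp: isos_def separable_cstar_category_def)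
qed

lemma is_category_full_subcategory:
  "is_category C \<Longrightarrow> full_subcategory B C \<Longrightarrow> is_category B"
  by (simp add: is_category_def full_subcategory_def subset_iff)

lemma group_Aut:
  assumes "is_category C" "x \<in> ob C" shows "group (Aut C x)"
proof (rule groupI)
  have assoc: "\<And>f g h. f \<in> mor C x x \<Longrightarrow> g \<in> mor C x x \<Longrightarrow> h \<in> mor C x x \<Longrightarrow>
     comp C x x x h (comp C x x x g f) = comp C x x x (comp C x x x h g) f"
   and cl: "\<And>f g. f \<in> mor C x x \<Longrightarrow> g \<in> mor C x x \<Longrightarrow> comp C x x x g f \<in> mor C x x"
   and id: "ident C x \<in> mor C x x" "\<And>f. f \<in> mor C x x \<Longrightarrow> comp C x x x f (ident C x) = f"
     "\<And>f. f \<in> mor C x x \<Longrightarrow> comp C x x x (ident C x) f = f"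
    using assms by (simp_all add: is_category_def)
  show "\<one>\<^bsub>Aut C x\<^esub> \<in> carrier (Aut C x)" using id by (auto simp: Aut_def isos_def)
  show "g \<otimes>\<^bsub>Aut C x\<^esub> f \<in> carrier (Aut C x)"
    if gf: "g \<in> carrier (Aut C x)" "f \<in> carrier (Aut C x)" for g f
  proof -
    obtain g' f' where *: "g \<in> mor C x x" "f \<in> mor C x x" "g' \<in> mor C x x" "f' \<in> mor C x x"
      "comp C x x x g' g = ident C x" "comp C x x x g g' = ident C x"
      "comp C x x x f' f = ident C x" "comp C x x x f f' = ident C x"
      using gf by (auto simp: Aut_def isos_def)
    have "comp C x x x (comp C x x x f' g') (comp C x x x g f) = ident C x"
      using * by (metis assoc cl id)
    moreover have "comp C x x x (comp C x x x g f) (comp C x x x f' g') = ident C x"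
      using * by (metis assoc cl id)
    ultimately show ?thesis using * cl by (auto simp: Aut_def isos_def)
  qed
  show "f \<otimes>\<^bsub>Aut C x\<^esub> g \<otimes>\<^bsub>Aut C x\<^esub> h = f \<otimes>\<^bsub>Aut C x\<^esub> (g \<otimes>\<^bsub>Aut C x\<^esub> h)"
    if "f \<in> carrier (Aut C x)" "g \<in> carrier (Aut C x)" "h \<in> carrier (Aut C x)" for f g h
    using that assoc by (simp add: Aut_def isos_def)
  show "\<one>\<^bsub>Aut C x\<^esub> \<otimes>\<^bsub>Aut C x\<^esub> f = f" if "f \<in> carrier (Aut C x)" for f
    using that id by (simp add: Aut_def isos_def)
  show "\<exists>g\<in>carrier (Aut C x). g \<otimes>\<^bsub>Aut C x\<^esub> f = \<one>\<^bsub>Aut C x\<^esub>" if "f \<in> carrier (Aut C x)" for f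
    using that by (auto simp: Aut_def isos_def)
qed

lemma is_category_equivariant:
  assumes "is_category C" "group G" shows "is_category (equivariant_category G C)"
proof -
  have id: "\<And>x. x \<in> ob C \<Longrightarrow> ident C x \<in> mor C x x"
    "\<And>x y f. \<lbrakk>x \<in> ob C; y \<in> ob C; f \<in> mor C x y\<rbrakk> \<Longrightarrow> comp C x x y f (ident C x) = f"
    "\<And>x y f. \<lbrakk>x \<in> ob C; y \<in> ob C; f \<in> mor C x y\<rbrakk> \<Longrightarrow> comp C x y y (ident C y) f = f"
    and cl: "\<And>x y z f g. \<lbrakk>x \<in> ob C; y \<in> ob C; z \<in> ob C; f \<in> mor C x y; g \<in> mor C y z\<rbrakk>
      \<Longrightarrow> comp C x y z g f \<in> mor C x z"
    and assoc: "\<And>w x y z f g h. \<lbrakk>w \<in> ob C; x \<in> ob C; y \<in> ob C; z \<in> ob C;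
      f \<in> mor C w x; g \<in> mor C x y; h \<in> mor C y z\<rbrakk>
      \<Longrightarrow> comp C w y z h (comp C w x y g f) = comp C w x z (comp C x y z h g) f"
    using assms by (simp_all add: is_category_def)
  have act: "\<gamma> g \<in> mor C x x" if "\<gamma> \<in> hom G (Aut C x)" "g \<in> carrier G" for \<gamma> g x
    using that by (auto simp: hom_def Aut_def isos_def Pi_iff)
  have eqv: "comp C x x z (comp C x y z g f) a = comp C x z z c (comp C x y z g f)"
    if o: "x \<in> ob C" "y \<in> ob C" "z \<in> ob C" and m: "f \<in> mor C x y" "g \<in> mor C y z"
      "a \<in> mor C x x" "b \<in> mor C y y" "c \<in> mor C z z"
      and e: "comp C x x y f a = comp C x y y b f" "comp C y y z g b = comp C y z z c g"
    for x y z f g a b c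
  proof -
    have "comp C x x z (comp C x y z g f) a = comp C x y z g (comp C x x y f a)"
      using assoc o m by simp
    also have "\<dots> = comp C x y z (comp C y y z g b) f"
      unfolding e(1) using assoc o m by simp
    also have "\<dots> = comp C x z z c (comp C x y z g f)"
      unfolding e(2) using assoc[of x y z z f g c] o m by simp
    finally show ?thesis .
  qed
  let ?E = "equivariant_category G C"
  have ob: "fst p \<in> ob C" "snd p \<in> hom G (Aut C (fst p))" if "p \<in> ob ?E" for p
    using that by (auto simp: equivariant_category_def)
  have mor: "f \<in> mor ?E p q \<longleftrightarrow> f \<in> mor C (fst p) (fst q) \<and> (\<forall>g\<in>carrier G.
     comp C (fst p) (fst p) (fst q) f (snd p g) = comp C (fst p) (fst q) (fst q) (snd q g) f)" for f p q
    by (simp add: equivariant_category_def split_beta)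
  have ops: "ident ?E p = ident C (fst p)" "comp ?E p q r = comp C (fst p) (fst q) (fst r)" for p q r
    by (simp_all add: equivariant_category_def split_beta)
  show ?thesis
    unfolding is_category_def ops
  proof (intro conjI ballI)
    fix p assume "p \<in> ob ?E"
    then show "ident C (fst p) \<in> mor ?E p p"
      using ob[of p] act by (simp add: mor id)
  next
    fix p q r f g assume h: "p \<in> ob ?E" "q \<in> ob ?E" "r \<in> ob ?E" "f \<in> mor ?E p q" "g \<in> mor ?E q r"
    show "comp C (fst p) (fst q) (fst r) g f \<in> mor ?E p r"
      unfolding mor
    proof (intro conjI ballI)
      show "comp C (fst p) (fst q) (fst r) g f \<in> mor C (fst p) (fst r)"
        using h ob cl by (simp add: mor)
      fix k assume k: "k \<in> carrier G"
      show "comp C (fst p) (fst p) (fst r) (comp C (fst p) (fst q) (fst r) g f) (snd p k) =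
            comp C (fst p) (fst r) (fst r) (snd r k) (comp C (fst p) (fst q) (fst r) g f)"
        by (rule eqv[where b = "snd q k"]) (use h ob act k in \<open>auto simp: mor\<close>)
    qed
  qed (use ob id assoc in \<open>simp_all add: mor\<close>)
qed

lemma full_subcategory_rokhlin:
  "full_subcategory (rokhlin_category G B) (equivariant_category G B)"
  by (auto simp: full_subcategory_def rokhlin_category_def)

lemma is_functor_equivariant:
  assumes C: "is_category C" and F: "is_functor C D F" "group G"
  shows "is_functor (equivariant_category G C) (equivariant_category G D) (equivariant_functor G F)"
proof -
  have F1: "fmor F x y f \<in> mor D (fob F x) (fob F y)" if "x \<in> ob C" "y \<in> ob C" "f \<in> mor C x y" for x y f
    using F that by (simp add: is_functor_def)
  have F0: "fob F x \<in> ob D" "fmor F x x (ident C x) = ident D (fob F x)" if "x \<in> ob C" for x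
    using F that by (simp_all add: is_functor_def)
  have F2: "fmor F x z (comp C x y z g f) =
       comp D (fob F x) (fob F y) (fob F z) (fmor F y z g) (fmor F x y f)"
    if "x \<in> ob C" "y \<in> ob C" "z \<in> ob C" "f \<in> mor C x y" "g \<in> mor C y z" for x y z f g
    using F that by (simp add: is_functor_def)
  have act: "\<gamma> g \<in> isos C x x" "\<gamma> g \<in> mor C x x" if "\<gamma> \<in> hom G (Aut C x)" "g \<in> carrier G" for \<gamma> g x
    using that by (auto simp: hom_def Aut_def isos_def Pi_iff)
  have iso: "fmor F x x f \<in> isos D (fob F x) (fob F x)" if x: "x \<in> ob C" and f: "f \<in> isos C x x" for x f
  proof -
    obtain g where g: "f \<in> mor C x x" "g \<in> mor C x x" "comp C x x x g f = ident C x" "comp C x x x f g = ident C x"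
      using f by (auto simp: isos_def)
    then show ?thesis
      unfolding isos_def using x F1[OF x x] F2[OF x x x, of f g] F2[OF x x x, of g f] F0[OF x] by auto
  qed
  have ob: "(\<lambda>g\<in>carrier G. fmor F x x (\<alpha> g)) \<in> hom G (Aut D (fob F x))"
    if x: "x \<in> ob C" and \<alpha>: "\<alpha> \<in> hom G (Aut C x)" for x \<alpha>
  proof -
    have "\<alpha> (g \<otimes>\<^bsub>G\<^esub> h) = comp C x x x (\<alpha> g) (\<alpha> h)" if "g \<in> carrier G" "h \<in> carrier G" for g h
      using \<alpha> that by (simp add: hom_def Aut_def)
    moreover have "g \<otimes>\<^bsub>G\<^esub> h \<in> carrier G" if "g \<in> carrier G" "h \<in> carrier G" for g h
      using that F(2) by (meson group.is_monoid monoid.m_closed)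
    ultimately show ?thesis
      using x act[OF \<alpha>] iso[OF x] F2[OF x x x] by (auto simp: hom_def Aut_def)
  qed
  let ?E = "equivariant_category G C" and ?E' = "equivariant_category G D"
  have obE: "fst p \<in> ob C" "snd p \<in> hom G (Aut C (fst p))" if "p \<in> ob ?E" for p
    using that by (auto simp: equivariant_category_def)
  have sel: "fob (equivariant_functor G F) p = (fob F (fst p), \<lambda>g\<in>carrier G. fmor F (fst p) (fst p) (snd p g))"
    "fmor (equivariant_functor G F) p q = fmor F (fst p) (fst q)"
    "ident ?E p = ident C (fst p)" "comp ?E p q r = comp C (fst p) (fst q) (fst r)"
    "ident ?E' p' = ident D (fst p')" "comp ?E' p' q' r' = comp D (fst p') (fst q') (fst r')"
    for p q r p' q' r'
    by (simp_all add: equivariant_functor_def equivariant_category_def split_beta)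
  have mor: "f \<in> mor ?E p q \<longleftrightarrow> f \<in> mor C (fst p) (fst q) \<and> (\<forall>g\<in>carrier G.
     comp C (fst p) (fst p) (fst q) f (snd p g) = comp C (fst p) (fst q) (fst q) (snd q g) f)" for f p q
    by (simp add: equivariant_category_def split_beta)
  have mor': "f \<in> mor ?E' p q \<longleftrightarrow> f \<in> mor D (fst p) (fst q) \<and> (\<forall>g\<in>carrier G.
     comp D (fst p) (fst p) (fst q) f (snd p g) = comp D (fst p) (fst q) (fst q) (snd q g) f)" for f p q
    by (simp add: equivariant_category_def split_beta)
  show ?thesis
    unfolding is_functor_def sel
  proof (intro conjI ballI)
    fix p assume "p \<in> ob ?E"
    then show "(fob F (fst p), \<lambda>g\<in>carrier G. fmor F (fst p) (fst p) (snd p g)) \<in> ob ?E'"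
      using F0 ob obE by (simp add: equivariant_category_def)
  next
    fix p q f assume h: "p \<in> ob ?E" "q \<in> ob ?E" "f \<in> mor ?E p q"
    show "fmor F (fst p) (fst q) f \<in> mor ?E'
      (fob F (fst p), \<lambda>g\<in>carrier G. fmor F (fst p) (fst p) (snd p g))
      (fob F (fst q), \<lambda>g\<in>carrier G. fmor F (fst q) (fst q) (snd q g))"
      unfolding mor'
    proof (intro conjI ballI; simp)
      show "fmor F (fst p) (fst q) f \<in> mor D (fob F (fst p)) (fob F (fst q))"
        using h F1 obE by (simp add: mor)
      fix g assume g: "g \<in> carrier G"
      have m: "f \<in> mor C (fst p) (fst q)" "snd p g \<in> mor C (fst p) (fst p)" "snd q g \<in> mor C (fst q) (fst q)"
        and e: "comp C (fst p) (fst p) (fst q) f (snd p g) = comp C (fst p) (fst q) (fst q) (snd q g) f"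
        using h g obE act by (auto simp: mor)
      show "comp D (fob F (fst p)) (fob F (fst p)) (fob F (fst q)) (fmor F (fst p) (fst q) f)
          (fmor F (fst p) (fst p) (snd p g)) =
        comp D (fob F (fst p)) (fob F (fst q)) (fob F (fst q)) (fmor F (fst q) (fst q) (snd q g))
          (fmor F (fst p) (fst q) f)"
        using h m obE by (simp add: F2[symmetric] e)
    qed
  qed (use obE F0 F2 in \<open>simp_all add: mor\<close>)
qed

text \<open>Approximate unitary equivalence without an action is the case of the trivial group.\<close>

lemma G_au_equiv_trivial:
  assumes "carrier G = {g}" and "\<beta> g = (\<lambda>x\<in>carrier B. x)"
  shows "G_au_equiv G (A, \<alpha>) (B, \<beta>) = au_equiv A B"
proof -
  have "{a \<in> carrier B. \<forall>h\<in>carrier G. \<beta> h a = a} = carrier B" using assms by auto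
  then have "fixed_point_algebra G B \<beta> = B" by (simp add: fixed_point_algebra_def)
  then show ?thesis by (simp add: G_au_equiv_def au_equiv_def)
qed

end

theory Submission
  imports Defs
begin

text \<open>The functor translates the problem into one about approximate unitary equivalence. Let \<open>\<rho>\<close> be an
isomorphism from \<open>F\<^sub>G(A, \<alpha>)\<close> to \<open>F\<^sub>G(B, \<beta>)\<close>. Let \<open>P\<close> be the class of homomorphisms \<open>A \<rightarrow> B\<close> that \<open>F\<close>
sends to \<open>\<rho>\<close>, and \<open>Q\<close> the class of homomorphisms \<open>B \<rightarrow> A\<close> that it sends to \<open>\<rho>\<inverse>\<close>. Both are full
approximate unitary equivalence classes, they are stable under \<open>\<phi> \<mapsto> \<beta>\<^sub>g \<circ> \<phi> \<circ> \<alpha>\<^sub>g\<inverse>\<close> (and its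
analogue for \<open>Q\<close>) because \<open>\<rho>\<close> is equivariant, and the composites of a member of \<open>P\<close> with a member of
\<open>Q\<close> are approximately unitarily equivalent to identities. From these properties the lemma
\<open>equivariant_bijection\<close> produces an equivariant isomorphism in \<open>P\<close>.

The Rokhlin property makes unitaries equivariant. A sequence of Rokhlin towers \<open>r\<^sub>n\<close> that becomes
central in a separable algebra \<open>S\<close> yields the maps \<open>y \<mapsto> \<Sum>\<^sub>g r\<^sub>n(g) y(g)\<close> (called \<open>glue\<close>) from
families \<open>G \<rightarrow> S\<close> to \<open>S\<close>. Asymptotically they are *-homomorphisms, they send constant families to
their value, and they turn translation of families into the action. Hence unitaries \<open>1 + b(g)\<close>
glue to approximate unitaries, which polar decomposition corrects to unitaries, and conjugation
by the result is the gluing of the conjugations (\<open>glue_unitaries\<close>). This is applied twice.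
If \<open>\<phi>\<close> and all \<open>\<beta>\<^sub>g \<circ> \<phi> \<circ> \<alpha>\<^sub>g\<inverse>\<close> are approximately unitarily equivalent, gluing the unitaries
that implement this makes \<open>\<phi>\<close> almost equivariant while moving it at most by a multiple of its defect
of equivariance, up to a given tolerance, so that an iteration converges to an equivariant map (\<open>exists_equivariant\<close>). If \<open>\<phi>\<close>
and \<open>\<psi>\<close> are equivariant and a unitary \<open>u\<close> almost conjugates one to the other, gluing the family
\<open>\<beta>\<^sub>g(u)\<close> gives a fixed unitary that does the same (\<open>equivariant_approx_equiv\<close>). This second
statement is also the uniqueness part of the classification. An Elliott intertwining within the
equivariant members of \<open>P\<close> and \<open>Q\<close> then gives the isomorphism (\<open>two_sided_intertwining\<close>).

No spectral theory enters. The two facts about C*-algebras that usually rest on it, contractivity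
of *-homomorphisms and polar decomposition near the unit, follow from square roots obtained as
fixed points of contractions.

Computations take place in a single unital C*-algebra that is a type: the bounded sections of the
unitizations of all C*-algebras over the element type \<open>'a\<close>. Every C*-algebra over \<open>'a\<close> is
isometrically a closed *-subalgebra of it, and its unitization is obtained by adding scalars.
Thus algebra, norms and limits come from type classes, and only membership in subalgebras has to
be tracked.\<close>

section \<open>Unital C*-algebras as a type class\<close>

text \<open>Complex scalars are encoded as real scalars together with the central element \<open>imu\<close>, the
imaginary unit; this makes the class an extension of real Banach algebras.\<close>

class unital_cstar = real_normed_algebra_1 + banach +
  fixes adj :: "'a \<Rightarrow> 'a" and imu :: 'a
  assumes adj_adj [simp]: "adj (adj x) = x"
    and adj_add: "adj (x + y) = adj x + adj y"
    and adj_mult: "adj (x * y) = adj y * adj x"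
    and adj_scaleR: "adj (c *\<^sub>R x) = c *\<^sub>R adj x"
    and adj_imu: "adj imu = - imu"
    and imu_imu: "imu * imu = - 1"
    and imu_central: "imu * x = x * imu"
    and cstar_norm: "norm (adj x * x) = (norm x)\<^sup>2"

lemma adj_zero [simp]: "adj (0::'u::unital_cstar) = 0"
  using adj_scaleR[of 0 "0::'u"] by simp
lemma adj_one [simp]: "adj (1::'u::unital_cstar) = 1"
  by (metis adj_adj adj_mult mult.left_neutral mult.right_neutral)
lemma adj_minus: "adj (- x) = - adj (x::'u::unital_cstar)"
  using adj_scaleR[of "-1" x] by simp
lemma adj_diff: "adj (x - y) = adj x - adj (y::'u::unital_cstar)"
  using adj_add[of x "- y"] by (simp add: adj_minus)
lemma adj_sum: "adj (sum f I) = (\<Sum>i\<in>I. adj (f i :: 'u::unital_cstar))"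
  by (induction I rule: infinite_finite_induct) (auto simp: adj_add)

lemmas adj_simps = adj_add adj_mult adj_scaleR adj_minus adj_diff adj_sum

lemma norm_adj [simp]: "norm (adj x) = norm (x::'u::unital_cstar)"
proof -
  have le: "norm y \<le> norm (adj y)" for y :: 'u
  proof (cases "norm y = 0")
    case False
    have "norm y * norm y \<le> norm (adj y) * norm y"
      using norm_mult_ineq[of "adj y" y] cstar_norm[of y] by (simp add: power2_eq_square)
    then show ?thesis using False by (simp add: mult_le_cancel_right)
  qed simp
  show ?thesis using le[of x] le[of "adj x"] by simp
qed

lemma bounded_linear_adj: "bounded_linear (adj :: 'u::unital_cstar \<Rightarrow> 'u)"
  by (rule bounded_linear_intro[where K = 1]) (auto simp: adj_simps)

lemmas tendsto_adj [tendsto_intros] = bounded_linear.tendsto[OF bounded_linear_adj]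
lemmas continuous_on_adj [continuous_intros] = bounded_linear.continuous_on[OF bounded_linear_adj]

lemma norm_imu_mult [simp]: "norm (imu * x) = norm (x::'u::unital_cstar)"
proof -
  have "adj (imu * x) * (imu * x) = adj x * x"
    by (simp add: adj_mult adj_imu mult.assoc) (metis imu_imu mult.assoc mult_minus1 minus_minus mult_minus_right)
  then have "(norm (imu * x))\<^sup>2 = (norm x)\<^sup>2" by (metis cstar_norm)
  then show ?thesis by simp
qed

definition unitary :: "'u::unital_cstar \<Rightarrow> bool" where
  "unitary u \<longleftrightarrow> adj u * u = 1 \<and> u * adj u = 1"

lemma norm_unitary: "unitary u \<Longrightarrow> norm u = 1"
  using cstar_norm[of u] norm_ge_zero[of u] by (auto simp: unitary_def power2_eq_1_iff)

lemma unitary_mult: "unitary u \<Longrightarrow> unitary v \<Longrightarrow> unitary (u * v)"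
  unfolding unitary_def adj_mult by (metis mult.assoc mult.right_neutral)

section \<open>Closed *-subalgebras and their homomorphisms\<close>

text \<open>The unit of the ambient algebra need not belong to the subalgebra; \<open>S + \<complex>1\<close> plays the role of
its unitization. A unitary of the unitization can be scaled to lie in \<open>1 + S\<close> without changing
its conjugation, which is why unitaries appear below as \<open>u\<close> with \<open>u - 1 \<in> S\<close>.\<close>

locale cstar_sub =
  fixes S :: "'u::unital_cstar set"
  assumes zero: "0 \<in> S" and add: "x \<in> S \<Longrightarrow> y \<in> S \<Longrightarrow> x + y \<in> S"
    and scaleR: "x \<in> S \<Longrightarrow> c *\<^sub>R x \<in> S" and imu: "x \<in> S \<Longrightarrow> imu * x \<in> S"
    and mult: "x \<in> S \<Longrightarrow> y \<in> S \<Longrightarrow> x * y \<in> S" and adj: "x \<in> S \<Longrightarrow> adj x \<in> S"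
    and closed: "closed S"
begin

lemma minus: "x \<in> S \<Longrightarrow> - x \<in> S"
  using scaleR[of x "-1"] by simp
lemma diff: "x \<in> S \<Longrightarrow> y \<in> S \<Longrightarrow> x - y \<in> S"
  using add[of x "- y"] minus by simp
lemma sum: "(\<And>i. i \<in> I \<Longrightarrow> f i \<in> S) \<Longrightarrow> sum f I \<in> S"
  by (induction I rule: infinite_finite_induct) (auto intro: zero add)

lemmas closure_rules = zero add scaleR imu mult adj minus diff

text \<open>The element \<open>1 - b\<close> is a square root of \<open>1 - a\<^sup>2\<close>. The equation for \<open>b\<close> says that it is a fixed
point of \<open>b \<mapsto> (a\<^sup>2 + b\<^sup>2) / 2\<close>, which is a contraction with constant \<open>norm a\<close> on the ball of
radius \<open>norm a\<close>. Commutation with \<open>a\<close> and self-adjointness are closed conditions preserved by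
this map, so they are imposed on the complete set in which the fixed point is sought.\<close>

lemma sqrt_one_minus_square:
  assumes a: "a \<in> S" "adj a = a" "norm a < 1"
  obtains b where "b \<in> S" "adj b = b" "a * b = b * a" "b + b = a * a + b * b"
proof -
  define t where "t = norm a"
  have t: "0 \<le> t" "t < 1" using a by (auto simp: t_def)
  define X where "X = {b \<in> S. adj b = b \<and> a * b = b * a \<and> norm b \<le> t}"
  have "X = S \<inter> {b. adj b = b} \<inter> {b. a * b = b * a} \<inter> {b. norm b \<le> t}" by (auto simp: X_def)
  moreover have "closed \<dots>"
    by (intro closed_Int closed closed_Collect_eq closed_Collect_le continuous_intros)
  ultimately have "complete X" by (simp add: complete_eq_closed)
  moreover have "0 \<in> X" using t zero by (auto simp: X_def)
  moreover have "(1/2) *\<^sub>R (a * a + b * b) \<in> X" if b: "b \<in> X" for b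
  proof -
    have "norm (a * a + b * b) \<le> norm a * norm a + norm b * norm b"
      by (meson norm_triangle_mono norm_mult_ineq)
    also have "\<dots> \<le> t * t + t * t"
      using b t by (intro add_mono mult_mono) (auto simp: X_def t_def)
    also have "\<dots> \<le> 2 * t" using mult_right_mono[of t 1 t] t by simp
    finally have "norm ((1/2) *\<^sub>R (a * a + b * b)) \<le> t" by simp
    moreover have "a * (a * a + b * b) = (a * a + b * b) * a"
      using b by (auto simp: X_def algebra_simps) (metis mult.assoc)
    ultimately show ?thesis
      using b a by (auto simp: X_def adj_simps intro!: closure_rules)
  qed
  moreover have "dist ((1/2) *\<^sub>R (a * a + b * b)) ((1/2) *\<^sub>R (a * a + c * c)) \<le> t * dist b c"
    if "b \<in> X" "c \<in> X" for b c
  proof -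
    have "(1/2) *\<^sub>R (a * a + b * b) - (1/2) *\<^sub>R (a * a + c * c) = (1/2) *\<^sub>R (b * (b - c) + (b - c) * c)"
      by (simp add: algebra_simps)
    moreover have "norm (b * (b - c) + (b - c) * c) \<le> t * norm (b - c) + norm (b - c) * t"
      using that t by (intro norm_triangle_mono order_trans[OF norm_mult_ineq] mult_mono) (auto simp: X_def)
    ultimately show ?thesis by (simp add: dist_norm)
  qed
  ultimately have "\<exists>!b\<in>X. (1/2) *\<^sub>R (a * a + b * b) = b"
    using t by (intro Banach_fix[where c = t]) auto
  then obtain b where b: "b \<in> X" "(1/2) *\<^sub>R (a * a + b * b) = b" by auto
  have "b + b = a * a + b * b"
    by (subst (1 2) b(2)[symmetric]) (simp add: scaleR_2[symmetric] del: scaleR_2)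
  then show ?thesis using that b by (auto simp: X_def)
qed

text \<open>With \<open>e = 1 - w\<^sup>* w\<close>, the unitary is \<open>u = w (1 + k)\<close> where \<open>1 + k\<close> is the inverse square root of
\<open>1 - e\<close>. Expanding \<open>(1 + k)\<^sup>2 (1 - e) = 1\<close> presents \<open>k\<close> as a fixed point of
\<open>k \<mapsto> (e + 2 k e + k\<^sup>2 e - k\<^sup>2) / 2\<close>, a contraction of the ball of radius \<open>d\<close> in the commutant
of \<open>e\<close>. The bound on \<open>w w\<^sup>* - 1\<close> yields \<open>u u\<^sup>* = 1\<close>.\<close>

lemma polar_decomposition:
  assumes w: "w - 1 \<in> S" and d: "norm (adj w * w - 1) \<le> d" "norm (w * adj w - 1) \<le> d" "d \<le> 1/4"
  obtains u where "unitary u" "u - 1 \<in> S" "norm (u - w) \<le> 2 * d"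
proof -
  define e where "e = 1 - adj w * w"
  have d0: "0 \<le> d" using d(1) norm_ge_zero order_trans by blast
  have "adj (w - 1) \<in> S" using w adj by blast
  then have eS: "e \<in> S"
  proof -
    have "e = - ((w - 1) + adj (w - 1) + adj (w - 1) * (w - 1))"
      by (simp add: e_def adj_simps algebra_simps)
    then show ?thesis using w \<open>adj (w - 1) \<in> S\<close> by (simp add: closure_rules del: minus_add_distrib)
  qed
  have ne: "norm e \<le> d" using d by (simp add: e_def norm_minus_commute)
  have adje: "adj e = e" by (simp add: e_def adj_simps)
  define X where "X = {k \<in> S. adj k = k \<and> e * k = k * e \<and> norm k \<le> d}"
  define f where "f = (\<lambda>k. (1/2) *\<^sub>R (e + 2 *\<^sub>R (k * e) + k * k * e - k * k))"
  have "X = S \<inter> {b. adj b = b} \<inter> {b. e * b = b * e} \<inter> {b. norm b \<le> d}" by (auto simp: X_def)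
  moreover have "closed \<dots>"
    by (intro closed_Int closed closed_Collect_eq closed_Collect_le continuous_intros)
  ultimately have "complete X" by (simp add: complete_eq_closed)
  moreover have "0 \<in> X" using d0 zero by (auto simp: X_def)
  moreover have "f k \<in> X" if k: "k \<in> X" for k
  proof -
    have nk: "norm k \<le> d" and com: "e * k = k * e" "adj k = k" and kS: "k \<in> S" using k by (auto simp: X_def)
    have kk: "norm (k * k) \<le> d * d" and ke: "norm (k * e) \<le> d * d"
      using nk ne d0 by (auto intro!: order_trans[OF norm_mult_ineq] mult_mono)
    have kke: "norm (k * k * e) \<le> d * d * d"
      using kk ne d0 by (auto intro!: order_trans[OF norm_mult_ineq[of "k * k"]] mult_mono)
    have "norm (e + 2 *\<^sub>R (k * e) + k * k * e - k * k) \<le> d + 2 * (d * d) + d * d * d + d * d"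
      using kk ke kke ne by (intro norm_triangle_le norm_triangle_le_diff add_mono) auto
    also have "\<dots> = d * (1 + 3 * d + d * d)" by (simp add: algebra_simps)
    also have "\<dots> \<le> d * (1 + 3 * (1/4) + (1/4) * (1/4))"
      using d0 d by (intro mult_left_mono add_mono mult_mono) auto
    also have "\<dots> \<le> d * 2" using d0 by (intro mult_left_mono) auto
    finally have "norm (f k) \<le> d" by (simp add: f_def)
    moreover have "e * f k = f k * e"
    proof -
      have *: "e * (k * e) = k * e * e" "e * (k * k) = k * k * e"  "e * (k * k * e) = k * k * e * e"
        by (metis com(1) mult.assoc)+
      show ?thesis
        by (simp only: f_def mult_scaleR_right mult_scaleR_left distrib_left distrib_right
            left_diff_distrib right_diff_distrib *)
    qed
    moreover have "adj (f k) = f k"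
    proof -
      have "e * (k * k) = k * k * e" by (metis com(1) mult.assoc)
      then show ?thesis using com adje by (simp add: f_def adj_simps)
    qed
    ultimately show ?thesis using kS eS by (auto simp: X_def f_def intro!: closure_rules)
  qed
  moreover have "dist (f k) (f l) \<le> (3/4) * dist k l" if "k \<in> X" "l \<in> X" for k l
  proof -
    have n: "norm k \<le> d" "norm l \<le> d" using that by (auto simp: X_def)
    have sq: "norm (k * k - l * l) \<le> 2 * d * norm (k - l)"
    proof -
      have "k * k - l * l = k * (k - l) + (k - l) * l" by (simp add: algebra_simps)
      moreover have "norm (k * (k - l) + (k - l) * l) \<le> d * norm (k - l) + norm (k - l) * d"
        using n d0 by (intro norm_triangle_mono order_trans[OF norm_mult_ineq] mult_mono) auto
      ultimately show ?thesis by simp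
    qed
    have "f k - f l = (k - l) * e + (1/2) *\<^sub>R ((k * k - l * l) * e - (k * k - l * l))"
      by (simp add: f_def algebra_simps)
    also have "norm \<dots> \<le> norm (k - l) * d + (1/2) * (2 * d * norm (k - l) * d + 2 * d * norm (k - l))"
      using ne sq d0
      by (intro norm_triangle_mono order_trans[OF norm_mult_ineq[of "k - l"]] mult_mono)
        (auto intro!: norm_triangle_le_diff add_mono order_trans[OF norm_mult_ineq[of "_ - _"]] mult_mono)
    also have "\<dots> = (2 * d + d * d) * norm (k - l)" by (simp add: algebra_simps)
    also have "\<dots> \<le> (3/4) * norm (k - l)"
    proof (rule mult_right_mono)
      have "d * d \<le> (1/4) * (1/4)" using d d0 by (intro mult_mono) auto
      then show "2 * d + d * d \<le> 3/4" using d by simp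
    qed simp
    finally show ?thesis by (simp add: dist_norm)
  qed
  ultimately have "\<exists>!k\<in>X. f k = k"
    by (intro Banach_fix[where c = "3/4"]) auto
  then obtain k where k: "k \<in> X" "f k = k" by auto
  have kS: "k \<in> S" "adj k = k" "e * k = k * e" "norm k \<le> d" using k by (auto simp: X_def)
  have fk: "k + k = e + 2 *\<^sub>R (k * e) + k * k * e - k * k"
  proof -
    have "2 *\<^sub>R k = 2 *\<^sub>R f k" using k by simp
    then show ?thesis by (simp add: f_def scaleR_2)
  qed
  define h where "h = 1 + k"
  have adjh: "adj h = h" by (simp add: h_def kS adj_simps)
  have ww: "adj w * w = 1 - e" by (simp add: e_def)
  have hhe: "h * h * (1 - e) = 1"
  proof -
    have "h * h * (1 - e) = 1 + (k + k) + k * k - e - 2 *\<^sub>R (k * e) - k * k * e"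
      by (simp add: h_def algebra_simps scaleR_2)
    then show ?thesis by (simp add: fk)
  qed
  have he: "(1 - e) * h = h * (1 - e)" using kS by (simp add: h_def algebra_simps)
  define u where "u = w * h"
  have "adj u * u = h * (adj w * w) * h" by (simp add: u_def adj_mult adjh mult.assoc)
  also have "\<dots> = 1" unfolding ww using he hhe by (simp add: mult.assoc)
  finally have uu: "adj u * u = 1" .
  \<comment> \<open>The defect \<open>p\<close> annihilates \<open>w\<close> from the left, hence also \<open>w w\<^sup>*\<close>, which is invertible.\<close>
  define p where "p = u * adj u - 1"
  have "u * adj u * w = w * (h * h * (adj w * w))" by (simp add: u_def adj_mult adjh mult.assoc)
  also have "\<dots> = w" by (simp add: ww hhe)
  finally have "p * w = 0" by (simp add: p_def algebra_simps)
  then have "p * (w * adj w) = 0" by (metis mult.assoc mult_zero_left)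
  then have "p = - (p * (w * adj w - 1))" by (simp add: algebra_simps)
  then have "norm p \<le> norm p * d"
    by (metis norm_minus_cancel norm_mult_ineq d(2) mult_left_mono norm_ge_zero order_trans)
  also have "\<dots> \<le> norm p * (1/4)" using d by (intro mult_left_mono) auto
  finally have "p = 0" by simp
  then have un: "unitary u" using uu by (simp add: unitary_def p_def)
  have "u - 1 = (w - 1) + k + (w - 1) * k" by (simp add: u_def h_def algebra_simps)
  also have "\<dots> \<in> S" using w kS by (intro add mult)
  finally have "u - 1 \<in> S" .
  moreover have "norm w \<le> 2"
  proof -
    have "(norm w)\<^sup>2 = norm (1 - e)" by (metis cstar_norm ww)
    also have "\<dots> \<le> 1 + d" using ne norm_triangle_ineq4[of 1 e] by simp
    also have "\<dots> \<le> 2\<^sup>2" using d by simp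
    finally show ?thesis by (rule power2_le_imp_le) simp
  qed
  then have "norm (w * k) \<le> 2 * d"
    using kS d0 by (intro order_trans[OF norm_mult_ineq] mult_mono) auto
  then have "norm (u - w) \<le> 2 * d" by (simp add: u_def h_def algebra_simps)
  ultimately show ?thesis using that un by blast
qed

end

definition star_hom :: "'u::unital_cstar set \<Rightarrow> 'u set \<Rightarrow> ('u \<Rightarrow> 'u) set" where
  "star_hom S T = {\<phi>. (\<forall>x\<in>S. \<phi> x \<in> T) \<and> (\<forall>x\<in>S. \<forall>y\<in>S. \<phi> (x + y) = \<phi> x + \<phi> y) \<and>
     (\<forall>x\<in>S. \<forall>y\<in>S. \<phi> (x * y) = \<phi> x * \<phi> y) \<and> (\<forall>c. \<forall>x\<in>S. \<phi> (c *\<^sub>R x) = c *\<^sub>R \<phi> x) \<and>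
     (\<forall>x\<in>S. \<phi> (imu * x) = imu * \<phi> x) \<and> (\<forall>x\<in>S. \<phi> (adj x) = adj (\<phi> x))}"

lemma star_homD:
  assumes "\<phi> \<in> star_hom S T"
  shows "x \<in> S \<Longrightarrow> \<phi> x \<in> T" "x \<in> S \<Longrightarrow> y \<in> S \<Longrightarrow> \<phi> (x + y) = \<phi> x + \<phi> y"
    "x \<in> S \<Longrightarrow> y \<in> S \<Longrightarrow> \<phi> (x * y) = \<phi> x * \<phi> y" "x \<in> S \<Longrightarrow> \<phi> (c *\<^sub>R x) = c *\<^sub>R \<phi> x"
    "x \<in> S \<Longrightarrow> \<phi> (imu * x) = imu * \<phi> x" "x \<in> S \<Longrightarrow> \<phi> (adj x) = adj (\<phi> x)"
  using assms by (auto simp: star_hom_def)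

lemma star_hom_comp:
  "\<phi> \<in> star_hom S T \<Longrightarrow> \<psi> \<in> star_hom T W \<Longrightarrow> (\<lambda>x. \<psi> (\<phi> x)) \<in> star_hom S W"
  by (simp add: star_hom_def)

text \<open>Conjugation by \<open>u\<close> maps \<open>T\<close> to itself even though \<open>u\<close> lies outside \<open>T\<close>, since \<open>T\<close> is an ideal
in \<open>T + \<complex>1\<close>.\<close>

lemma star_hom_conj_unitary:
  fixes u :: "'u::unital_cstar"
  assumes "cstar_sub T" "\<phi> \<in> star_hom S T" "unitary u" "u - 1 \<in> T"
  shows "(\<lambda>x. adj u * \<phi> x * u) \<in> star_hom S T"
proof -
  interpret T: cstar_sub T by fact
  have "adj u * x * u \<in> T" if "x \<in> T" for x
  proof -
    have "adj u * x * u = x + adj (u - 1) * x + x * (u - 1) + adj (u - 1) * x * (u - 1)"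
      by (simp add: adj_simps algebra_simps)
    also have "\<dots> \<in> T" using assms(4) that by (intro T.add T.mult T.adj)
    finally show ?thesis .
  qed
  moreover have "adj u * (x * y) * u = adj u * x * u * (adj u * y * u)" for x y
    using assms(3) unfolding unitary_def by (metis mult.assoc mult.right_neutral)
  moreover have "adj u * (imu * x) * u = imu * (adj u * x * u)" for x
    by (metis imu_central mult.assoc)
  ultimately show ?thesis using assms(2)
    by (auto simp: star_hom_def adj_simps algebra_simps)
qed

context cstar_sub
begin

lemma hom_diff:
  assumes "\<phi> \<in> star_hom S T" "x \<in> S" "y \<in> S" shows "\<phi> (x - y) = \<phi> x - \<phi> y"
proof -
  have "\<phi> (x + (- 1) *\<^sub>R y) = \<phi> x + (- 1) *\<^sub>R \<phi> y"
    using assms star_homD[OF assms(1)] scaleR[OF assms(3), of "-1"] by metis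
  then show ?thesis by simp
qed

lemma hom_zero:
  assumes "\<phi> \<in> star_hom S T" shows "\<phi> 0 = 0"
  using hom_diff[OF assms zero zero] by simp

lemma hom_sum:
  assumes "\<phi> \<in> star_hom S T" "\<And>i. i \<in> I \<Longrightarrow> f i \<in> S"
  shows "\<phi> (sum f I) = (\<Sum>i\<in>I. \<phi> (f i))"
  using assms(2)
  by (induction I rule: infinite_finite_induct)
    (auto simp: hom_zero[OF assms(1)] star_homD(2)[OF assms(1)] sum)

text \<open>A self-adjoint element of norm less than 1 has an image that is the imaginary part of a unitary:
if \<open>(1 - b)\<^sup>2 = 1 - a\<^sup>2\<close>, the images \<open>x\<close> of \<open>a\<close> and \<open>y\<close> of \<open>b\<close> satisfy the same relation, so that
\<open>1 - y + i x\<close> is unitary and \<open>norm x \<le> 1\<close>. The C*-identity reduces the general case to the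
self-adjoint one.\<close>

lemma hom_contractive:
  assumes \<phi>: "\<phi> \<in> star_hom S T" and "x \<in> S" shows "norm (\<phi> x) \<le> norm x"
proof -
  note h = star_homD[OF \<phi>]
  have unit_ball: "norm (\<phi> a) \<le> 1" if a: "a \<in> S" "adj a = a" "norm a < 1" for a
  proof -
    obtain b where b: "b \<in> S" "adj b = b" "a * b = b * a" "b + b = a * a + b * b"
      using sqrt_one_minus_square[OF a] .
    define x y where "x = \<phi> a" and "y = \<phi> b"
    have xy: "adj x = x" "adj y = y" "x * y = y * x" "y + y = x * x + y * y"
      using h a b mult[OF a(1) a(1)] mult[OF b(1) b(1)] unfolding x_def y_def by metis+
    define u where "u = 1 - y + imu * x"
    have adju: "adj u = 1 - y - imu * x"
      by (simp add: u_def adj_simps xy adj_imu imu_central)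
    have com: "y * (imu * x) = imu * x * y" by (metis imu_central mult.assoc xy(3))
    have ixix: "imu * x * (imu * x) = - (x * x)"
      by (metis imu_central imu_imu mult.assoc mult_minus1)
    have 1: "1 - y - y + y * y + x * x = 1" using xy(4) by (simp add: algebra_simps)
    have "adj u * u = 1 - y - y + y * y + x * x"
      unfolding adju unfolding u_def using com ixix by (simp add: algebra_simps)
    moreover have "u * adj u = 1 - y - y + y * y + x * x"
      unfolding adju unfolding u_def using com ixix by (simp add: algebra_simps)
    ultimately have "unitary u" using 1 by (simp add: unitary_def)
    then have "norm u = 1" "norm (adj u) = 1" by (simp_all add: norm_unitary)
    moreover have "2 *\<^sub>R (imu * x) = u - adj u" unfolding adju by (simp add: u_def scaleR_2)
    then have "norm (2 *\<^sub>R (imu * x)) \<le> norm u + norm (adj u)"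
      by (metis norm_triangle_ineq4)
    ultimately show ?thesis by (simp add: x_def)
  qed
  have selfadj: "norm (\<phi> a) \<le> norm a" if a: "a \<in> S" "adj a = a" for a
  proof (rule dense_ge)
    fix t assume t: "norm a < t"
    then have t0: "t > 0" using norm_ge_zero[of a] by linarith
    have "norm (\<phi> ((1/t) *\<^sub>R a)) \<le> 1"
      using t t0 a by (intro unit_ball) (auto simp: scaleR adj_simps)
    then show "norm (\<phi> a) \<le> t" using t0 a by (simp add: h field_simps)
  qed
  have "(norm (\<phi> x))\<^sup>2 = norm (\<phi> (adj x * x))"
    using assms(2) by (simp add: h adj flip: cstar_norm)
  also have "\<dots> \<le> norm (adj x * x)"
    using assms(2) by (intro selfadj) (auto simp: adj mult adj_simps)
  also have "\<dots> = (norm x)\<^sup>2" by (rule cstar_norm)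
  finally show ?thesis by (simp add: abs_le_square_iff[symmetric])
qed

lemma hom_dist_le:
  assumes "\<phi> \<in> star_hom S T" "x \<in> S" "y \<in> S" shows "norm (\<phi> x - \<phi> y) \<le> norm (x - y)"
  using hom_contractive[OF assms(1) diff[OF assms(2,3)]] hom_diff[OF assms] by simp

lemma hom_unitary:
  assumes "\<phi> \<in> star_hom S T" "b \<in> S" "unitary (1 + b)" shows "unitary (1 + \<phi> b)"
proof -
  note h = star_homD[OF assms(1)]
  have "b + adj b + adj b * b = 0" "b + adj b + b * adj b = 0"
    using assms(3) by (auto simp: unitary_def adj_simps algebra_simps)
  then have "\<phi> (b + adj b + adj b * b) = 0" "\<phi> (b + adj b + b * adj b) = 0"
    using hom_zero[OF assms(1)] by auto
  then have "\<phi> b + adj (\<phi> b) + adj (\<phi> b) * \<phi> b = 0" "\<phi> b + adj (\<phi> b) + \<phi> b * adj (\<phi> b) = 0"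
    using assms(2) by (simp_all add: h adj add mult)
  then show ?thesis by (simp add: unitary_def adj_simps algebra_simps)
qed

lemma hom_conj:
  assumes "\<phi> \<in> star_hom S T" "b \<in> S" "x \<in> S"
  shows "\<phi> (adj (1 + b) * x * (1 + b)) = adj (1 + \<phi> b) * \<phi> x * (1 + \<phi> b)"
proof -
  note h = star_homD[OF assms(1)]
  have "adj (1 + b) * x * (1 + b) = x + adj b * x + x * b + adj b * (x * b)"
    by (simp add: adj_simps algebra_simps)
  then have "\<phi> (adj (1 + b) * x * (1 + b)) = \<phi> x + adj (\<phi> b) * \<phi> x + \<phi> x * \<phi> b + adj (\<phi> b) * (\<phi> x * \<phi> b)"
    using assms(2,3) by (simp add: h adj add mult)
  then show ?thesis by (simp add: adj_simps algebra_simps)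
qed

text \<open>Contractivity makes the sequence equicontinuous, so convergence on a dense set suffices.\<close>

lemma hom_pointwise_limit:
  assumes T: "cstar_sub T" and f: "\<And>n. f n \<in> star_hom S T"
    and d: "range d \<subseteq> S" "S \<subseteq> closure (range d)"
    and C: "\<And>i. Cauchy (\<lambda>n. f n (d i))"
  obtains \<Phi> where "\<Phi> \<in> star_hom S T" "\<And>x. x \<in> S \<Longrightarrow> (\<lambda>n. f n x) \<longlonglongrightarrow> \<Phi> x"
proof -
  interpret T: cstar_sub T by fact
  have "Cauchy (\<lambda>n. f n x)" if x: "x \<in> S" for x
  proof (rule metric_CauchyI)
    fix e :: real assume e: "e > 0"
    obtain y where y: "y \<in> range d" "dist y x < e / 3"
      using x d(2) e closure_approachable[of x "range d"] by (metis subsetD zero_less_divide_iff zero_less_numeral)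
    then obtain i where i: "norm (d i - x) < e / 3" by (auto simp: dist_norm)
    obtain N where N: "\<And>m n. m \<ge> N \<Longrightarrow> n \<ge> N \<Longrightarrow> dist (f m (d i)) (f n (d i)) < e / 3"
      using metric_CauchyD[OF C[of i], of "e/3"] e by auto
    have near: "norm (f n (d i) - f n x) < e / 3" for n
      using hom_dist_le[OF f, of "d i" x n] x d(1) i by fastforce
    have "dist (f m x) (f n x) < e" if "m \<ge> N" "n \<ge> N" for m n
      using near[of m] near[of n] N[OF that] unfolding dist_norm by norm
    then show "\<exists>M. \<forall>m\<ge>M. \<forall>n\<ge>M. dist (f m x) (f n x) < e" by blast
  qed
  then have lim: "(\<lambda>n. f n x) \<longlonglongrightarrow> lim (\<lambda>n. f n x)" if "x \<in> S" for x
    using Cauchy_convergent that unfolding convergent_LIMSEQ_iff by blast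
  define \<Phi> where "\<Phi> x = lim (\<lambda>n. f n x)" for x
  note L = lim[folded \<Phi>_def]
  note h = star_homD[OF f]
  have "\<Phi> \<in> star_hom S T"
    unfolding star_hom_def
  proof (intro CollectI conjI ballI allI)
    fix x y c assume x: "x \<in> S"
    show "\<Phi> x \<in> T"
      by (rule closed_sequentially[OF T.closed _ L[OF x]]) (use h x in auto)
    show "\<Phi> (c *\<^sub>R x) = c *\<^sub>R \<Phi> x"
      using L[OF scaleR[OF x], of c] tendsto_scaleR[OF tendsto_const[of c] L[OF x]]
      by (simp add: h x LIMSEQ_unique)
    show "\<Phi> (imu * x) = imu * \<Phi> x"
      using L[OF imu[OF x]] tendsto_mult[OF tendsto_const L[OF x]] by (simp add: h x LIMSEQ_unique)
    show "\<Phi> (adj x) = adj (\<Phi> x)"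
      using L[OF adj[OF x]] tendsto_adj[OF L[OF x]] by (simp add: h x LIMSEQ_unique)
    assume y: "y \<in> S"
    show "\<Phi> (x + y) = \<Phi> x + \<Phi> y"
      using L[OF add[OF x y]] tendsto_add[OF L[OF x] L[OF y]] by (simp add: h x y LIMSEQ_unique)
    show "\<Phi> (x * y) = \<Phi> x * \<Phi> y"
      using L[OF mult[OF x y]] tendsto_mult[OF L[OF x] L[OF y]] by (simp add: h x y LIMSEQ_unique)
  qed
  with L show ?thesis using that by blast
qed

end

section \<open>Asymptotic equality of sequences\<close>

definition asymptotic :: "(nat \<Rightarrow> 'u::real_normed_vector) \<Rightarrow> (nat \<Rightarrow> 'u) \<Rightarrow> bool" (infix "\<doteq>" 50) where
  "X \<doteq> Y \<longleftrightarrow> (\<lambda>n. X n - Y n) \<longlonglongrightarrow> 0"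

lemma asym_refl [simp]: "X \<doteq> X" by (simp add: asymptotic_def)
lemma asym_sym: "X \<doteq> Y \<Longrightarrow> Y \<doteq> X"
  unfolding asymptotic_def using tendsto_minus[of "\<lambda>n. X n - Y n" 0] by simp
lemma asym_trans [trans]: "X \<doteq> Y \<Longrightarrow> Y \<doteq> Z \<Longrightarrow> X \<doteq> Z"
  unfolding asymptotic_def using tendsto_add[of "\<lambda>n. X n - Y n" 0 _ "\<lambda>n. Y n - Z n" 0] by simp
lemma asym_add: "X \<doteq> X' \<Longrightarrow> Y \<doteq> Y' \<Longrightarrow> (\<lambda>n. X n + Y n) \<doteq> (\<lambda>n. X' n + Y' n)"
  unfolding asymptotic_def using tendsto_add[of "\<lambda>n. X n - X' n" 0 _ "\<lambda>n. Y n - Y' n" 0]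
  by (simp add: algebra_simps)
lemma asym_sum: "(\<And>i. i \<in> I \<Longrightarrow> X i \<doteq> Y i) \<Longrightarrow> (\<lambda>n. \<Sum>i\<in>I. X i n) \<doteq> (\<lambda>n. \<Sum>i\<in>I. Y i n)"
  unfolding asymptotic_def sum_subtractf[symmetric] by (rule tendsto_null_sum)
lemma asym_scaleR: "X \<doteq> Y \<Longrightarrow> (\<lambda>n. c *\<^sub>R X n) \<doteq> (\<lambda>n. c *\<^sub>R Y n)"
  unfolding asymptotic_def scaleR_diff_right[symmetric] using tendsto_scaleR[OF tendsto_const, of _ 0 _ c] by simp
lemma asym_adj: "X \<doteq> Y \<Longrightarrow> (\<lambda>n. adj (X n)) \<doteq> (\<lambda>n. adj (Y n))"
  unfolding asymptotic_def using tendsto_adj[of "\<lambda>n. X n - Y n" 0] by (simp add: adj_simps)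
lemma asym_mult:
  fixes X :: "nat \<Rightarrow> 'u::real_normed_algebra"
  assumes "X \<doteq> X'" "Y \<doteq> Y'" "Bseq X'" "Bseq Y"
  shows "(\<lambda>n. X n * Y n) \<doteq> (\<lambda>n. X' n * Y' n)"
proof -
  have "(\<lambda>n. (X n - X' n) * Y n) \<longlonglongrightarrow> 0" "(\<lambda>n. X' n * (Y n - Y' n)) \<longlonglongrightarrow> 0"
    using assms unfolding asymptotic_def tendsto_Zfun_iff
    by (auto intro: bounded_bilinear.Zfun_prod_Bfun[OF bounded_bilinear_mult]
        bounded_bilinear.Bfun_prod_Zfun[OF bounded_bilinear_mult])
  then have "(\<lambda>n. (X n - X' n) * Y n + X' n * (Y n - Y' n)) \<longlonglongrightarrow> 0 + 0" by (rule tendsto_add)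
  then show ?thesis unfolding asymptotic_def by (simp add: algebra_simps)
qed
lemma asym_eventually: "X \<doteq> Y \<Longrightarrow> 0 < e \<Longrightarrow> eventually (\<lambda>n. norm (X n - Y n) < e) sequentially"
  unfolding asymptotic_def using tendstoD by fastforce
lemma asym_const_iff: "X \<doteq> (\<lambda>_. x) \<longleftrightarrow> X \<longlonglongrightarrow> x"
  unfolding asymptotic_def by (rule LIM_zero_iff)
lemma asym_Bseq:
  assumes "X \<doteq> Y" "Bseq Y" shows "Bseq X"
proof -
  have "Bseq (\<lambda>n. X n - Y n)"
    using assms(1) by (auto simp: asymptotic_def intro: convergent_imp_Bseq convergentI)
  then obtain K where K: "\<And>n. norm (X n - Y n) \<le> K" by (auto simp: Bseq_def)
  obtain L where L: "\<And>n. norm (Y n) \<le> L" using assms(2) by (auto simp: Bseq_def)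
  have "norm (X n) \<le> K + L" for n using K[of n] L[of n] norm_triangle_sub[of "X n" "Y n"] by linarith
  then show ?thesis by (rule BseqI')
qed

text \<open>The form in which polar decomposition is used: an asymptotically unitary sequence in \<open>1 + S\<close> is
asymptotically equal to a sequence of unitaries in \<open>1 + S\<close>.\<close>

lemma (in cstar_sub) polar_sequence:
  assumes W: "\<And>n. W n - 1 \<in> S" and lim: "(\<lambda>n. adj (W n) * W n) \<longlonglongrightarrow> 1" "(\<lambda>n. W n * adj (W n)) \<longlonglongrightarrow> 1"
  obtains V where "\<And>n. unitary (V n)" "\<And>n. V n - 1 \<in> S" "V \<doteq> W"
proof -
  define d where "d n = max (norm (adj (W n) * W n - 1)) (norm (W n * adj (W n) - 1))" for n
  have "(\<lambda>n. norm (adj (W n) * W n - 1)) \<longlonglongrightarrow> 0" "(\<lambda>n. norm (W n * adj (W n) - 1)) \<longlonglongrightarrow> 0"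
    using lim by (auto intro!: tendsto_norm_zero simp: LIM_zero_iff)
  then have "d \<longlonglongrightarrow> max 0 0" unfolding d_def by (rule tendsto_max)
  then have d: "d \<longlonglongrightarrow> 0" by simp
  have "\<exists>v. unitary v \<and> v - 1 \<in> S \<and> (d n \<le> 1/4 \<longrightarrow> norm (v - W n) \<le> 2 * d n)" for n
  proof (cases "d n \<le> 1/4")
    case True
    then show ?thesis
      using polar_decomposition[OF W[of n], of "d n"] by (metis d_def max.cobounded1 max.cobounded2)
  next
    case False
    then show ?thesis using zero by (intro exI[of _ 1]) (auto simp: unitary_def)
  qed
  then obtain V where V: "\<And>n. unitary (V n)" "\<And>n. V n - 1 \<in> S" "\<And>n. d n \<le> 1/4 \<Longrightarrow> norm (V n - W n) \<le> 2 * d n"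
    by metis
  have "eventually (\<lambda>n. d n \<le> 1/4) sequentially"
    using order_tendstoD(2)[OF d, of "1/4"] by (auto elim: eventually_mono)
  then have "eventually (\<lambda>n. norm (V n - W n) \<le> 2 * d n) sequentially"
    by (rule eventually_mono) (rule V)
  moreover have "(\<lambda>n. 2 * d n) \<longlonglongrightarrow> 0" using tendsto_mult_right_zero[OF d] by simp
  ultimately have "V \<doteq> W" unfolding asymptotic_def by (rule Lim_null_comparison)
  with V show ?thesis using that by blast
qed

lemma Bseq_product:
  fixes X :: "nat \<Rightarrow> 'u::real_normed_algebra"
  assumes "Bseq X" "Bseq Y" shows "Bseq (\<lambda>n. X n * Y n)"
proof -
  obtain K L where K: "\<And>n. norm (X n) \<le> K" and L: "\<And>n. norm (Y n) \<le> L"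
    using assms by (auto simp: Bseq_def)
  have "norm (X n * Y n) \<le> K * L" for n
    using K[of n] L[of n] order_trans[OF norm_ge_zero K[of n]]
    by (intro order_trans[OF norm_mult_ineq] mult_mono) auto
  then show ?thesis by (rule BseqI')
qed

section \<open>Dynamical systems and Rokhlin towers\<close>

locale dynamical_system = cstar_sub S + group G
  for S :: "'u::unital_cstar set" and G :: "'g monoid" (structure) +
  fixes \<sigma> :: "'g \<Rightarrow> 'u \<Rightarrow> 'u"
  assumes finite_G: "finite (carrier G)"
    and separable: "\<exists>d::nat \<Rightarrow> 'u. range d \<subseteq> S \<and> S \<subseteq> closure (range d)"
    and action_hom: "g \<in> carrier G \<Longrightarrow> \<sigma> g \<in> star_hom S S"
    and action_mult: "g \<in> carrier G \<Longrightarrow> h \<in> carrier G \<Longrightarrow> x \<in> S \<Longrightarrow> \<sigma> (g \<otimes> h) x = \<sigma> g (\<sigma> h x)"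
    and action_one: "x \<in> S \<Longrightarrow> \<sigma> \<one> x = x"
begin

abbreviation "fixed \<equiv> {x \<in> S. \<forall>g\<in>carrier G. \<sigma> g x = x}"

lemma action_closed: "g \<in> carrier G \<Longrightarrow> x \<in> S \<Longrightarrow> \<sigma> g x \<in> S"
  using star_homD(1)[OF action_hom] .

lemma action_inv: "g \<in> carrier G \<Longrightarrow> x \<in> S \<Longrightarrow> \<sigma> g (\<sigma> (inv g) x) = x"
  by (metis action_mult action_one inv_closed r_inv)

lemma action_inv': "g \<in> carrier G \<Longrightarrow> x \<in> S \<Longrightarrow> \<sigma> (inv g) (\<sigma> g x) = x"
  by (metis action_mult action_one inv_closed l_inv)

lemma norm_action_le: "g \<in> carrier G \<Longrightarrow> x \<in> S \<Longrightarrow> norm (\<sigma> g x) \<le> norm x"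
  using hom_contractive[OF action_hom] .

lemma sum_translate:
  assumes "g \<in> carrier G"
  shows "(\<Sum>h\<in>carrier G. f (g \<otimes> h)) = (\<Sum>h\<in>carrier G. f h)"
proof (rule sum.reindex_bij_betw)
  show "bij_betw ((\<otimes>) g) (carrier G) (carrier G)"
    using assms by (intro bij_betwI[where g = "(\<otimes>) (inv g)"]) (auto simp: m_assoc[symmetric])
qed

lemma cstar_sub_fixed: "cstar_sub fixed"
proof
  note h = star_homD[OF action_hom]
  show "closed fixed"
    unfolding closed_sequential_limits
  proof (intro allI impI, elim conjE)
    fix x l assume x: "\<forall>n. x n \<in> fixed" and l: "x \<longlonglongrightarrow> l"
    have lS: "l \<in> S" using closed_sequentially[OF closed _ l] x by auto
    have "\<sigma> g l = l" if g: "g \<in> carrier G" for g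
    proof -
      have "norm (\<sigma> g (x n) - \<sigma> g l) \<le> norm (x n - l)" for n
        using x lS g by (intro hom_dist_le[OF action_hom]) auto
      then have "(\<lambda>n. \<sigma> g (x n) - \<sigma> g l) \<longlonglongrightarrow> 0"
        using l by - (rule Lim_transform_bound[where g = "\<lambda>n. x n - l"], auto simp: LIM_zero)
      then have "x \<longlonglongrightarrow> \<sigma> g l" using x g by (simp add: LIM_zero_iff)
      then show ?thesis using l LIMSEQ_unique by blast
    qed
    then show "l \<in> fixed" using lS by simp
  qed
qed (auto simp: star_homD[OF action_hom] zero add scaleR imu mult adj hom_zero[OF action_hom])

definition average :: "'u \<Rightarrow> 'u" where
  "average x = (1 / card (carrier G)) *\<^sub>R (\<Sum>g\<in>carrier G. \<sigma> g x)"

lemma card_G: "card (carrier G) > 0"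
  using finite_G by (auto simp: card_gt_0_iff)

lemma average_fixed:
  assumes x: "x \<in> S" shows "average x \<in> fixed"
proof -
  have s: "(\<Sum>g\<in>carrier G. \<sigma> g x) \<in> S" using x by (intro sum) (auto simp: action_closed)
  have "\<sigma> h (average x) = average x" if h: "h \<in> carrier G" for h
  proof -
    have "\<sigma> h (\<Sum>g\<in>carrier G. \<sigma> g x) = (\<Sum>g\<in>carrier G. \<sigma> h (\<sigma> g x))"
      using x h by (intro hom_sum[OF action_hom]) (auto simp: action_closed)
    also have "\<dots> = (\<Sum>g\<in>carrier G. \<sigma> (h \<otimes> g) x)"
      using x h by (simp add: action_mult)
    also have "\<dots> = (\<Sum>g\<in>carrier G. \<sigma> g x)" by (rule sum_translate[OF h])
    finally show ?thesis using s h by (simp add: average_def star_homD(4)[OF action_hom])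
  qed
  then show ?thesis using s by (simp add: average_def scaleR)
qed

lemma asym_action:
  assumes "X \<doteq> Y" "\<And>n. X n \<in> S" "\<And>n. Y n \<in> S" "g \<in> carrier G"
  shows "(\<lambda>n. \<sigma> g (X n)) \<doteq> (\<lambda>n. \<sigma> g (Y n))"
proof -
  have "norm (\<sigma> g (X n) - \<sigma> g (Y n)) \<le> norm (X n - Y n)" for n
    using assms by (intro hom_dist_le[OF action_hom]) auto
  then show ?thesis
    using assms(1) unfolding asymptotic_def
    by - (rule Lim_transform_bound[where g = "\<lambda>n. X n - Y n"], auto)
qed

end

definition approx_tower ::
  "'g monoid \<Rightarrow> 'u::unital_cstar set \<Rightarrow> ('g \<Rightarrow> 'u \<Rightarrow> 'u) \<Rightarrow> real \<Rightarrow> 'u set \<Rightarrow> ('g \<Rightarrow> 'u) \<Rightarrow> bool" where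
  "approx_tower G S \<sigma> \<epsilon> F r \<longleftrightarrow>
     (\<forall>g\<in>carrier G. r g \<in> S \<and> adj (r g) = r g \<and> norm (r g) \<le> 1) \<and>
     (\<forall>g\<in>carrier G. \<forall>h\<in>carrier G. g \<noteq> h \<longrightarrow> r g * r h = 0) \<and>
     (\<forall>g\<in>carrier G. \<forall>h\<in>carrier G. norm (\<sigma> g (r h) - r (g \<otimes>\<^bsub>G\<^esub> h)) < \<epsilon>) \<and>
     (\<forall>a\<in>F. \<forall>g\<in>carrier G. norm (r g * a - a * r g) < \<epsilon>) \<and>
     (\<forall>a\<in>F. norm ((\<Sum>g\<in>carrier G. r g) * a - a) < \<epsilon>)"

definition rokhlin :: "'g monoid \<Rightarrow> 'u::unital_cstar set \<Rightarrow> ('g \<Rightarrow> 'u \<Rightarrow> 'u) \<Rightarrow> bool" where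
  "rokhlin G S \<sigma> \<longleftrightarrow> (\<forall>\<epsilon>>0. \<forall>F. finite F \<and> F \<subseteq> S \<longrightarrow> (\<exists>r. approx_tower G S \<sigma> \<epsilon> F r))"

text \<open>A sequence of Rokhlin towers for which all the approximate relations hold in the limit and for
every element of the algebra at once.\<close>

locale tower = dynamical_system S G \<sigma>
  for S :: "'u::unital_cstar set" and G :: "'g monoid" (structure) and \<sigma> :: "'g \<Rightarrow> 'u \<Rightarrow> 'u" +
  fixes r :: "nat \<Rightarrow> 'g \<Rightarrow> 'u"
  assumes tower_in: "g \<in> carrier G \<Longrightarrow> r n g \<in> S"
    and tower_adj: "g \<in> carrier G \<Longrightarrow> adj (r n g) = r n g"
    and tower_norm: "g \<in> carrier G \<Longrightarrow> norm (r n g) \<le> 1"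
    and tower_orth: "g \<in> carrier G \<Longrightarrow> h \<in> carrier G \<Longrightarrow> g \<noteq> h \<Longrightarrow> r n g * r n h = 0"
    and tower_equivariant:
      "g \<in> carrier G \<Longrightarrow> h \<in> carrier G \<Longrightarrow> (\<lambda>n. \<sigma> g (r n h)) \<doteq> (\<lambda>n. r n (g \<otimes> h))"
    and tower_central: "g \<in> carrier G \<Longrightarrow> a \<in> S \<Longrightarrow> (\<lambda>n. r n g * a) \<doteq> (\<lambda>n. a * r n g)"
    and tower_unit: "a \<in> S \<Longrightarrow> (\<lambda>n. (\<Sum>g\<in>carrier G. r n g) * a) \<doteq> (\<lambda>_. a)"

text \<open>The \<open>n\<close>-th tower is chosen for the first \<open>n + 1\<close> members of a dense sequence and precision
\<open>1 / (n + 1)\<close>. The relations extend from the dense sequence to the whole algebra because both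
sides are Lipschitz in the element, uniformly in \<open>n\<close>.\<close>

lemma (in dynamical_system) rokhlin_tower:
  assumes "rokhlin G S \<sigma>"
  obtains r where "tower S G \<sigma> r"
proof -
  obtain d :: "nat \<Rightarrow> 'u" where d: "range d \<subseteq> S" "S \<subseteq> closure (range d)" using separable by blast
  have "\<exists>r. approx_tower G S \<sigma> (inverse (real (Suc n))) (d ` {..n}) r" for n
  proof -
    have "finite (d ` {..n}) \<and> d ` {..n} \<subseteq> S" "inverse (real (Suc n)) > 0" using d(1) by auto
    then show ?thesis using assms unfolding rokhlin_def by blast
  qed
  then obtain r where "\<And>n. approx_tower G S \<sigma> (inverse (real (Suc n))) (d ` {..n}) (r n)" by metis
  note r = this[unfolded approx_tower_def]
  have null: "X \<doteq> Y" if "eventually (\<lambda>n. norm (X n - Y n) < inverse (real (Suc n))) sequentially"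
    for X Y :: "nat \<Rightarrow> 'u"
    unfolding asymptotic_def
    by (rule Lim_null_comparison[OF _ LIMSEQ_inverse_real_of_nat]) (use that in \<open>auto elim: eventually_mono\<close>)
  \<comment> \<open>Two families of uniformly Lipschitz maps that agree asymptotically on the dense sequence agree
asymptotically everywhere.\<close>
  have dense: "(\<lambda>n. L n a) \<doteq> (\<lambda>n. R n a)"
    if a: "a \<in> S" and gen: "\<And>i. (\<lambda>n. L n (d i)) \<doteq> (\<lambda>n. R n (d i))"
      and lip: "\<And>n x y. norm (L n x - L n y) \<le> K * norm (x - y)" "\<And>n x y. norm (R n x - R n y) \<le> K * norm (x - y)"
    for L R :: "nat \<Rightarrow> 'u \<Rightarrow> 'u" and K a
  proof -
    have "eventually (\<lambda>n. norm (L n a - R n a) < e) sequentially" if e: "e > 0" for e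
    proof -
      define K' where "K' = max K 1"
      have K': "K' \<ge> K" "K' > 0" by (auto simp: K'_def)
      have "e / (3 * K') > 0" using e K' by simp
      then obtain i where i: "norm (a - d i) < e / (3 * K')"
        using a d(2) closure_approachable[of a "range d"] by (auto simp: dist_norm norm_minus_commute)
      have K3: "K * norm (a - d i) < e / 3"
      proof -
        have "K * norm (a - d i) \<le> K' * norm (a - d i)" using K' by (intro mult_right_mono) auto
        also have "\<dots> < e / 3" using i K' by (simp add: field_simps)
        finally show ?thesis .
      qed
      have "eventually (\<lambda>n. norm (L n (d i) - R n (d i)) < e / 3) sequentially"
        using gen e by (intro asym_eventually) auto
      then show ?thesis
      proof (rule eventually_mono)
        fix n assume *: "norm (L n (d i) - R n (d i)) < e / 3"
        have "norm (L n a - L n (d i)) < e / 3" "norm (R n a - R n (d i)) < e / 3"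
          using lip[of n a "d i"] K3 by linarith+
        with * show "norm (L n a - R n a) < e" by norm
      qed
    qed
    then show ?thesis unfolding asymptotic_def by (intro tendstoI) (simp add: dist_norm)
  qed
  have sum_le: "norm (\<Sum>g\<in>carrier G. r n g) \<le> card (carrier G)" for n
    using r[of n] sum_norm_le[of "carrier G" "r n" "\<lambda>_. 1"] by simp
  have "tower S G \<sigma> r"
  proof
    fix g h a assume g: "g \<in> carrier G"
    note nr = mult_right_mono[OF r[THEN conjunct1, rule_format, OF g, THEN conjunct2, THEN conjunct2] norm_ge_zero]
    show "(\<lambda>n. \<sigma> g (r n h)) \<doteq> (\<lambda>n. r n (g \<otimes> h))" if "h \<in> carrier G"
      using r g that by (intro null) auto
    show "(\<lambda>n. r n g * a) \<doteq> (\<lambda>n. a * r n g)" if a: "a \<in> S"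
    proof (rule dense[OF a, where K = 1])
      show "(\<lambda>n. r n g * d i) \<doteq> (\<lambda>n. d i * r n g)" for i
      proof (rule null, rule eventually_sequentiallyI)
        show "norm (r n g * d i - d i * r n g) < inverse (real (Suc n))" if "i \<le> n" for n
          using r[of n] g that by auto
      qed
      show "norm (r n g * x - r n g * y) \<le> 1 * norm (x - y)" for n x y
        unfolding right_diff_distrib[symmetric] using nr by (rule order_trans[OF norm_mult_ineq])
      show "norm (x * r n g - y * r n g) \<le> 1 * norm (x - y)" for n x y
        unfolding left_diff_distrib[symmetric] using nr[of n "x - y"]
        by (intro order_trans[OF norm_mult_ineq]) (simp add: mult.commute)
    qed
  next
    fix a assume a: "a \<in> S"
    show "(\<lambda>n. (\<Sum>g\<in>carrier G. r n g) * a) \<doteq> (\<lambda>_. a)"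
    proof (rule dense[OF a, where K = "card (carrier G)" and R = "\<lambda>_ x. x"])
      show "(\<lambda>n. (\<Sum>g\<in>carrier G. r n g) * d i) \<doteq> (\<lambda>_. d i)" for i
      proof (rule null, rule eventually_sequentiallyI)
        show "norm ((\<Sum>g\<in>carrier G. r n g) * d i - d i) < inverse (real (Suc n))" if "i \<le> n" for n
          using r[of n] that by auto
      qed
      show "norm ((\<Sum>g\<in>carrier G. r n g) * x - (\<Sum>g\<in>carrier G. r n g) * y) \<le> card (carrier G) * norm (x - y)"
        for n x y
        unfolding right_diff_distrib[symmetric]
        by (rule order_trans[OF norm_mult_ineq mult_right_mono[OF sum_le norm_ge_zero]])
      show "norm (x - y) \<le> card (carrier G) * norm (x - y)" for x y
        using card_G mult_right_mono[of 1 "real (card (carrier G))" "norm (x - y)"] by simp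
    qed
  qed (use r in auto)
  then show ?thesis by (rule that)
qed

context tower
begin

text \<open>For large \<open>n\<close> the map \<open>y \<mapsto> glue y n\<close> behaves like an equivariant *-homomorphism from the algebra of
families \<open>G \<rightarrow> S\<close>, on which \<open>G\<close> acts by translation combined with \<open>\<sigma>\<close>, that is left inverse
to the inclusion of constant families. The lemmas below make this precise up to sequences that
tend to zero.\<close>

definition glue :: "('g \<Rightarrow> 'u) \<Rightarrow> nat \<Rightarrow> 'u" where
  "glue y n = (\<Sum>g\<in>carrier G. r n g * y g)"

abbreviation "family y \<equiv> y \<in> carrier G \<rightarrow> S"

lemma glue_in: "family y \<Longrightarrow> glue y n \<in> S"
  unfolding glue_def by (intro sum mult tower_in) auto

lemma glue_add: "glue y n + glue z n = glue (\<lambda>g. y g + z g) n"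
  by (simp add: glue_def distrib_left sum.distrib)

lemma glue_cong: "(\<And>g. g \<in> carrier G \<Longrightarrow> y g = z g) \<Longrightarrow> glue y = glue z"
  by (auto simp: glue_def fun_eq_iff)

lemma norm_glue_diff_le: "norm (glue y n - glue z n) \<le> (\<Sum>g\<in>carrier G. norm (y g - z g))"
  unfolding glue_def sum_subtractf[symmetric] right_diff_distrib[symmetric]
proof (rule sum_norm_le)
  fix g assume "g \<in> carrier G"
  then show "norm (r n g * (y g - z g)) \<le> norm (y g - z g)"
    using mult_right_mono[OF tower_norm norm_ge_zero] by (intro order_trans[OF norm_mult_ineq]) fastforce
qed

lemma Bseq_glue: "Bseq (glue y)"
proof (rule BseqI')
  show "norm (glue y n) \<le> (\<Sum>g\<in>carrier G. norm (y g))" for n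
    using norm_glue_diff_le[of y n "\<lambda>_. 0"] by (simp add: glue_def)
qed

lemma Bseq_tower: "g \<in> carrier G \<Longrightarrow> Bseq (\<lambda>n. r n g)"
  by (rule BseqI') (rule tower_norm)

lemma glue_const: "a \<in> S \<Longrightarrow> glue (\<lambda>_. a) \<doteq> (\<lambda>_. a)"
  using tower_unit by (simp add: glue_def[abs_def] sum_distrib_right)

text \<open>Members of one tower are asymptotically projections: multiplying \<open>\<Sum>\<^sub>h r(h) a \<approx> a\<close> by \<open>r(g)\<close>
leaves only \<open>r(g)\<^sup>2 a\<close> on the left, by orthogonality.\<close>

lemma tower_idem:
  assumes g: "g \<in> carrier G" and a: "a \<in> S"
  shows "(\<lambda>n. r n g * r n g * a) \<doteq> (\<lambda>n. r n g * a)"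
proof -
  have "r n g * ((\<Sum>h\<in>carrier G. r n h) * a) = r n g * r n g * a" for n
  proof -
    have "r n g * (\<Sum>h\<in>carrier G. r n h) = (\<Sum>h\<in>carrier G. if h = g then r n g * r n g else 0)"
      unfolding sum_distrib_left using g tower_orth by (intro sum.cong) auto
    also have "\<dots> = r n g * r n g" using g finite_G by simp
    finally show ?thesis by (simp flip: mult.assoc)
  qed
  moreover have "(\<lambda>n. r n g * ((\<Sum>h\<in>carrier G. r n h) * a)) \<doteq> (\<lambda>n. r n g * a)"
    by (rule asym_mult[OF asym_refl tower_unit[OF a] Bseq_tower[OF g]])
      (rule asym_Bseq[OF tower_unit[OF a]], simp)
  ultimately show ?thesis by simp
qed

text \<open>Moving \<open>y(g)\<close> past \<open>r(h)\<close> turns the \<open>(g, h)\<close> term into \<open>r(g) r(h) y(g) z(h)\<close>, which vanishes off the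
diagonal and is reduced by \<open>tower_idem\<close> on it.\<close>

lemma glue_mult:
  assumes y: "family y" and z: "family z"
  shows "(\<lambda>n. glue y n * glue z n) \<doteq> glue (\<lambda>g. y g * z g)"
proof -
  have "(\<lambda>n. r n g * y g * (r n h * z h)) \<doteq> (\<lambda>n. if g = h then r n g * (y g * z g) else 0)"
    if g: "g \<in> carrier G" and h: "h \<in> carrier G" for g h
  proof -
    have yz: "y g \<in> S" "z h \<in> S" using y z g h by auto
    have 1: "(\<lambda>n. y g * r n h) \<doteq> (\<lambda>n. r n h * y g)"
      using yz h by (intro asym_sym[OF tower_central])
    have B: "Bseq (\<lambda>n. y g * r n h)" "Bseq (\<lambda>n. r n g * (r n h * y g))"
      using g h by (auto intro!: Bseq_product Bseq_tower)
    have "(\<lambda>n. r n g * (y g * r n h)) \<doteq> (\<lambda>n. r n g * (r n h * y g))"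
      by (rule asym_mult[OF asym_refl 1 Bseq_tower[OF g] B(1)])
    then have "(\<lambda>n. r n g * (y g * r n h) * z h) \<doteq> (\<lambda>n. r n g * (r n h * y g) * z h)"
      by (rule asym_mult[OF _ asym_refl B(2)]) simp
    then have "(\<lambda>n. r n g * y g * (r n h * z h)) \<doteq> (\<lambda>n. r n g * r n h * (y g * z h))"
      by (simp add: mult.assoc)
    moreover have "(\<lambda>n. r n g * r n h * (y g * z h)) \<doteq> (\<lambda>n. if g = h then r n g * (y g * z g) else 0)"
      using tower_idem[OF g, of "y g * z h"] tower_orth[OF g h] yz mult by (cases "g = h") auto
    ultimately show ?thesis by (rule asym_trans)
  qed
  then have "(\<lambda>n. \<Sum>g\<in>carrier G. \<Sum>h\<in>carrier G. r n g * y g * (r n h * z h))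
     \<doteq> (\<lambda>n. \<Sum>g\<in>carrier G. \<Sum>h\<in>carrier G. if g = h then r n g * (y g * z g) else 0)"
    by (intro asym_sum)
  then show ?thesis
    using finite_G by (simp add: glue_def[abs_def] sum_product)
qed

lemma glue_adj:
  assumes y: "family y"
  shows "(\<lambda>n. adj (glue y n)) \<doteq> glue (\<lambda>g. adj (y g))"
proof -
  have "(\<lambda>n. \<Sum>g\<in>carrier G. adj (y g) * r n g)
    \<doteq> (\<lambda>n. \<Sum>g\<in>carrier G. r n g * adj (y g))"
    using y by (intro asym_sum asym_sym[OF tower_central] adj) auto
  moreover have "(\<Sum>g\<in>carrier G. adj (y g) * r n g) = adj (glue y n)" for n
    by (simp add: glue_def adj_simps tower_adj)
  ultimately show ?thesis by (simp add: glue_def[abs_def])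
qed

text \<open>Translation of the tower by \<open>h\<close> is undone by reindexing the sum.\<close>

lemma glue_equivariant:
  assumes y: "family y" and h: "h \<in> carrier G"
  shows "(\<lambda>n. \<sigma> h (glue y n)) \<doteq> glue (\<lambda>g. \<sigma> h (y (inv h \<otimes> g)))"
proof -
  have yS: "y g \<in> S" if "g \<in> carrier G" for g using y that by auto
  have "(\<lambda>n. \<sigma> h (r n g) * \<sigma> h (y g)) \<doteq> (\<lambda>n. r n (h \<otimes> g) * \<sigma> h (y g))" if g: "g \<in> carrier G" for g
    using h g by (intro asym_mult tower_equivariant asym_refl Bseq_tower) auto
  then have "(\<lambda>n. \<Sum>g\<in>carrier G. \<sigma> h (r n g) * \<sigma> h (y g)) \<doteq> (\<lambda>n. \<Sum>g\<in>carrier G. r n (h \<otimes> g) * \<sigma> h (y g))"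
    by (rule asym_sum)
  moreover have "\<sigma> h (glue y n) = (\<Sum>g\<in>carrier G. \<sigma> h (r n g) * \<sigma> h (y g))" for n
    using h yS by (simp add: glue_def hom_sum[OF action_hom] mult tower_in star_homD(3)[OF action_hom])
  moreover have "(\<Sum>g\<in>carrier G. r n (h \<otimes> g) * \<sigma> h (y g)) = glue (\<lambda>g. \<sigma> h (y (inv h \<otimes> g))) n" for n
    unfolding glue_def using h
    by (subst sum_translate[OF h, symmetric]) (auto intro!: sum.cong simp: m_assoc[symmetric])
  ultimately show ?thesis by simp
qed

lemma glue_zero: "glue (\<lambda>_. 0) n = 0" by (simp add: glue_def)

text \<open>Unitaries \<open>1 + b(g)\<close> glue to the asymptotically unitary sequence \<open>1 + glue b\<close>, and conjugation by it
is asymptotically the gluing of the conjugations by \<open>1 + b(g)\<close>. The sequence \<open>c\<close> allows the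
unitaries to be found in a smaller subalgebra \<open>S'\<close>: it is \<open>glue b\<close> itself when \<open>S' = S\<close>, and the
average of \<open>glue b\<close> over the group when \<open>S'\<close> is the fixed point algebra.\<close>

lemma glue_unitaries:
  assumes b: "family b" and u: "\<And>g. g \<in> carrier G \<Longrightarrow> unitary (1 + b g)"
    and S': "cstar_sub S'" "S' \<subseteq> S" and c: "\<And>n. c n \<in> S'" "c \<doteq> glue b"
  obtains V where "\<And>n. unitary (V n)" "\<And>n. V n - 1 \<in> S'"
    "\<And>a. a \<in> S \<Longrightarrow> (\<lambda>n. adj (V n) * a * V n)
       \<doteq> glue (\<lambda>g. adj (1 + b g) * a * (1 + b g))"
proof -
  let ?a = "adj :: 'u \<Rightarrow> 'u"
  define W where "W n = 1 + c n" for n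
  have W: "W \<doteq> (\<lambda>n. 1 + glue b n)" unfolding W_def using c by (intro asym_add asym_refl)
  have ba: "family (\<lambda>g. ?a (b g))" using b adj by auto
  have BW: "Bseq (\<lambda>n. 1 + glue b n)" "Bseq (\<lambda>n. 1 + glue (\<lambda>g. ?a (b g)) n)"
    using Bseq_add[OF Bseq_glue] by (simp_all add: add.commute[of 1])
  have aW: "(\<lambda>n. ?a (W n)) \<doteq> (\<lambda>n. 1 + glue (\<lambda>g. ?a (b g)) n)"
  proof -
    have "(\<lambda>n. ?a (W n)) \<doteq> (\<lambda>n. ?a (1 + glue b n))" using W by (rule asym_adj)
    also have "\<dots> \<doteq> (\<lambda>n. 1 + glue (\<lambda>g. ?a (b g)) n)"
      unfolding adj_add adj_one by (intro asym_add asym_refl glue_adj b)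
    finally show ?thesis .
  qed
  have prod: "(\<lambda>n. (1 + glue x n) * (1 + glue y n)) \<doteq> (\<lambda>_. 1)"
    if "family x" "family y" and 1: "\<And>g. g \<in> carrier G \<Longrightarrow> (1 + x g) * (1 + y g) = 1" for x y
  proof -
    have "(\<lambda>n. (1 + glue x n + glue y n) + glue x n * glue y n)
        \<doteq> (\<lambda>n. (1 + glue x n + glue y n) + glue (\<lambda>g. x g * y g) n)"
      using that by (intro asym_add glue_mult asym_refl)
    moreover have "1 + glue x n + glue y n + glue (\<lambda>g. x g * y g) n = 1" for n
    proof -
      have "x g + y g + x g * y g = 0" if "g \<in> carrier G" for g
        using 1[OF that] by (simp add: algebra_simps)
      then have "glue (\<lambda>g. x g + y g + x g * y g) n = glue (\<lambda>_. 0) n"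
        by (simp add: glue_def)
      then show ?thesis by (simp add: glue_add add.assoc glue_zero)
    qed
    ultimately show ?thesis by (simp add: algebra_simps)
  qed
  have "(\<lambda>n. ?a (W n) * W n) \<doteq> (\<lambda>n. (1 + glue (\<lambda>g. ?a (b g)) n) * (1 + glue b n))"
    by (rule asym_mult[OF aW W BW(2) asym_Bseq[OF W BW(1)]])
  also have "\<dots> \<doteq> (\<lambda>_. 1)"
    using u by (intro prod ba b) (simp add: unitary_def adj_simps)
  finally have WW: "(\<lambda>n. ?a (W n) * W n) \<longlonglongrightarrow> 1" by (simp add: asym_const_iff)
  have "(\<lambda>n. W n * ?a (W n)) \<doteq> (\<lambda>n. (1 + glue b n) * (1 + glue (\<lambda>g. ?a (b g)) n))"
    by (rule asym_mult[OF W aW BW(1) asym_Bseq[OF aW BW(2)]])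
  also have "\<dots> \<doteq> (\<lambda>_. 1)"
    using u by (intro prod ba b) (simp add: unitary_def adj_simps)
  finally have WW': "(\<lambda>n. W n * ?a (W n)) \<longlonglongrightarrow> 1" by (simp add: asym_const_iff)
  obtain V where V: "\<And>n. unitary (V n)" "\<And>n. V n - 1 \<in> S'" "V \<doteq> W"
    using cstar_sub.polar_sequence[OF S'(1), of W] WW WW' c(1) by (auto simp: W_def)
  have VW: "V \<doteq> (\<lambda>n. 1 + glue b n)" using V(3) W by (rule asym_trans)
  have aV: "(\<lambda>n. ?a (V n)) \<doteq> (\<lambda>n. 1 + glue (\<lambda>g. ?a (b g)) n)"
    using asym_adj[OF V(3)] aW by (rule asym_trans)
  have right: "(\<lambda>n. glue y n * (1 + glue b n)) \<doteq> glue (\<lambda>g. y g * (1 + b g))"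
    and left: "(\<lambda>n. (1 + glue (\<lambda>g. ?a (b g)) n) * glue y n) \<doteq> glue (\<lambda>g. ?a (1 + b g) * y g)"
    if y: "family y" for y
  proof -
    have "(\<lambda>n. glue y n + glue y n * glue b n) \<doteq> (\<lambda>n. glue y n + glue (\<lambda>g. y g * b g) n)"
      using y b by (intro asym_add glue_mult asym_refl)
    then show "(\<lambda>n. glue y n * (1 + glue b n)) \<doteq> glue (\<lambda>g. y g * (1 + b g))"
      by (simp add: distrib_left glue_add)
    have "(\<lambda>n. glue y n + glue (\<lambda>g. ?a (b g)) n * glue y n) \<doteq> (\<lambda>n. glue y n + glue (\<lambda>g. ?a (b g) * y g) n)"
      using y ba by (intro asym_add glue_mult asym_refl)
    then show "(\<lambda>n. (1 + glue (\<lambda>g. ?a (b g)) n) * glue y n) \<doteq> glue (\<lambda>g. ?a (1 + b g) * y g)"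
      by (simp add: distrib_right glue_add adj_simps)
  qed
  have "(\<lambda>n. ?a (V n) * a * V n) \<doteq> glue (\<lambda>g. ?a (1 + b g) * a * (1 + b g))" if a: "a \<in> S" for a
  proof -
    have BV: "Bseq V" using asym_Bseq[OF VW BW(1)] .
    have fam: "family (\<lambda>g. ?a (1 + b g) * a)"
      using a b by (auto simp: adj_simps distrib_right intro!: add mult adj)
    have "(\<lambda>n. ?a (V n) * a) \<doteq> (\<lambda>n. (1 + glue (\<lambda>g. ?a (b g)) n) * glue (\<lambda>_. a) n)"
      by (intro asym_mult aV asym_sym[OF glue_const[OF a]] BW) auto
    also have "\<dots> \<doteq> glue (\<lambda>g. ?a (1 + b g) * a)" by (rule left) (use a in auto)
    finally have "(\<lambda>n. ?a (V n) * a) \<doteq> glue (\<lambda>g. ?a (1 + b g) * a)" .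
    then have "(\<lambda>n. ?a (V n) * a * V n) \<doteq> (\<lambda>n. glue (\<lambda>g. ?a (1 + b g) * a) n * (1 + glue b n))"
      by (intro asym_mult VW Bseq_glue BV)
    also have "\<dots> \<doteq> glue (\<lambda>g. ?a (1 + b g) * a * (1 + b g))" by (rule right[OF fam])
    finally show ?thesis .
  qed
  with V show ?thesis using that by blast
qed

end

section \<open>Approximate unitary equivalence under the Rokhlin property\<close>

text \<open>The set \<open>V\<close> is the algebra whose unitization contains the unitaries: the whole target, or the
fixed points in it.\<close>

definition approx_equiv :: "'u::unital_cstar set \<Rightarrow> 'u set \<Rightarrow> ('u \<Rightarrow> 'u) \<Rightarrow> ('u \<Rightarrow> 'u) \<Rightarrow> bool" where
  "approx_equiv V S \<phi> \<psi> \<longleftrightarrow> (\<forall>F \<epsilon>. 0 < \<epsilon> \<longrightarrow> finite F \<longrightarrow> F \<subseteq> S \<longrightarrow>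
     (\<exists>u. unitary u \<and> u - 1 \<in> V \<and> (\<forall>a\<in>F. norm (\<phi> a - adj u * \<psi> a * u) < \<epsilon>)))"

lemma approx_equivD:
  assumes "approx_equiv V S \<phi> \<psi>" "0 < \<epsilon>" "finite F" "F \<subseteq> S"
  obtains u where "unitary u" "u - 1 \<in> V" "\<And>a. a \<in> F \<Longrightarrow> norm (\<phi> a - adj u * \<psi> a * u) < \<epsilon>"
  using assms(1)[unfolded approx_equiv_def, rule_format, OF assms(2-4)] that by auto

lemma approx_equiv_conj:
  assumes "unitary u" "u - 1 \<in> V"
  shows "approx_equiv V S (\<lambda>x. adj u * \<phi> x * u) \<phi>"
  unfolding approx_equiv_def using assms by fastforce

lemma approx_equiv_limit:
  assumes f: "\<And>n. approx_equiv V S (f n) \<psi>" and lim: "\<And>x. x \<in> S \<Longrightarrow> (\<lambda>n. f n x) \<longlonglongrightarrow> \<Phi> x"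
  shows "approx_equiv V S \<Phi> \<psi>"
  unfolding approx_equiv_def
proof (intro allI impI)
  fix F and \<epsilon> :: real assume e: "0 < \<epsilon>" and F: "finite F" "F \<subseteq> S"
  have "eventually (\<lambda>n. \<forall>a\<in>F. norm (f n a - \<Phi> a) < \<epsilon>/2) sequentially"
  proof (rule eventually_ball_finite[OF F(1)], rule ballI)
    fix a assume "a \<in> F"
    then show "eventually (\<lambda>n. norm (f n a - \<Phi> a) < \<epsilon>/2) sequentially"
      using tendstoD[OF lim, of a "\<epsilon>/2"] F e by (auto simp: dist_norm)
  qed
  then obtain n where n: "\<And>a. a \<in> F \<Longrightarrow> norm (f n a - \<Phi> a) < \<epsilon>/2"
    by (auto simp: eventually_sequentially)
  obtain u where u: "unitary u" "u - 1 \<in> V" "\<And>a. a \<in> F \<Longrightarrow> norm (f n a - adj u * \<psi> a * u) < \<epsilon>/2"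
    using approx_equivD[OF f, of "\<epsilon>/2" F n] e F by auto
  have "norm (\<Phi> a - adj u * \<psi> a * u) < \<epsilon>" if "a \<in> F" for a
    using n[OF that] u(3)[OF that] by norm
  then show "\<exists>u. unitary u \<and> u - 1 \<in> V \<and> (\<forall>a\<in>F. norm (\<Phi> a - adj u * \<psi> a * u) < \<epsilon>)"
    using u by blast
qed

context tower
begin

text \<open>Let \<open>u\<close> almost conjugate \<open>\<psi>\<close> to \<open>\<phi>\<close> on the orbit of a finite set. By equivariance every \<open>\<sigma>\<^sub>g(u)\<close> does so
on the set itself, hence so does the gluing of the family \<open>\<sigma>\<^sub>g(u)\<close>. This family is invariant under
translation, so its gluing is asymptotically fixed and can be replaced by its average.\<close>

lemma equivariant_approx_equiv:
  assumes A: "dynamical_system S' G \<alpha>"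
    and \<phi>: "\<phi> \<in> star_hom S' S" "\<And>g x. g \<in> carrier G \<Longrightarrow> x \<in> S' \<Longrightarrow> \<phi> (\<alpha> g x) = \<sigma> g (\<phi> x)"
    and \<psi>: "\<psi> \<in> star_hom S' S" "\<And>g x. g \<in> carrier G \<Longrightarrow> x \<in> S' \<Longrightarrow> \<psi> (\<alpha> g x) = \<sigma> g (\<psi> x)"
    and equiv: "approx_equiv S S' \<phi> \<psi>"
  shows "approx_equiv fixed S' \<phi> \<psi>"
  unfolding approx_equiv_def
proof (intro allI impI)
  interpret A: dynamical_system S' G \<alpha> by fact
  fix F and \<epsilon> :: real assume e: "0 < \<epsilon>" and F: "finite F" "F \<subseteq> S'"
  define k where "k = real (card (carrier G))"
  have k: "k > 0" using card_G by (simp add: k_def)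
  define F' where "F' = (\<Union>g\<in>carrier G. \<alpha> g ` F)"
  have F': "finite F'" "F' \<subseteq> S'" using F finite_G A.action_closed by (auto simp: F'_def)
  \<comment> \<open>The gluing of a family of errors below \<open>\<delta>\<close> has norm at most \<open>k \<delta> = \<epsilon> / 2\<close>.\<close>
  define \<delta> where "\<delta> = \<epsilon> / (2 * k)"
  have "\<delta> > 0" using e k by (simp add: \<delta>_def)
  then obtain u where u: "unitary u" "u - 1 \<in> S" "\<And>a. a \<in> F' \<Longrightarrow> norm (\<phi> a - adj u * \<psi> a * u) < \<delta>"
    using approx_equivD[OF equiv _ F'] by metis
  define b where "b g = \<sigma> g (u - 1)" for g
  have b: "family b" using u by (auto simp: b_def action_closed)
  have ub: "unitary (1 + b g)" if "g \<in> carrier G" for g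
    unfolding b_def using hom_unitary[OF action_hom[OF that] u(2)] u(1) by simp
  have bS: "glue b n \<in> S" for n by (rule glue_in[OF b])
  have inv: "(\<lambda>n. \<sigma> h (glue b n)) \<doteq> glue b" if h: "h \<in> carrier G" for h
  proof -
    have "\<sigma> h (b (inv h \<otimes> g)) = b g" if "g \<in> carrier G" for g
      using h that u(2) by (simp add: b_def action_closed action_mult[symmetric] m_assoc[symmetric])
    then have "glue (\<lambda>g. \<sigma> h (b (inv h \<otimes> g))) = glue b" by (rule glue_cong)
    then show ?thesis using glue_equivariant[OF b h] by simp
  qed
  have av: "(\<lambda>n. average (glue b n)) \<doteq> glue b"
  proof -
    have "(\<lambda>n. (1/k) *\<^sub>R (\<Sum>h\<in>carrier G. \<sigma> h (glue b n))) \<doteq> (\<lambda>n. (1/k) *\<^sub>R (\<Sum>h\<in>carrier G. glue b n))"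
      by (intro asym_scaleR asym_sum inv)
    moreover have "(1/k) *\<^sub>R (\<Sum>h\<in>carrier G. glue b n) = glue b n" for n
      using k by (simp add: k_def sum_constant_scaleR del: sum_constant)
    ultimately show ?thesis unfolding average_def k_def[symmetric] by (simp only:)
  qed
  obtain V where V: "\<And>n. unitary (V n)" "\<And>n. V n - 1 \<in> fixed"
    "\<And>a. a \<in> S \<Longrightarrow> (\<lambda>n. adj (V n) * a * V n) \<doteq> glue (\<lambda>g. adj (1 + b g) * a * (1 + b g))"
    using glue_unitaries[OF b ub cstar_sub_fixed _ average_fixed[OF bS] av] by auto
  have near: "norm (\<phi> a - adj (1 + b g) * \<psi> a * (1 + b g)) < \<delta>" if a: "a \<in> F" and g: "g \<in> carrier G" for a g
  proof -
    \<comment> \<open>Write \<open>a\<close> as \<open>\<alpha>\<^sub>g(x)\<close> with \<open>x\<close> in the orbit \<open>F'\<close>, where \<open>u\<close> is known to conjugate.\<close>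
    define x where "x = \<alpha> (inv g) a"
    have x: "x \<in> F'" "x \<in> S'" "a = \<alpha> g x"
      using a g F A.action_closed A.action_inv by (auto simp: x_def F'_def)
    have "\<psi> x \<in> S" "\<phi> x \<in> S" using star_homD(1)[OF \<psi>(1)] star_homD(1)[OF \<phi>(1)] x by auto
    have u1: "1 + (u - 1) = u" by simp
    have cS: "adj u * \<psi> x * u \<in> S"
      using star_homD(1)[OF star_hom_conj_unitary[OF cstar_sub_axioms \<psi>(1) u(1,2)] x(2)] .
    have "\<phi> a - adj (1 + b g) * \<psi> a * (1 + b g) = \<sigma> g (\<phi> x - adj u * \<psi> x * u)"
      using hom_conj[OF action_hom[OF g] u(2) \<open>\<psi> x \<in> S\<close>] x g
        hom_diff[OF action_hom[OF g] \<open>\<phi> x \<in> S\<close> cS]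
      by (simp add: b_def \<phi>(2) \<psi>(2))
    also have "norm \<dots> \<le> norm (\<phi> x - adj u * \<psi> x * u)"
      using \<open>\<phi> x \<in> S\<close> cS by (intro norm_action_le g diff)
    finally show ?thesis using u(3)[OF x(1)] by simp
  qed
  have "eventually (\<lambda>n. norm (\<phi> a - adj (V n) * \<psi> a * V n) < \<epsilon>) sequentially" if a: "a \<in> F" for a
  proof -
    let ?y = "\<lambda>g. adj (1 + b g) * \<psi> a * (1 + b g)"
    have S: "\<phi> a \<in> S" "\<psi> a \<in> S" using a F star_homD(1)[OF \<psi>(1)] star_homD(1)[OF \<phi>(1)] by auto
    have "eventually (\<lambda>n. norm (adj (V n) * \<psi> a * V n - glue ?y n) < \<epsilon>/4) sequentially"
      using V(3)[OF S(2)] e by (intro asym_eventually) auto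
    moreover have "eventually (\<lambda>n. norm (glue (\<lambda>_. \<phi> a) n - \<phi> a) < \<epsilon>/4) sequentially"
      using glue_const[OF S(1)] e by (intro asym_eventually) auto
    ultimately show ?thesis
    proof eventually_elim
      case (elim n)
      have "norm (glue (\<lambda>_. \<phi> a) n - glue ?y n) \<le> (\<Sum>g\<in>carrier G. \<delta>)"
        by (intro order_trans[OF norm_glue_diff_le] sum_mono less_imp_le near[OF a])
      also have "\<dots> = \<epsilon>/2" using k by (simp add: \<delta>_def k_def)
      finally show ?case using elim by norm
    qed
  qed
  then have "eventually (\<lambda>n. \<forall>a\<in>F. norm (\<phi> a - adj (V n) * \<psi> a * V n) < \<epsilon>) sequentially"
    using F by (intro eventually_ball_finite) auto
  then obtain n where "\<forall>a\<in>F. norm (\<phi> a - adj (V n) * \<psi> a * V n) < \<epsilon>"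
    by (auto simp: eventually_sequentially)
  then show "\<exists>u. unitary u \<and> u - 1 \<in> fixed \<and> (\<forall>a\<in>F. norm (\<phi> a - adj u * \<psi> a * u) < \<epsilon>)"
    using V by blast
qed

text \<open>Let \<open>u(g)\<close> almost conjugate \<open>\<phi>\<close> to its twist \<open>\<phi>\<^sub>g = \<sigma>\<^sub>g \<circ> \<phi> \<circ> \<alpha>\<^sub>g\<inverse>\<close> on \<open>F\<close>. Conjugating \<open>\<phi>\<close> by the glued unitary
gives approximately \<open>\<Sum>\<^sub>g r(g) \<phi>\<^sub>g\<close>, which is almost equivariant because \<open>G\<close> permutes the summands.
The last conclusion bounds the displacement of \<open>\<phi>\<close> by a multiple of its defect of equivariance, up
to \<open>\<epsilon>\<close>, which is what makes the iteration in \<open>exists_equivariant\<close> converge.\<close>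

lemma almost_equivariant_conj:
  assumes A: "dynamical_system S' G \<alpha>" and \<phi>: "\<phi> \<in> star_hom S' S"
    and equiv: "\<And>g. g \<in> carrier G \<Longrightarrow> approx_equiv S S' (\<lambda>x. \<sigma> g (\<phi> (\<alpha> (inv g) x))) \<phi>"
    and F: "finite F" "F \<subseteq> S'" "\<And>g a. g \<in> carrier G \<Longrightarrow> a \<in> F \<Longrightarrow> \<alpha> g a \<in> F" and e: "\<epsilon> > 0"
  obtains w where "unitary w" "w - 1 \<in> S"
    "\<And>g a. g \<in> carrier G \<Longrightarrow> a \<in> F \<Longrightarrow>
      norm (\<sigma> g (adj w * \<phi> (\<alpha> (inv g) a) * w) - adj w * \<phi> a * w) < \<epsilon>"
    "\<And>\<delta> a. a \<in> F \<Longrightarrow> (\<And>g. g \<in> carrier G \<Longrightarrow> norm (\<sigma> g (\<phi> (\<alpha> (inv g) a)) - \<phi> a) \<le> \<delta>) \<Longrightarrow>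
      norm (adj w * \<phi> a * w - \<phi> a) \<le> real (card (carrier G)) * \<delta> + \<epsilon>"
proof -
  interpret A: dynamical_system S' G \<alpha> by fact
  define k where "k = real (card (carrier G))"
  have k: "k > 0" using card_G by (simp add: k_def)
  define \<eta> where "\<eta> = \<epsilon> / (8 * k)"
  have \<eta>: "\<eta> > 0" using e k by (simp add: \<eta>_def)
  \<comment> \<open>The twists of \<open>\<phi>\<close>, evaluated at \<open>a\<close>, as a family indexed by \<open>g\<close>.\<close>
  define tw where "tw a g = \<sigma> g (\<phi> (\<alpha> (inv g) a))" for a g
  have \<phi>S: "\<phi> a \<in> S" if "a \<in> S'" for a using star_homD(1)[OF \<phi> that] .
  have tw: "family (tw a)" if "a \<in> S'" for a
    using that by (auto simp: tw_def intro!: action_closed \<phi>S A.action_closed)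
  have "\<exists>u. unitary u \<and> u - 1 \<in> S \<and> (\<forall>a\<in>F. norm (tw a g - adj u * \<phi> a * u) < \<eta>)"
    if "g \<in> carrier G" for g
    using approx_equivD[OF equiv[OF that] \<eta> F(1,2)] unfolding tw_def by metis
  then obtain u where u: "\<And>g. g \<in> carrier G \<Longrightarrow> unitary (u g) \<and> u g - 1 \<in> S"
    "\<And>g a. g \<in> carrier G \<Longrightarrow> a \<in> F \<Longrightarrow> norm (tw a g - adj (u g) * \<phi> a * u g) < \<eta>"
    by metis
  define b where "b g = u g - 1" for g
  have b: "family b" and ub: "\<And>g. 1 + b g = u g" using u by (auto simp: b_def)
  have un: "unitary (1 + b g)" if "g \<in> carrier G" for g using u that by (simp add: ub)
  obtain V where "\<And>n. unitary (V n)" "\<And>n. V n - 1 \<in> S"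
    "\<And>a. a \<in> S \<Longrightarrow> (\<lambda>n. adj (V n) * a * V n) \<doteq> glue (\<lambda>g. adj (1 + b g) * a * (1 + b g))"
    using glue_unitaries[OF b un cstar_sub_axioms order_refl glue_in[OF b] asym_refl] by auto
  note V = this[unfolded ub]
  have *: "eventually (\<lambda>n. norm (adj (V n) * \<phi> a * V n - glue (tw a) n) < \<epsilon>/4) sequentially" if a: "a \<in> F" for a
  proof -
    let ?y = "\<lambda>g. adj (u g) * \<phi> a * u g"
    have "\<phi> a \<in> S" using a F \<phi>S by auto
    then have "eventually (\<lambda>n. norm (adj (V n) * \<phi> a * V n - glue ?y n) < \<epsilon>/8) sequentially"
      using V(3) e by (intro asym_eventually) auto
    then show ?thesis
    proof eventually_elim
      case (elim n)
      have "norm (glue (tw a) n - glue ?y n) \<le> (\<Sum>g\<in>carrier G. \<eta>)"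
        by (intro order_trans[OF norm_glue_diff_le] sum_mono less_imp_le u(2) a)
      also have "\<dots> = \<epsilon>/8" using k by (simp add: \<eta>_def k_def)
      finally show ?case using elim by norm
    qed
  qed
  have **: "eventually (\<lambda>n. norm (\<sigma> h (glue (tw (\<alpha> (inv h) a)) n) - glue (tw a) n) < \<epsilon>/4) sequentially"
    if a: "a \<in> F" and h: "h \<in> carrier G" for a h
  proof -
    have aS: "a \<in> S'" using a F by auto
    have "\<sigma> h (tw (\<alpha> (inv h) a) (inv h \<otimes> g)) = tw a g" if g: "g \<in> carrier G" for g
    proof -
      have "\<alpha> (inv (inv h \<otimes> g)) (\<alpha> (inv h) a) = \<alpha> (inv g) a"
        using h g aS by (simp add: A.action_mult[symmetric] inv_mult_group m_assoc)
      then show ?thesis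
        using h g aS by (simp add: tw_def action_mult[symmetric] \<phi>S A.action_closed m_assoc[symmetric])
    qed
    then have "glue (\<lambda>g. \<sigma> h (tw (\<alpha> (inv h) a) (inv h \<otimes> g))) = glue (tw a)" by (rule glue_cong)
    then show ?thesis
      using glue_equivariant[OF tw h, of "\<alpha> (inv h) a"] h aS e
      by (intro asym_eventually) (auto simp: A.action_closed)
  qed
  have ***: "eventually (\<lambda>n. norm (glue (\<lambda>_. \<phi> a) n - \<phi> a) < \<epsilon>/4) sequentially" if "a \<in> F" for a
    using that F \<phi>S e by (intro asym_eventually glue_const) auto
  have "eventually (\<lambda>n. \<forall>a\<in>F. norm (adj (V n) * \<phi> a * V n - glue (tw a) n) < \<epsilon>/4 \<and>
      norm (glue (\<lambda>_. \<phi> a) n - \<phi> a) < \<epsilon>/4 \<and>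
      (\<forall>h\<in>carrier G. norm (\<sigma> h (glue (tw (\<alpha> (inv h) a)) n) - glue (tw a) n) < \<epsilon>/4)) sequentially"
    using * ** *** F(1) finite_G
    by (intro eventually_ball_finite ballI eventually_conj) auto
  then obtain n where n: "\<And>a. a \<in> F \<Longrightarrow> norm (adj (V n) * \<phi> a * V n - glue (tw a) n) < \<epsilon>/4"
      "\<And>a. a \<in> F \<Longrightarrow> norm (glue (\<lambda>_. \<phi> a) n - \<phi> a) < \<epsilon>/4"
      "\<And>a h. a \<in> F \<Longrightarrow> h \<in> carrier G \<Longrightarrow> norm (\<sigma> h (glue (tw (\<alpha> (inv h) a)) n) - glue (tw a) n) < \<epsilon>/4"
    by (auto simp: eventually_sequentially)
  show ?thesis
  proof (rule that[OF V(1)[of n] V(2)[of n]])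
    fix g a assume g: "g \<in> carrier G" and a: "a \<in> F"
    let ?a = "\<alpha> (inv g) a"
    have a': "?a \<in> F" using F a g by auto
    have S: "adj (V n) * \<phi> ?a * V n \<in> S" "glue (tw ?a) n \<in> S"
      using star_homD(1)[OF star_hom_conj_unitary[OF cstar_sub_axioms \<phi> V(1,2)[of n]]] a' F
        glue_in[OF tw] by auto
    have "norm (\<sigma> g (adj (V n) * \<phi> ?a * V n) - \<sigma> g (glue (tw ?a) n)) < \<epsilon>/4"
      using hom_dist_le[OF action_hom[OF g] S] n(1)[OF a'] by linarith
    then show "norm (\<sigma> g (adj (V n) * \<phi> ?a * V n) - adj (V n) * \<phi> a * V n) < \<epsilon>"
      using n(1)[OF a] n(3)[OF a g] by norm
  next
    fix \<delta> a assume a: "a \<in> F" and d: "\<And>g. g \<in> carrier G \<Longrightarrow> norm (\<sigma> g (\<phi> (\<alpha> (inv g) a)) - \<phi> a) \<le> \<delta>"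
    have "norm (glue (tw a) n - glue (\<lambda>_. \<phi> a) n) \<le> (\<Sum>g\<in>carrier G. \<delta>)"
      using d by (intro order_trans[OF norm_glue_diff_le] sum_mono) (auto simp: tw_def)
    moreover define D where "D = card (carrier G) * \<delta>"
    ultimately have "norm (glue (tw a) n - glue (\<lambda>_. \<phi> a) n) \<le> D" by simp
    then have "norm (adj (V n) * \<phi> a * V n - \<phi> a) \<le> D + \<epsilon>"
      using n(1)[OF a] n(2)[OF a] e by norm
    then show "norm (adj (V n) * \<phi> a * V n - \<phi> a) \<le> real (card (carrier G)) * \<delta> + \<epsilon>"
      by (simp add: D_def)
  qed
qed

end

section \<open>Intertwining\<close>

lemma Cauchy_geometric:
  fixes x :: "nat \<Rightarrow> 'u::real_normed_vector"
  assumes "\<And>n. n \<ge> m \<Longrightarrow> norm (x (Suc n) - x n) \<le> C * (1/2) ^ n"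
  shows "Cauchy x"
proof (rule metric_CauchyI)
  fix e :: real assume e: "e > 0"
  have C: "C \<ge> 0"
    using order_trans[OF norm_ge_zero assms[of m]] zero_less_power[of "1/2::real" m]
    by (simp add: zero_le_mult_iff not_le[symmetric])
  have tail: "norm (x (n + j) - x n) \<le> 2 * C * (1/2)^n - 2 * C * (1/2)^(n+j)" if n: "n \<ge> m" for n j
  proof (induction j)
    case (Suc j)
    have "norm (x (n + Suc j) - x n) \<le> C * (1/2)^(n+j) + norm (x (n + j) - x n)"
      using assms[of "n+j"] n norm_triangle_ineq[of "x (Suc (n+j)) - x (n+j)" "x (n+j) - x n"] by simp
    moreover have "2 * C * (1/2)^(n + Suc j) = C * (1/2)^(n + j)" by simp
    moreover have "2 * C * (1/2)^(n + j) = 2 * (C * (1/2)^(n + j))" by simp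
    ultimately show ?case using Suc by linarith
  qed simp
  have "(\<lambda>n. 2 * C * (1/2)^n) \<longlonglongrightarrow> 2 * C * 0"
    by (intro tendsto_mult tendsto_const LIMSEQ_power_zero) simp
  then have "eventually (\<lambda>n. 2 * C * (1/2)^n < e / 2) sequentially"
    using e by (intro order_tendstoD(2)) auto
  then obtain N where N: "\<And>n. n \<ge> N \<Longrightarrow> 2 * C * (1/2)^n < e/2" by (auto simp: eventually_sequentially)
  define M where "M = max N m"
  have "norm (x n - x M) < e / 2" if "n \<ge> M" for n
  proof -
    have "norm (x n - x M) \<le> 2 * C * (1/2)^M - 2 * C * (1/2)^n"
      using tail[of M "n - M"] that by (simp add: M_def)
    also have "\<dots> \<le> 2 * C * (1/2)^M" using C by simp
    also have "\<dots> < e/2" using N[of M] by (simp add: M_def)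
    finally show ?thesis .
  qed
  then have "dist (x i) (x j) < e" if "i \<ge> M" "j \<ge> M" for i j
    using that dist_triangle_half_l[of "x i" "x M" e "x j"] by (simp add: dist_norm)
  then show "\<exists>M. \<forall>m\<ge>M. \<forall>n\<ge>M. dist (x m) (x n) < e" by blast
qed

lemma hom_eq_on_dense:
  assumes S: "cstar_sub S" and f: "f \<in> star_hom S T" and g: "g \<in> star_hom S T'"
    and d: "range d \<subseteq> S" "S \<subseteq> closure (range d)" and eq: "\<And>i. f (d i) = g (d i)" and x: "x \<in> S"
  shows "f x = g x"
proof (rule ccontr)
  assume "f x \<noteq> g x"
  then have "norm (f x - g x) / 2 > 0" by simp
  then have "\<exists>y\<in>range d. dist y x < norm (f x - g x) / 2"
    using x d(2) closure_approachable by blast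
  then obtain i where i: "norm (d i - x) < norm (f x - g x) / 2" by (auto simp: dist_norm)
  have "norm (f (d i) - f x) \<le> norm (d i - x)" "norm (g (d i) - g x) \<le> norm (d i - x)"
    using cstar_sub.hom_dist_le[OF S f] cstar_sub.hom_dist_le[OF S g] d x by blast+
  moreover have "f x - g x = (g (d i) - g x) - (f (d i) - f x)" using eq[of i] by simp
  then have "norm (f x - g x) \<le> norm (g (d i) - g x) + norm (f (d i) - f x)"
    by (metis norm_triangle_ineq4)
  ultimately show False using i by simp
qed

context tower
begin

text \<open>Iterate \<open>almost_equivariant_conj\<close> with tolerances \<open>2\<^sup>-\<^sup>n\<close> on growing invariant finite sets that exhaust a
dense set. After step \<open>n\<close> the defect of equivariance is at most \<open>2\<^sup>-\<^sup>n\<close>, so step \<open>n + 1\<close> moves the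
map by a multiple of \<open>2\<^sup>-\<^sup>n\<close>. The pointwise limit is equivariant; it stays in \<open>P\<close> because it is
approximately unitarily equivalent to the map the iteration started from.\<close>

lemma exists_equivariant:
  assumes A: "dynamical_system S' G \<alpha>" and P: "P \<subseteq> star_hom S' S" "P \<noteq> {}"
    and equiv: "\<And>\<phi> \<psi>. \<phi> \<in> P \<Longrightarrow> \<psi> \<in> P \<Longrightarrow> approx_equiv S S' \<phi> \<psi>"
    and closed_P: "\<And>\<phi> \<psi>. \<phi> \<in> star_hom S' S \<Longrightarrow> \<psi> \<in> P \<Longrightarrow> approx_equiv S S' \<phi> \<psi> \<Longrightarrow> \<phi> \<in> P"
    and twist: "\<And>\<phi> g. \<phi> \<in> P \<Longrightarrow> g \<in> carrier G \<Longrightarrow> (\<lambda>x. \<sigma> g (\<phi> (\<alpha> (inv g) x))) \<in> P"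
  obtains \<phi> where "\<phi> \<in> P" "\<And>g x. g \<in> carrier G \<Longrightarrow> x \<in> S' \<Longrightarrow> \<phi> (\<alpha> g x) = \<sigma> g (\<phi> x)"
proof -
  interpret A: dynamical_system S' G \<alpha> by fact
  obtain d :: "nat \<Rightarrow> 'u" where d: "range d \<subseteq> S'" "S' \<subseteq> closure (range d)" using A.separable by blast
  define F where "F n = (\<Union>g\<in>carrier G. \<alpha> g ` d ` {..n})" for n :: nat
  have dS: "d i \<in> S'" for i using d by auto
  have F: "finite (F n)" "F n \<subseteq> S'" "\<And>g a. g \<in> carrier G \<Longrightarrow> a \<in> F n \<Longrightarrow> \<alpha> g a \<in> F n" for n
  proof -
    show "finite (F n)" "F n \<subseteq> S'" using finite_G dS A.action_closed by (auto simp: F_def)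
    fix g a assume g: "g \<in> carrier G" and "a \<in> F n"
    then obtain h i where "h \<in> carrier G" "i \<le> n" "a = \<alpha> h (d i)" by (auto simp: F_def)
    then have "\<alpha> g a = \<alpha> (g \<otimes> h) (d i)" "g \<otimes> h \<in> carrier G" "i \<le> n"
      using g dS by (auto simp: A.action_mult)
    then show "\<alpha> g a \<in> F n" by (auto simp: F_def)
  qed
  have dF: "d i \<in> F n" if "i \<le> n" for i n
    using that dS A.action_one one_closed unfolding F_def by (metis UN_I atMost_iff imageI)
  let ?k = "real (card (carrier G))"
  \<comment> \<open>Step \<open>n\<close> makes \<open>\<psi>\<close> almost equivariant and controls its distance from \<open>\<phi>\<close>.\<close>
  define R where "R n \<phi> \<psi> \<longleftrightarrow> (\<forall>g\<in>carrier G. \<forall>a\<in>F n. norm (\<sigma> g (\<psi> (\<alpha> (inv g) a)) - \<psi> a) \<le> (1/2)^n) \<and>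
     (\<forall>a\<in>F n. \<forall>\<delta>. (\<forall>g\<in>carrier G. norm (\<sigma> g (\<phi> (\<alpha> (inv g) a)) - \<phi> a) \<le> \<delta>) \<longrightarrow>
        norm (\<psi> a - \<phi> a) \<le> ?k * \<delta> + (1/2)^n)" for n and \<phi> \<psi> :: "'u \<Rightarrow> 'u"
  have "\<exists>f. \<forall>n. f n \<in> P \<and> R n (f n) (f (Suc n))"
  proof (rule dependent_nat_choice)
    show "\<exists>\<phi>. \<phi> \<in> P" using P by auto
    fix \<phi> and n :: nat assume \<phi>: "\<phi> \<in> P"
    have \<phi>h: "\<phi> \<in> star_hom S' S" using \<phi> P by auto
    have Fn: "finite (F n)" "F n \<subseteq> S'" "\<And>g a. g \<in> carrier G \<Longrightarrow> a \<in> F n \<Longrightarrow> \<alpha> g a \<in> F n"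
      using F by auto
    obtain w where w: "unitary w" "w - 1 \<in> S"
      "\<And>g a. g \<in> carrier G \<Longrightarrow> a \<in> F n \<Longrightarrow>
        norm (\<sigma> g (adj w * \<phi> (\<alpha> (inv g) a) * w) - adj w * \<phi> a * w) < (1/2)^n"
      "\<And>\<delta> a. a \<in> F n \<Longrightarrow> (\<And>g. g \<in> carrier G \<Longrightarrow> norm (\<sigma> g (\<phi> (\<alpha> (inv g) a)) - \<phi> a) \<le> \<delta>) \<Longrightarrow>
        norm (adj w * \<phi> a * w - \<phi> a) \<le> ?k * \<delta> + (1/2)^n"
      using almost_equivariant_conj[OF A \<phi>h equiv[OF twist[OF \<phi>] \<phi>] Fn, where \<epsilon> = "(1/2)^n"] by auto
    let ?\<psi> = "\<lambda>x. adj w * \<phi> x * w"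
    have "?\<psi> \<in> P"
      using star_hom_conj_unitary[OF cstar_sub_axioms \<phi>h w(1,2)] \<phi> approx_equiv_conj[OF w(1,2)]
      by (rule closed_P)
    moreover have "R n \<phi> ?\<psi>"
      unfolding R_def using w(3) w(4) by (blast intro: less_imp_le)
    ultimately show "\<exists>\<psi>. \<psi> \<in> P \<and> R n \<phi> \<psi>" by blast
  qed
  then obtain f where f: "\<And>n. f n \<in> P" "\<And>n. R n (f n) (f (Suc n))" by blast
  have fh: "f n \<in> star_hom S' S" for n using f P by auto
  have "Cauchy (\<lambda>n. f n (d i))" for i
  proof (rule Cauchy_geometric[where m = "Suc i" and C = "2 * ?k + 1"])
    fix n assume "n \<ge> Suc i"
    then obtain p where p: "n = Suc p" "i \<le> p" by (cases n) auto
    have "norm (\<sigma> g (f n (\<alpha> (inv g) (d i))) - f n (d i)) \<le> (1/2)^p" if "g \<in> carrier G" for g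
      using f(2)[of p] dF[OF p(2)] that unfolding R_def p(1) by blast
    then have "norm (f (Suc n) (d i) - f n (d i)) \<le> ?k * (1/2)^p + (1/2)^n"
      using f(2)[of n] dF[of i n] p unfolding R_def by simp
    then show "norm (f (Suc n) (d i) - f n (d i)) \<le> (2 * ?k + 1) * (1/2)^n"
      by (simp add: p algebra_simps)
  qed
  then obtain \<Phi> where \<Phi>: "\<Phi> \<in> star_hom S' S" and lim: "\<And>x. x \<in> S' \<Longrightarrow> (\<lambda>n. f n x) \<longlonglongrightarrow> \<Phi> x"
    using A.hom_pointwise_limit[where f = f, OF cstar_sub_axioms fh d] by blast
  have "approx_equiv S S' \<Phi> (f 0)"
    by (rule approx_equiv_limit[OF _ lim]) (use equiv f in auto)
  then have "\<Phi> \<in> P" using closed_P[OF \<Phi> f(1)] by blast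
  have eq: "\<sigma> g (\<Phi> (\<alpha> (inv g) (d i))) = \<Phi> (d i)" if g: "g \<in> carrier G" for g i
  proof -
    let ?a = "\<alpha> (inv g) (d i)"
    have a: "?a \<in> S'" using g dS A.action_closed by auto
    have S: "f n ?a \<in> S" "\<Phi> ?a \<in> S" for n using star_homD(1)[OF fh a] star_homD(1)[OF \<Phi> a] by auto
    have "(\<lambda>n. f n ?a) \<doteq> (\<lambda>_. \<Phi> ?a)" using lim[OF a] by (simp add: asym_const_iff)
    then have "(\<lambda>n. \<sigma> g (f n ?a)) \<doteq> (\<lambda>_. \<sigma> g (\<Phi> ?a))"
      by (rule asym_action) (use S g in auto)
    then have 1: "(\<lambda>n. \<sigma> g (f n ?a)) \<longlonglongrightarrow> \<sigma> g (\<Phi> ?a)" by (simp add: asym_const_iff)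
    have "(\<lambda>n. \<sigma> g (f n ?a) - f n (d i)) \<longlonglongrightarrow> 0"
    proof (rule Lim_null_comparison)
      show "eventually (\<lambda>n. norm (\<sigma> g (f n ?a) - f n (d i)) \<le> 2 * (1/2)^n) sequentially"
      proof (rule eventually_sequentiallyI)
        fix n assume "Suc i \<le> n"
        then obtain p where p: "n = Suc p" "i \<le> p" by (cases n) auto
        have "norm (\<sigma> g (f n ?a) - f n (d i)) \<le> (1/2)^p"
          using f(2)[of p] dF[OF p(2)] g unfolding R_def p(1) by blast
        then show "norm (\<sigma> g (f n ?a) - f n (d i)) \<le> 2 * (1/2)^n" by (simp add: p)
      qed
      show "(\<lambda>n. 2 * (1/2::real)^n) \<longlonglongrightarrow> 0"
        by (intro tendsto_mult_right_zero LIMSEQ_power_zero) simp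
    qed
    moreover have "(\<lambda>n. \<sigma> g (f n ?a) - f n (d i)) \<longlonglongrightarrow> \<sigma> g (\<Phi> ?a) - \<Phi> (d i)"
      by (intro tendsto_diff 1 lim dS)
    ultimately show ?thesis using LIMSEQ_unique by fastforce
  qed
  have "\<Phi> (\<alpha> g x) = \<sigma> g (\<Phi> x)" if g: "g \<in> carrier G" and x: "x \<in> S'" for g x
  proof -
    have "(\<lambda>x. \<sigma> g (\<Phi> (\<alpha> (inv g) x))) \<in> star_hom S' S"
      using g star_hom_comp[OF star_hom_comp[OF A.action_hom \<Phi>] action_hom] by simp
    then have "\<sigma> g (\<Phi> (\<alpha> (inv g) y)) = \<Phi> y" if "y \<in> S'" for y
      using hom_eq_on_dense[OF A.cstar_sub_axioms _ \<Phi> d eq[OF g] that] by blast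
    from this[of "\<alpha> g x"] show ?thesis using g x by (simp add: A.action_closed A.action_inv')
  qed
  then show ?thesis using that[OF \<open>\<Phi> \<in> P\<close>] by blast
qed

end

text \<open>This identifies both composites of the limit maps of an intertwining.\<close>

lemma approximate_inverse_limit:
  assumes T: "cstar_sub T" and g: "\<And>n. g n \<in> star_hom T S"
    and x: "\<And>n. x n \<in> T" "x \<longlonglongrightarrow> l" "l \<in> T" and m: "(\<lambda>n. g n l) \<longlonglongrightarrow> m"
    and inv: "\<And>n. i \<le> n \<Longrightarrow> norm (g n (x n) - a) \<le> (1/2) ^ n"
  shows "m = a"
proof -
  have "(\<lambda>n. norm (x n - l) + (1/2)^n) \<longlonglongrightarrow> 0 + 0"
    by (intro tendsto_add LIMSEQ_power_zero tendsto_norm_zero) (use x(2) in \<open>simp_all add: LIM_zero\<close>)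
  then have *: "(\<lambda>n. norm (x n - l) + (1/2)^n) \<longlonglongrightarrow> 0" by simp
  have "(\<lambda>n. g n l - a) \<longlonglongrightarrow> 0"
  proof (rule Lim_null_comparison[OF _ *], rule eventually_sequentiallyI)
    fix n assume "i \<le> n"
    have "norm (g n (x n) - g n l) \<le> norm (x n - l)" by (rule cstar_sub.hom_dist_le[OF T g x(1,3)])
    then show "norm (g n l - a) \<le> norm (x n - l) + (1/2)^n" using inv[OF \<open>i \<le> n\<close>] by norm
  qed
  then show ?thesis using LIMSEQ_unique[OF m LIM_zero_cancel] by simp
qed

text \<open>The intertwining argument of Elliott: alternately choose \<open>\<psi>\<^sub>n\<close> almost left inverse to \<open>\<phi>\<^sub>n\<close>, and \<open>\<phi>\<^sub>n\<^sub>+\<^sub>1\<close> almost left inverse to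
\<open>\<psi>\<^sub>n\<close>, on growing finite sets. Since \<open>\<phi>\<^sub>n\<^sub>+\<^sub>1 \<approx> \<phi>\<^sub>n\<^sub>+\<^sub>1 \<circ> \<psi>\<^sub>n \<circ> \<phi>\<^sub>n \<approx> \<phi>\<^sub>n\<close>, both sequences converge, and their
limits are mutually inverse.\<close>

lemma two_sided_intertwining:
  fixes a b :: "nat \<Rightarrow> 'u::unital_cstar"
  assumes S: "cstar_sub S" "range a \<subseteq> S" "S \<subseteq> closure (range a)"
    and T: "cstar_sub T" "range b \<subseteq> T" "T \<subseteq> closure (range b)"
    and P: "P \<subseteq> star_hom S T" "P \<noteq> {}" and Q: "Q \<subseteq> star_hom T S" "Q \<noteq> {}"
    and PQ: "\<And>\<phi> \<psi> F \<epsilon>. \<lbrakk>\<phi> \<in> P; \<psi> \<in> Q; finite F; F \<subseteq> S; 0 < \<epsilon>\<rbrakk> \<Longrightarrow> \<exists>\<psi>'\<in>Q. \<forall>x\<in>F. norm (\<psi>' (\<phi> x) - x) < \<epsilon>"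
    and QP: "\<And>\<phi> \<psi> F \<epsilon>. \<lbrakk>\<phi> \<in> P; \<psi> \<in> Q; finite F; F \<subseteq> T; 0 < \<epsilon>\<rbrakk> \<Longrightarrow> \<exists>\<phi>'\<in>P. \<forall>y\<in>F. norm (\<phi>' (\<psi> y) - y) < \<epsilon>"
  obtains f \<Phi> where "\<And>n. f n \<in> P" "\<And>x. x \<in> S \<Longrightarrow> (\<lambda>n. f n x) \<longlonglongrightarrow> \<Phi> x" "\<Phi> \<in> star_hom S T" "bij_betw \<Phi> S T"
proof -
  interpret S: cstar_sub S by fact
  interpret T: cstar_sub T by fact
  have aS: "a i \<in> S" and bT: "b i \<in> T" for i using S T by auto
  define I where "I n p \<longleftrightarrow> fst p \<in> P \<and> snd p \<in> Q \<and> (\<forall>i\<le>n. norm (snd p (fst p (a i)) - a i) \<le> (1/2)^n)"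
    for n :: nat and p :: "('u \<Rightarrow> 'u) \<times> ('u \<Rightarrow> 'u)"
  \<comment> \<open>The values of the previous maps are included, since the estimates of consecutive distances apply
the approximate inverses to them.\<close>
  define R where "R n p q \<longleftrightarrow>
     (\<forall>i\<le>n. norm (fst q (snd p (b i)) - b i) \<le> (1/2)^n \<and>
       norm (fst q (snd p (fst p (a i))) - fst p (a i)) \<le> (1/2)^n \<and>
       norm (snd q (fst q (snd p (b i))) - snd p (b i)) \<le> (1/2)^n)"
    for n :: nat and p q :: "('u \<Rightarrow> 'u) \<times> ('u \<Rightarrow> 'u)"
  have "\<exists>f. \<forall>n. I n (f n) \<and> R n (f n) (f (Suc n))"
  proof (rule dependent_nat_choice)
    obtain \<phi> \<psi> where "\<phi> \<in> P" "\<psi> \<in> Q" using P Q by auto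
    then obtain \<psi>' where "\<psi>' \<in> Q" "\<forall>x\<in>{a 0}. norm (\<psi>' (\<phi> x) - x) < 1" using PQ[of \<phi> \<psi> "{a 0}" 1] aS by auto
    then have "I 0 (\<phi>, \<psi>')" using \<open>\<phi> \<in> P\<close> by (simp add: I_def)
    then show "\<exists>p. I 0 p" by blast
    fix p and n :: nat assume p: "I n p"
    have e: "(1/2::real)^n > 0" "(1/2::real)^Suc n > 0" by simp_all
    have pP: "fst p \<in> P" "snd p \<in> Q" using p by (auto simp: I_def)
    have hom: "fst p \<in> star_hom S T" "snd p \<in> star_hom T S" using pP P Q by auto
    let ?F = "b ` {..n} \<union> fst p ` a ` {..n}" and ?E = "a ` {..Suc n} \<union> snd p ` b ` {..n}"
    have "?F \<subseteq> T" "?E \<subseteq> S" using aS bT star_homD(1)[OF hom(1)] star_homD(1)[OF hom(2)] by auto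
    then obtain \<phi> where \<phi>: "\<phi> \<in> P" "\<forall>y\<in>?F. norm (\<phi> (snd p y) - y) < (1/2)^n"
      using QP[OF pP _ _ e(1), of ?F] by auto
    then obtain \<psi> where \<psi>: "\<psi> \<in> Q" "\<forall>x\<in>?E. norm (\<psi> (\<phi> x) - x) < (1/2)^Suc n"
      using PQ[OF \<phi>(1) pP(2) _ \<open>?E \<subseteq> S\<close> e(2)] by auto
    have pow: "(1/2::real)^Suc n \<le> (1/2)^n" by (intro power_decreasing) auto
    have \<psi>n: "norm (\<psi> (\<phi> x) - x) < (1/2)^n" if "x \<in> ?E" for x
      by (rule less_le_trans[OF \<psi>(2)[rule_format, OF that] pow])
    have "R n p (\<phi>, \<psi>)"
      unfolding R_def fst_conv snd_conv
    proof (intro allI impI conjI less_imp_le)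
      fix i assume "i \<le> n"
      then show "norm (\<phi> (snd p (b i)) - b i) < (1/2)^n"
        "norm (\<phi> (snd p (fst p (a i))) - fst p (a i)) < (1/2)^n"
        by (auto intro!: \<phi>(2)[rule_format])
      show "norm (\<psi> (\<phi> (snd p (b i))) - snd p (b i)) < (1/2)^n"
        using \<open>i \<le> n\<close> by (intro \<psi>n) auto
    qed
    moreover have "I (Suc n) (\<phi>, \<psi>)"
      unfolding I_def fst_conv snd_conv
      using \<phi>(1) \<psi>(1) by (auto intro!: less_imp_le \<psi>(2)[rule_format] simp del: power_Suc)
    ultimately show "\<exists>q. I (Suc n) q \<and> R n p q" by blast
  qed
  then obtain p where I: "\<And>n. I n (p n)" and R: "\<And>n. R n (p n) (p (Suc n))" by blast
  define f g where "f n = fst (p n)" and "g n = snd (p n)" for n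
  have fP: "f n \<in> P" and gQ: "g n \<in> Q" for n using I[of n] by (auto simp: I_def f_def g_def)
  have fh: "f n \<in> star_hom S T" and gh: "g n \<in> star_hom T S" for n using fP gQ P Q by auto
  note fc = star_homD(1)[OF fh] and gc = star_homD(1)[OF gh]
  have gf: "norm (g n (f n (a i)) - a i) \<le> (1/2)^n" if "i \<le> n" for i n
    using I[of n] that by (auto simp: I_def f_def g_def)
  have fg: "norm (f (Suc n) (g n (b i)) - b i) \<le> (1/2)^n"
    and fgf: "norm (f (Suc n) (g n (f n (a i))) - f n (a i)) \<le> (1/2)^n"
    and gfg: "norm (g (Suc n) (f (Suc n) (g n (b i))) - g n (b i)) \<le> (1/2)^n" if "i \<le> n" for i n
    using R[of n] that by (auto simp: R_def f_def g_def)
  have "Cauchy (\<lambda>n. f n (a i))" for i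
  proof (rule Cauchy_geometric[where m = i and C = 2])
    fix n assume n: "i \<le> n"
    have "norm (f (Suc n) (g n (f n (a i))) - f (Suc n) (a i)) \<le> norm (g n (f n (a i)) - a i)"
      by (intro S.hom_dist_le[OF fh] gc fc aS)
    then show "norm (f (Suc n) (a i) - f n (a i)) \<le> 2 * (1/2)^n"
      using fgf[OF n] gf[OF n] by norm
  qed
  then obtain \<Phi> where \<Phi>: "\<Phi> \<in> star_hom S T" and limf: "\<And>x. x \<in> S \<Longrightarrow> (\<lambda>n. f n x) \<longlonglongrightarrow> \<Phi> x"
    using S.hom_pointwise_limit[where f = f, OF T(1) fh S(2,3)] by blast
  have "Cauchy (\<lambda>n. g n (b i))" for i
  proof (rule Cauchy_geometric[where m = i and C = 2])
    fix n assume n: "i \<le> n"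
    have "norm (g (Suc n) (f (Suc n) (g n (b i))) - g (Suc n) (b i)) \<le> norm (f (Suc n) (g n (b i)) - b i)"
      by (intro T.hom_dist_le[OF gh] gc fc bT)
    then show "norm (g (Suc n) (b i) - g n (b i)) \<le> 2 * (1/2)^n"
      using gfg[OF n] fg[OF n] by norm
  qed
  then obtain \<Psi> where \<Psi>: "\<Psi> \<in> star_hom T S" and limg: "\<And>y. y \<in> T \<Longrightarrow> (\<lambda>n. g n y) \<longlonglongrightarrow> \<Psi> y"
    using T.hom_pointwise_limit[where f = g, OF S(1) gh T(2,3)] by blast
  have \<Psi>\<Phi>: "\<Psi> (\<Phi> (a i)) = a i" for i
  proof -
    have \<Phi>a: "\<Phi> (a i) \<in> T" using star_homD(1)[OF \<Phi>] aS by blast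
    show ?thesis
      by (rule approximate_inverse_limit[OF T(1) gh fc[OF aS] limf[OF aS] \<Phi>a limg[OF \<Phi>a] gf])
  qed
  have \<Phi>\<Psi>: "\<Phi> (\<Psi> (b i)) = b i" for i
  proof -
    have \<Psi>b: "\<Psi> (b i) \<in> S" using star_homD(1)[OF \<Psi>] bT by blast
    show ?thesis
      by (rule approximate_inverse_limit[OF S(1) fh gc[OF bT] limg[OF bT] \<Psi>b LIMSEQ_Suc[OF limf[OF \<Psi>b]] fg])
  qed
  have "bij_betw \<Phi> S T"
  proof (rule bij_betwI[where g = \<Psi>])
    show "\<Phi> \<in> S \<rightarrow> T" "\<Psi> \<in> T \<rightarrow> S" using star_homD(1)[OF \<Phi>] star_homD(1)[OF \<Psi>] by auto
    have id: "(\<lambda>x. x) \<in> star_hom W W" for W :: "'u set" by (simp add: star_hom_def)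
    show "\<Psi> (\<Phi> x) = x" if "x \<in> S" for x
      by (rule hom_eq_on_dense[OF S(1) star_hom_comp[OF \<Phi> \<Psi>] id S(2,3) \<Psi>\<Phi> that])
    show "\<Phi> (\<Psi> y) = y" if "y \<in> T" for y
      by (rule hom_eq_on_dense[OF T(1) star_hom_comp[OF \<Psi> \<Phi>] id T(2,3) \<Phi>\<Psi> that])
  qed
  then show ?thesis using that[OF fP limf \<Phi>] by blast
qed

text \<open>Through a fixed unitary, the composite is equivalent to the identity; conjugating \<open>\<psi>\<close> by that unitary
keeps it equivariant.\<close>

lemma (in tower) approximate_left_inverse:
  assumes A: "dynamical_system S' G \<alpha>"
    and \<phi>: "\<phi> \<in> star_hom S S'" "\<And>g x. g \<in> carrier G \<Longrightarrow> x \<in> S \<Longrightarrow> \<phi> (\<sigma> g x) = \<alpha> g (\<phi> x)"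
    and \<psi>: "\<psi> \<in> star_hom S' S" "\<And>g y. g \<in> carrier G \<Longrightarrow> y \<in> S' \<Longrightarrow> \<psi> (\<alpha> g y) = \<sigma> g (\<psi> y)"
    and equiv: "approx_equiv S S (\<lambda>x. x) (\<lambda>x. \<psi> (\<phi> x))" and F: "finite F" "F \<subseteq> S" "0 < \<epsilon>"
  obtains \<psi>' where "\<psi>' \<in> star_hom S' S" "approx_equiv S S' \<psi>' \<psi>"
    "\<And>g y. g \<in> carrier G \<Longrightarrow> y \<in> S' \<Longrightarrow> \<psi>' (\<alpha> g y) = \<sigma> g (\<psi>' y)"
    "\<And>x. x \<in> F \<Longrightarrow> norm (\<psi>' (\<phi> x) - x) < \<epsilon>"
proof -
  have id: "(\<lambda>x. x) \<in> star_hom S S" by (simp add: star_hom_def)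
  have "approx_equiv fixed S (\<lambda>x. x) (\<lambda>x. \<psi> (\<phi> x))"
    using \<phi> \<psi> star_homD(1)[OF \<phi>(1)]
    by (intro equivariant_approx_equiv[OF dynamical_system_axioms id _ star_hom_comp[OF \<phi>(1) \<psi>(1)]] equiv) auto
  then obtain u where u: "unitary u" "u - 1 \<in> fixed" "\<And>a. a \<in> F \<Longrightarrow> norm (a - adj u * \<psi> (\<phi> a) * u) < \<epsilon>"
    by (rule approx_equivD[OF _ F(3,1,2)]) blast
  have uS: "u - 1 \<in> S" using u by simp
  show ?thesis
  proof (rule that[OF star_hom_conj_unitary[OF cstar_sub_axioms \<psi>(1) u(1) uS] approx_equiv_conj[OF u(1) uS]])
    show "adj u * \<psi> (\<alpha> g y) * u = \<sigma> g (adj u * \<psi> y * u)" if "g \<in> carrier G" "y \<in> S'" for g y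
      using hom_conj[OF action_hom[OF that(1)] uS star_homD(1)[OF \<psi>(1) that(2)]] u(2) \<psi>(2) that by simp
    show "norm (adj u * \<psi> (\<phi> x) * u - x) < \<epsilon>" if "x \<in> F" for x
      using u(3)[OF that] by (simp add: norm_minus_commute)
  qed
qed

text \<open>The equivariant members of \<open>P\<close> and \<open>Q\<close> form nonempty classes by \<open>exists_equivariant\<close>, and they are stable under
conjugation by fixed unitaries. The composites are equivariant and approximately unitarily
equivalent to identities, hence equivalent to them through fixed unitaries, and conjugating one
factor by such a unitary provides the approximate inverses required for the intertwining.\<close>

lemma equivariant_bijection:
  assumes S: "tower S G \<alpha> r" and T: "tower T G \<beta> s"
    and P: "P \<subseteq> star_hom S T" "P \<noteq> {}" and Q: "Q \<subseteq> star_hom T S" "Q \<noteq> {}"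
    and P_equiv: "\<And>\<phi> \<psi>. \<phi> \<in> P \<Longrightarrow> \<psi> \<in> P \<Longrightarrow> approx_equiv T S \<phi> \<psi>"
    and P_closed: "\<And>\<phi> \<psi>. \<phi> \<in> star_hom S T \<Longrightarrow> \<psi> \<in> P \<Longrightarrow> approx_equiv T S \<phi> \<psi> \<Longrightarrow> \<phi> \<in> P"
    and P_twist: "\<And>\<phi> g. \<phi> \<in> P \<Longrightarrow> g \<in> carrier G \<Longrightarrow> (\<lambda>x. \<beta> g (\<phi> (\<alpha> (inv\<^bsub>G\<^esub> g) x))) \<in> P"
    and Q_equiv: "\<And>\<phi> \<psi>. \<phi> \<in> Q \<Longrightarrow> \<psi> \<in> Q \<Longrightarrow> approx_equiv S T \<phi> \<psi>"
    and Q_closed: "\<And>\<phi> \<psi>. \<phi> \<in> star_hom T S \<Longrightarrow> \<psi> \<in> Q \<Longrightarrow> approx_equiv S T \<phi> \<psi> \<Longrightarrow> \<phi> \<in> Q"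
    and Q_twist: "\<And>\<phi> g. \<phi> \<in> Q \<Longrightarrow> g \<in> carrier G \<Longrightarrow> (\<lambda>x. \<alpha> g (\<phi> (\<beta> (inv\<^bsub>G\<^esub> g) x))) \<in> Q"
    and QP: "\<And>\<phi> \<psi>. \<phi> \<in> P \<Longrightarrow> \<psi> \<in> Q \<Longrightarrow> approx_equiv S S (\<lambda>x. x) (\<lambda>x. \<psi> (\<phi> x))"
    and PQ: "\<And>\<phi> \<psi>. \<phi> \<in> P \<Longrightarrow> \<psi> \<in> Q \<Longrightarrow> approx_equiv T T (\<lambda>y. y) (\<lambda>y. \<phi> (\<psi> y))"
  obtains \<Phi> where "\<Phi> \<in> P" "bij_betw \<Phi> S T"
    "\<And>g x. g \<in> carrier G \<Longrightarrow> x \<in> S \<Longrightarrow> \<Phi> (\<alpha> g x) = \<beta> g (\<Phi> x)"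
proof -
  interpret S: tower S G \<alpha> r by fact
  interpret T: tower T G \<beta> s by fact
  obtain a b :: "nat \<Rightarrow> 'a" where ab: "range a \<subseteq> S" "S \<subseteq> closure (range a)" "range b \<subseteq> T" "T \<subseteq> closure (range b)"
    using S.separable T.separable by blast
  define P' where "P' = {\<phi> \<in> P. \<forall>g\<in>carrier G. \<forall>x\<in>S. \<phi> (\<alpha> g x) = \<beta> g (\<phi> x)}"
  define Q' where "Q' = {\<psi> \<in> Q. \<forall>g\<in>carrier G. \<forall>y\<in>T. \<psi> (\<beta> g y) = \<alpha> g (\<psi> y)}"
  have ne: "P' \<noteq> {}" "Q' \<noteq> {}"
  proof -
    have "\<exists>\<phi>\<in>P. \<forall>g\<in>carrier G. \<forall>x\<in>S. \<phi> (\<alpha> g x) = \<beta> g (\<phi> x)"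
      by (rule T.exists_equivariant[OF S.dynamical_system_axioms P P_equiv P_closed P_twist]) auto
    then show "P' \<noteq> {}" by (auto simp: P'_def)
    have "\<exists>\<psi>\<in>Q. \<forall>g\<in>carrier G. \<forall>y\<in>T. \<psi> (\<beta> g y) = \<alpha> g (\<psi> y)"
      by (rule S.exists_equivariant[OF T.dynamical_system_axioms Q Q_equiv Q_closed Q_twist]) auto
    then show "Q' \<noteq> {}" by (auto simp: Q'_def)
  qed
  have hom: "P' \<subseteq> star_hom S T" "Q' \<subseteq> star_hom T S" using P Q by (auto simp: P'_def Q'_def)
  have sub: "P' \<subseteq> P" "Q' \<subseteq> Q" by (auto simp: P'_def Q'_def)
  have 1: "\<exists>\<psi>'\<in>Q'. \<forall>x\<in>F. norm (\<psi>' (\<phi> x) - x) < \<epsilon>"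
    if \<phi>: "\<phi> \<in> P'" and \<psi>: "\<psi> \<in> Q'" and F: "finite F" "F \<subseteq> S" "0 < \<epsilon>" for \<phi> \<psi> F \<epsilon>
  proof (rule S.approximate_left_inverse[where \<phi> = \<phi> and \<psi> = \<psi>,
        OF T.dynamical_system_axioms _ _ _ _ QP[OF subsetD[OF sub(1) \<phi>] subsetD[OF sub(2) \<psi>]] F])
    fix \<psi>' assume "\<psi>' \<in> star_hom T S" "approx_equiv S T \<psi>' \<psi>"
      "\<And>g y. g \<in> carrier G \<Longrightarrow> y \<in> T \<Longrightarrow> \<psi>' (\<beta> g y) = \<alpha> g (\<psi>' y)"
      "\<And>x. x \<in> F \<Longrightarrow> norm (\<psi>' (\<phi> x) - x) < \<epsilon>"
    then show ?thesis using \<psi> Q_closed[of \<psi>' \<psi>] by (intro bexI[of _ \<psi>']) (auto simp: Q'_def)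
  qed (use \<phi> \<psi> hom in \<open>auto simp: P'_def Q'_def\<close>)
  have 2: "\<exists>\<phi>'\<in>P'. \<forall>y\<in>F. norm (\<phi>' (\<psi> y) - y) < \<epsilon>"
    if \<phi>: "\<phi> \<in> P'" and \<psi>: "\<psi> \<in> Q'" and F: "finite F" "F \<subseteq> T" "0 < \<epsilon>" for \<phi> \<psi> F \<epsilon>
  proof (rule T.approximate_left_inverse[where \<phi> = \<psi> and \<psi> = \<phi>,
        OF S.dynamical_system_axioms _ _ _ _ PQ[OF subsetD[OF sub(1) \<phi>] subsetD[OF sub(2) \<psi>]] F])
    fix \<phi>' assume "\<phi>' \<in> star_hom S T" "approx_equiv T S \<phi>' \<phi>"
      "\<And>g y. g \<in> carrier G \<Longrightarrow> y \<in> S \<Longrightarrow> \<phi>' (\<alpha> g y) = \<beta> g (\<phi>' y)"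
      "\<And>x. x \<in> F \<Longrightarrow> norm (\<phi>' (\<psi> x) - x) < \<epsilon>"
    then show ?thesis using \<phi> P_closed[of \<phi>' \<phi>] by (intro bexI[of _ \<phi>']) (auto simp: P'_def)
  qed (use \<phi> \<psi> hom in \<open>auto simp: P'_def Q'_def\<close>)
  obtain f \<Phi> where f: "\<And>n. f n \<in> P'" and lim: "\<And>x. x \<in> S \<Longrightarrow> (\<lambda>n. f n x) \<longlonglongrightarrow> \<Phi> x"
    and \<Phi>: "\<Phi> \<in> star_hom S T" "bij_betw \<Phi> S T"
    by (rule two_sided_intertwining[OF S.cstar_sub_axioms ab(1,2) T.cstar_sub_axioms ab(3,4)
          hom(1) ne(1) hom(2) ne(2)], (rule 1; assumption), (rule 2; assumption), (rule that; assumption))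
  have fP: "f n \<in> P" and fh: "f n \<in> star_hom S T" for n using f[of n] hom by (auto simp: P'_def)
  have "approx_equiv T S \<Phi> (f 0)"
    by (rule approx_equiv_limit[OF P_equiv[OF fP fP] lim])
  then have "\<Phi> \<in> P" using P_closed[OF \<Phi>(1) fP] by blast
  moreover have "\<Phi> (\<alpha> g x) = \<beta> g (\<Phi> x)" if g: "g \<in> carrier G" and x: "x \<in> S" for g x
  proof (rule LIMSEQ_unique)
    show "(\<lambda>n. f n (\<alpha> g x)) \<longlonglongrightarrow> \<Phi> (\<alpha> g x)" using S.action_closed g x by (intro lim)
    have "(\<lambda>n. \<beta> g (f n x)) \<doteq> (\<lambda>_. \<beta> g (\<Phi> x))"
      using lim[OF x] star_homD(1)[OF fh x] star_homD(1)[OF \<Phi>(1) x] g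
      by (intro T.asym_action) (auto simp: asym_const_iff)
    then show "(\<lambda>n. f n (\<alpha> g x)) \<longlonglongrightarrow> \<beta> g (\<Phi> x)"
      using f g x by (simp add: asym_const_iff P'_def)
  qed
  ultimately show ?thesis using that \<Phi>(2) by blast
qed

section \<open>The unitization is a C*-algebra\<close>

context cstar_algebra
begin

abbreviation "U \<equiv> unitization A"

text \<open>The action of \<open>a + s 1\<close> on \<open>A\<close> by left multiplication, whose operator norm is one of the two terms
in the norm of the unitization.\<close>

definition act :: "'a \<times> complex \<Rightarrow> 'a \<Rightarrow> 'a" where
  "act x b = fst x \<boxtimes> b \<boxplus> snd x \<boxdot> b"

definition op_norm :: "'a \<times> complex \<Rightarrow> real" where
  "op_norm x = (SUP b\<in>{b \<in> carrier A. cnorm A b \<le> 1}. cnorm A (act x b))"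

lemma add_left_commute:
  "\<lbrakk>x \<in> carrier A; y \<in> carrier A; z \<in> carrier A\<rbrakk> \<Longrightarrow> x \<boxplus> (y \<boxplus> z) = y \<boxplus> (x \<boxplus> z)"
  by (metis add_assoc add_commute)

lemma zero_add: "x \<in> carrier A \<Longrightarrow> czero A \<boxplus> x = x"
  by (simp add: add_commute add_zero zero_closed)

lemma scale_zero: "s \<boxdot> czero A = czero A"
  by (metis mult_zero_right scale_scale zero_closed zero_scale)

lemma mult_zero: "x \<in> carrier A \<Longrightarrow> x \<boxtimes> czero A = czero A"
  by (metis mult_closed mult_scale_right zero_closed zero_scale)

lemma zero_mult: "x \<in> carrier A \<Longrightarrow> czero A \<boxtimes> x = czero A"
  by (metis mult_closed mult_scale_left zero_closed zero_scale)

lemma star_zero: "cstar A (czero A) = czero A"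
  by (metis complex_cnj_zero star_closed star_scale zero_closed zero_scale)

lemma norm_zero: "cnorm A (czero A) = 0"
  using norm_zero_iff zero_closed by blast

lemmas closed = add_closed scale_closed mult_closed star_closed zero_closed
lemmas expand = scale_add_right scale_add_left scale_scale mult_assoc mult_add_left mult_add_right
  mult_scale_left mult_scale_right star_add star_scale star_mult star_star
  add_assoc add_commute add_left_commute

lemma unitization_simps:
  "carrier U = carrier A \<times> UNIV"
  "x \<boxplus>\<^bsub>U\<^esub> y = (fst x \<boxplus> fst y, snd x + snd y)"
  "czero U = (czero A, 0)"
  "c \<boxdot>\<^bsub>U\<^esub> x = (c \<boxdot> fst x, c * snd x)"
  "x \<boxtimes>\<^bsub>U\<^esub> y =
     (fst x \<boxtimes> fst y \<boxplus> snd x \<boxdot> fst y \<boxplus> snd y \<boxdot> fst x, snd x * snd y)"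
  "cstar U x = (cstar A (fst x), cnj (snd x))"
  "cnorm U x = max (cmod (snd x)) (op_norm x)"
  by (simp_all add: unitization_def split_beta op_norm_def act_def)

lemma act_closed: "x \<in> carrier U \<Longrightarrow> b \<in> carrier A \<Longrightarrow> act x b \<in> carrier A"
  by (auto simp: act_def unitization_simps closed)

lemma norm_act_le:
  assumes "x \<in> carrier U" "b \<in> carrier A"
  shows "cnorm A (act x b) \<le> (cnorm A (fst x) + cmod (snd x)) * cnorm A b"
proof -
  have "cnorm A (act x b) \<le> cnorm A (fst x \<boxtimes> b) + cnorm A (snd x \<boxdot> b)"
    unfolding act_def using assms by (intro norm_triangle) (auto simp: unitization_simps closed)
  also have "\<dots> \<le> cnorm A (fst x) * cnorm A b + cmod (snd x) * cnorm A b"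
    using assms by (intro add_mono norm_mult) (auto simp: unitization_simps norm_scale)
  finally show ?thesis by (simp add: algebra_simps)
qed

lemma bdd_above_act:
  assumes x: "x \<in> carrier U"
  shows "bdd_above ((\<lambda>b. cnorm A (act x b)) ` {b \<in> carrier A. cnorm A b \<le> 1})"
proof (rule bdd_aboveI2)
  fix b assume b: "b \<in> {b \<in> carrier A. cnorm A b \<le> 1}"
  have "0 \<le> cnorm A (fst x) + cmod (snd x)"
    using x by (auto simp: unitization_simps intro!: add_nonneg_nonneg norm_nonneg)
  then have "(cnorm A (fst x) + cmod (snd x)) * cnorm A b \<le> (cnorm A (fst x) + cmod (snd x)) * 1"
    using b by (intro mult_left_mono) auto
  then show "cnorm A (act x b) \<le> cnorm A (fst x) + cmod (snd x)"
    using norm_act_le[OF x, of b] b by simp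
qed

lemma act_le_op_norm:
  assumes x: "x \<in> carrier U" and b: "b \<in> carrier A"
  shows "cnorm A (act x b) \<le> op_norm x * cnorm A b"
proof (cases "cnorm A b = 0")
  case True
  then show ?thesis using norm_act_le[OF x b] norm_nonneg[OF act_closed[OF x b]] by simp
next
  case False
  then have pos: "cnorm A b > 0" using norm_nonneg[OF b] by simp
  define c where "c = complex_of_real (inverse (cnorm A b)) \<boxdot> b"
  have c: "c \<in> carrier A" "cnorm A c = 1"
    using b pos by (auto simp: c_def closed norm_scale norm_inverse)
  have "cnorm A (act x c) \<le> op_norm x"
    unfolding op_norm_def using c by (intro cSUP_upper bdd_above_act[OF x]) auto
  moreover have "act x c = complex_of_real (inverse (cnorm A b)) \<boxdot> act x b"
    using x b by (auto simp: act_def c_def unitization_simps closed expand mult.commute)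
  ultimately show ?thesis
    using pos by (simp add: norm_scale act_closed[OF x b] norm_divide norm_inverse field_simps)
qed

lemma op_norm_least:
  assumes "\<And>b. b \<in> carrier A \<Longrightarrow> cnorm A b \<le> 1 \<Longrightarrow> cnorm A (act x b) \<le> K"
  shows "op_norm x \<le> K"
  unfolding op_norm_def using assms zero_closed norm_zero by (intro cSUP_least) auto

lemma op_norm_nonneg: "x \<in> carrier U \<Longrightarrow> 0 \<le> op_norm x"
proof -
  assume x: "x \<in> carrier U"
  have "cnorm A (act x (czero A)) \<le> op_norm x"
    unfolding op_norm_def using zero_closed norm_zero by (intro cSUP_upper bdd_above_act[OF x]) auto
  then show ?thesis using norm_nonneg[OF act_closed[OF x zero_closed]] by simp
qed

lemma act_mult:
  assumes "x \<in> carrier U" "y \<in> carrier U" "b \<in> carrier A"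
  shows "act (x \<boxtimes>\<^bsub>U\<^esub> y) b = act x (act y b)"
  using assms by (auto simp: act_def unitization_simps closed expand)

lemma op_norm_mult:
  assumes x: "x \<in> carrier U" and y: "y \<in> carrier U"
  shows "op_norm (x \<boxtimes>\<^bsub>U\<^esub> y) \<le> op_norm x * op_norm y"
proof (rule op_norm_least)
  fix b assume b: "b \<in> carrier A" "cnorm A b \<le> 1"
  have "cnorm A (act x (act y b)) \<le> op_norm x * cnorm A (act y b)"
    using act_le_op_norm[OF x act_closed[OF y b(1)]] .
  also have "\<dots> \<le> op_norm x * (op_norm y * cnorm A b)"
    using act_le_op_norm[OF y b(1)] op_norm_nonneg[OF x] by (rule mult_left_mono)
  also have "\<dots> \<le> op_norm x * (op_norm y * 1)"
    using b op_norm_nonneg[OF x] op_norm_nonneg[OF y] by (intro mult_left_mono) auto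
  finally show "cnorm A (act (x \<boxtimes>\<^bsub>U\<^esub> y) b) \<le> op_norm x * op_norm y"
    using act_mult[OF x y b(1)] by simp
qed

lemma op_norm_scale:
  assumes x: "x \<in> carrier U"
  shows "op_norm (c \<boxdot>\<^bsub>U\<^esub> x) = cmod c * op_norm x"
proof -
  have le: "op_norm (c \<boxdot>\<^bsub>U\<^esub> x) \<le> cmod c * op_norm x"
    if x: "x \<in> carrier U" for c x
  proof (rule op_norm_least)
    fix b assume b: "b \<in> carrier A" "cnorm A b \<le> 1"
    have "act (c \<boxdot>\<^bsub>U\<^esub> x) b = c \<boxdot> act x b"
      using x b by (auto simp: act_def unitization_simps closed expand)
    then have "cnorm A (act (c \<boxdot>\<^bsub>U\<^esub> x) b) = cmod c * cnorm A (act x b)"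
      using act_closed[OF x b(1)] by (simp add: norm_scale)
    also have "\<dots> \<le> cmod c * (op_norm x * cnorm A b)"
      using act_le_op_norm[OF x b(1)] by (intro mult_left_mono) auto
    also have "\<dots> \<le> cmod c * (op_norm x * 1)"
      using b op_norm_nonneg[OF x] by (intro mult_left_mono) auto
    finally show "cnorm A (act (c \<boxdot>\<^bsub>U\<^esub> x) b) \<le> cmod c * op_norm x" by simp
  qed
  show ?thesis
  proof (cases "c = 0")
    case True
    have y: "c \<boxdot>\<^bsub>U\<^esub> x \<in> carrier U" using x by (auto simp: unitization_simps closed)
    then show ?thesis using le[OF x, of c] op_norm_nonneg[OF y] True by simp
  next
    case False
    let ?y = "c \<boxdot>\<^bsub>U\<^esub> x"
    have y: "?y \<in> carrier U" using x by (auto simp: unitization_simps closed)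
    have "inverse c \<boxdot>\<^bsub>U\<^esub> ?y = x"
      using x False by (auto simp: unitization_simps scale_scale scale_one)
    then have "op_norm x \<le> cmod (inverse c) * op_norm ?y" using le[OF y, of "inverse c"] by simp
    then have "cmod c * op_norm x \<le> op_norm ?y" using False by (simp add: norm_divide norm_inverse field_simps)
    then show ?thesis using le[OF x, of c] by simp
  qed
qed

text \<open>This is the C*-identity of \<open>A\<close> applied to \<open>x b\<close>, since \<open>(x b)\<^sup>* (x b) = b\<^sup>* ((x\<^sup>* x) b)\<close>.\<close>

lemma op_norm_square_le:
  assumes x: "x \<in> carrier U"
  shows "(op_norm x)\<^sup>2 \<le> op_norm (cstar U x \<boxtimes>\<^bsub>U\<^esub> x)"
proof -
  let ?s = "cstar U x" let ?z = "?s \<boxtimes>\<^bsub>U\<^esub> x"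
  have s: "?s \<in> carrier U" and z: "?z \<in> carrier U"
    using x by (auto simp: unitization_simps closed)
  have "op_norm x \<le> sqrt (op_norm ?z)"
  proof (rule op_norm_least)
    fix b assume b: "b \<in> carrier A" "cnorm A b \<le> 1"
    have "cstar A (act x b) \<boxtimes> act x b = cstar A b \<boxtimes> act ?s (act x b)"
      using x b by (auto simp: act_def unitization_simps closed expand mult.commute)
    then have "(cnorm A (act x b))\<^sup>2 = cnorm A (cstar A b \<boxtimes> act ?z b)"
      using act_closed[OF x b(1)] by (simp add: act_mult[OF s x b(1)] flip: cstar_identity)
    also have "\<dots> \<le> cnorm A b * cnorm A (act ?z b)"
      using norm_mult[OF star_closed[OF b(1)] act_closed[OF z b(1)]] norm_star[OF b(1)] by simp
    also have "\<dots> \<le> 1 * (op_norm ?z * cnorm A b)"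
      using b act_le_op_norm[OF z b(1)] norm_nonneg act_closed[OF z b(1)] by (intro mult_mono) auto
    also have "\<dots> \<le> op_norm ?z"
      using b op_norm_nonneg[OF z] mult_left_mono[of "cnorm A b" 1] by simp
    finally show "cnorm A (act x b) \<le> sqrt (op_norm ?z)" by (rule real_le_rsqrt)
  qed
  then have "(op_norm x)\<^sup>2 \<le> (sqrt (op_norm ?z))\<^sup>2" using op_norm_nonneg[OF x] by (rule power_mono)
  then show ?thesis using op_norm_nonneg[OF z] by simp
qed

lemma op_norm_cstar:
  assumes x: "x \<in> carrier U"
  shows "op_norm (cstar U x \<boxtimes>\<^bsub>U\<^esub> x) = (op_norm x)\<^sup>2"
proof -
  have s: "cstar U x \<in> carrier U" if "x \<in> carrier U" for x
    using that by (auto simp: unitization_simps closed)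
  have le: "op_norm y \<le> op_norm (cstar U y)" if y: "y \<in> carrier U" for y
  proof (cases "op_norm y = 0")
    case True then show ?thesis using op_norm_nonneg[OF s[OF y]] by simp
  next
    case False
    have "op_norm y * op_norm y \<le> op_norm (cstar U y) * op_norm y"
      using op_norm_square_le[OF y] op_norm_mult[OF s[OF y] y] by (simp add: power2_eq_square)
    then show ?thesis using False op_norm_nonneg[OF y] by (simp add: mult_le_cancel_right)
  qed
  have "cstar U (cstar U x) = x"
    using x by (auto simp: unitization_simps star_star)
  then have "op_norm (cstar U x) = op_norm x" using le[OF x] le[OF s[OF x]] by simp
  then show ?thesis
    using op_norm_square_le[OF x] op_norm_mult[OF s[OF x] x] by (simp add: power2_eq_square)
qed

lemma op_norm_triangle:
  assumes x: "x \<in> carrier U" and y: "y \<in> carrier U"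
  shows "op_norm (x \<boxplus>\<^bsub>U\<^esub> y) \<le> op_norm x + op_norm y"
proof (rule op_norm_least)
  fix b assume b: "b \<in> carrier A" "cnorm A b \<le> 1"
  have "act (x \<boxplus>\<^bsub>U\<^esub> y) b = act x b \<boxplus> act y b"
    using x y b by (auto simp: act_def unitization_simps closed expand)
  then have "cnorm A (act (x \<boxplus>\<^bsub>U\<^esub> y) b) \<le> cnorm A (act x b) + cnorm A (act y b)"
    using norm_triangle act_closed x y b by simp
  also have "\<dots> \<le> op_norm x * cnorm A b + op_norm y * cnorm A b"
    using act_le_op_norm x y b by (intro add_mono) auto
  also have "\<dots> \<le> op_norm x * 1 + op_norm y * 1"
    using b op_norm_nonneg x y by (intro add_mono mult_left_mono) auto
  finally show "cnorm A (act (x \<boxplus>\<^bsub>U\<^esub> y) b) \<le> op_norm x + op_norm y" by simp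
qed

lemma convergent_of_Cauchy:
  assumes x: "\<And>n::nat. x n \<in> carrier A"
    and C: "\<And>e. e > 0 \<Longrightarrow> \<exists>N. \<forall>m\<ge>N. \<forall>n\<ge>N. cnorm A (x m \<boxminus> x n) < e"
  obtains l where "l \<in> carrier A" "\<And>e. e > 0 \<Longrightarrow> \<exists>N. \<forall>n\<ge>N. cnorm A (x n \<boxminus> l) < e"
proof -
  interpret M: Metric_space "carrier A" "cdist A" by (rule Metric_space_cdist)
  have "M.MCauchy x"
    unfolding M.MCauchy_def using x C by (auto simp: cdist_def)
  then obtain l where "limitin M.mtopology x l sequentially"
    using complete by (auto simp: M.mcomplete_def)
  then have "l \<in> carrier A" "\<And>e. e > 0 \<Longrightarrow> \<exists>N. \<forall>n\<ge>N. cdist A (x n) l < e"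
    unfolding M.limit_metric_sequentially by metis+
  then show ?thesis using that x by (auto simp: cdist_def)
qed

text \<open>Completeness holds because the scalar part is a coordinate dominated by the norm, so that a
Cauchy sequence has convergent scalar part and, after subtracting it, a Cauchy part in \<open>A\<close>.\<close>

lemma cstar_algebra_unitization: "cstar_algebra U"
proof -
  let ?U = U
  note us = unitization_simps
  have tri: "cnorm ?U (x \<boxplus>\<^bsub>?U\<^esub> y) \<le> cnorm ?U x + cnorm ?U y"
    if "x \<in> carrier ?U" "y \<in> carrier ?U" for x y
    using op_norm_triangle[OF that] norm_triangle_ineq[of "snd x" "snd y"]
    by (auto simp: us(7)) (auto simp: us(2))
  have scale: "cnorm ?U (c \<boxdot>\<^bsub>?U\<^esub> x) = cmod c * cnorm ?U x" if "x \<in> carrier ?U" for c x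
  proof -
    have "cnorm ?U (c \<boxdot>\<^bsub>?U\<^esub> x) = max (cmod c * cmod (snd x)) (cmod c * op_norm x)"
      unfolding us(7) op_norm_scale[OF that] by (simp add: us Real_Vector_Spaces.norm_mult)
    then show ?thesis by (simp add: us(7) max_mult_distrib_left)
  qed
  have zero: "cnorm ?U x = 0 \<longleftrightarrow> x = czero ?U" if x: "x \<in> carrier ?U" for x
  proof
    assume 0: "cnorm ?U x = 0"
    then have s: "snd x = 0" by (auto simp: us(7) max_def split: if_splits dest: antisym)
    have "cnorm A (fst x) = 0"
      using norm_unitization[of "fst x"] x 0 s by (metis mem_Times_iff prod.collapse us(1))
    then show "x = czero ?U" using x s norm_zero_iff by (auto simp: us)
  next
    assume "x = czero ?U"
    then show "cnorm ?U x = 0" using norm_unitization[OF zero_closed] norm_zero by (simp add: us(3))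
  qed
  have nonneg: "0 \<le> cnorm ?U x" for x by (simp add: us(7) le_max_iff_disj)
  have metric: "Metric_space (carrier ?U) (cdist ?U)"
  proof
    fix x y
    show "0 \<le> cdist ?U x y" using nonneg by (simp add: cdist_def)
    show "cdist ?U x y = cdist ?U y x"
    proof (cases "x \<in> carrier ?U \<and> y \<in> carrier ?U")
      case True
      then have "y \<boxminus>\<^bsub>?U\<^esub> x = (- 1) \<boxdot>\<^bsub>?U\<^esub> (x \<boxminus>\<^bsub>?U\<^esub> y)" "x \<boxminus>\<^bsub>?U\<^esub> y \<in> carrier ?U"
        by (auto simp: us cminus_def closed expand scale_one)
      then have "cnorm ?U (y \<boxminus>\<^bsub>?U\<^esub> x) = cnorm ?U (x \<boxminus>\<^bsub>?U\<^esub> y)" using scale by simp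
      then show ?thesis by (simp add: cdist_def)
    qed (auto simp: cdist_def)
    assume x: "x \<in> carrier ?U" and y: "y \<in> carrier ?U"
    have xy: "x \<boxminus>\<^bsub>?U\<^esub> y \<in> carrier ?U" using x y by (auto simp: us cminus_def closed)
    have "x \<boxminus>\<^bsub>?U\<^esub> y = czero ?U \<longleftrightarrow> x = y"
    proof
      assume "x \<boxminus>\<^bsub>?U\<^esub> y = czero ?U"
      then have "fst x \<boxminus> fst y = czero A" "snd x = snd y" by (auto simp: us cminus_def)
      then have "fst x = fst y"
        using minus_add_cancel[of "fst x" "fst y"] x y by (auto simp: us zero_add)
      then show "x = y" using \<open>snd x = snd y\<close> by (rule prod_eqI)
    next
      assume "x = y"
      then show "x \<boxminus>\<^bsub>?U\<^esub> y = czero ?U" using minus_self[of "fst x"] x by (auto simp: us cminus_def)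
    qed
    then show "cdist ?U x y = 0 \<longleftrightarrow> x = y" using zero[OF xy] x y by (simp add: cdist_def)
    fix z assume z: "z \<in> carrier ?U"
    have "x \<boxminus>\<^bsub>?U\<^esub> z = (x \<boxminus>\<^bsub>?U\<^esub> y) \<boxplus>\<^bsub>?U\<^esub> (y \<boxminus>\<^bsub>?U\<^esub> z)"
    proof -
      have "fst x \<boxminus> fst z = (fst x \<boxminus> fst y) \<boxplus> (fst y \<boxminus> fst z)"
        using x y z minus_add_cancel[of "fst x" "fst y"]
        by (metis add_assoc cminus_def minus_closed scale_closed mem_Times_iff us(1))
      then show ?thesis by (simp add: us cminus_def)
    qed
    moreover have "y \<boxminus>\<^bsub>?U\<^esub> z \<in> carrier ?U" using y z by (auto simp: us cminus_def closed)
    ultimately show "cdist ?U x z \<le> cdist ?U x y + cdist ?U y z"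
      using tri[OF xy, of "y \<boxminus>\<^bsub>?U\<^esub> z"] x y z by (simp add: cdist_def)
  qed
  show ?thesis
  proof (rule cstar_algebra.intro)
    show "comm_group (additive_monoid ?U)"
    proof (rule comm_groupI)
      fix x assume x: "x \<in> carrier (additive_monoid ?U)"
      have "(- 1) \<boxdot> fst x \<boxplus> fst x = czero A"
        using minus_self[of "fst x"] x by (auto simp: additive_monoid_def us cminus_def closed add_commute)
      then show "\<exists>y\<in>carrier (additive_monoid ?U). y \<otimes>\<^bsub>additive_monoid ?U\<^esub> x = \<one>\<^bsub>additive_monoid ?U\<^esub>"
        using x by (intro bexI[of _ "((- 1) \<boxdot> fst x, - snd x)"]) (auto simp: additive_monoid_def us closed)
    qed (auto simp: additive_monoid_def us closed zero_add add_zero expand)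
    show "cnorm ?U (x \<boxtimes>\<^bsub>?U\<^esub> y) \<le> cnorm ?U x * cnorm ?U y"
      if x: "x \<in> carrier ?U" and y: "y \<in> carrier ?U" for x y
    proof -
      have "cmod (snd x) * cmod (snd y) \<le> cnorm ?U x * cnorm ?U y"
        "op_norm x * op_norm y \<le> cnorm ?U x * cnorm ?U y"
        using op_norm_nonneg[OF x] op_norm_nonneg[OF y]
        by (auto simp: us(7) intro!: mult_mono simp: le_max_iff_disj)
      then show ?thesis
        unfolding us(7)[of "x \<boxtimes>\<^bsub>?U\<^esub> y"] using op_norm_mult[OF x y] by (auto simp: us(5) Real_Vector_Spaces.norm_mult)
    qed
    show "cnorm ?U (cstar ?U x \<boxtimes>\<^bsub>?U\<^esub> x) = (cnorm ?U x)\<^sup>2" if x: "x \<in> carrier ?U" for x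
    proof -
      have "cnorm ?U (cstar ?U x \<boxtimes>\<^bsub>?U\<^esub> x) = max ((cmod (snd x))\<^sup>2) ((op_norm x)\<^sup>2)"
        unfolding us(7) op_norm_cstar[OF x] by (simp add: us Real_Vector_Spaces.norm_mult power2_eq_square)
      also have "\<dots> = (max (cmod (snd x)) (op_norm x))\<^sup>2"
        using op_norm_nonneg[OF x] by (auto simp: max_def power_mono intro: antisym dest: power2_le_imp_le)
      finally show ?thesis by (simp add: us(7))
    qed
    interpret M: Metric_space "carrier ?U" "cdist ?U" by (rule metric)
    show "M.mcomplete"
      unfolding M.mcomplete_def
    proof (intro allI impI)
      fix x :: "nat \<Rightarrow> 'a \<times> complex" assume "M.MCauchy x"
      note MC = this[unfolded M.MCauchy_def]
      have xU: "x n \<in> carrier ?U" for n using conjunct1[OF MC] by blast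
      have C: "\<exists>N. \<forall>m\<ge>N. \<forall>n\<ge>N. cdist ?U (x m) (x n) < e" if "e > 0" for e
        using conjunct2[OF MC, THEN spec, THEN mp, OF that] by auto
      have diff: "x m \<boxminus>\<^bsub>?U\<^esub> x n = (fst (x m) \<boxminus> fst (x n), snd (x m) - snd (x n))" for m n
        by (simp add: us cminus_def)
      have fA: "fst (x n) \<in> carrier A" for n using xU[of n] by (auto simp: us)
      have snd_le: "cmod (snd (x m) - snd (x n)) \<le> cdist ?U (x m) (x n)" for m n
        using xU by (simp add: cdist_def diff us(7))
      \<comment> \<open>Changing the scalar part by \<open>s - t\<close> changes the norm by at most \<open>\<bar>s - t\<bar>\<close>, as the unit has norm at most 1.\<close>
      have shift: "cnorm ?U (a, s) \<le> cnorm ?U (a, t) + cmod (s - t)" if "a \<in> carrier A" for a s t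
      proof -
        have "cmod (s - t) * cnorm ?U (czero A, 1) \<le> cmod (s - t) * 1"
        proof (rule mult_left_mono)
          have "op_norm (czero A, 1) \<le> 1"
            by (rule op_norm_least) (simp add: act_def zero_mult scale_one zero_add)
          then show "cnorm ?U (czero A, 1) \<le> 1" by (simp add: us(7))
        qed simp
        moreover have "(a, s) = (a, t) \<boxplus>\<^bsub>?U\<^esub> ((s - t) \<boxdot>\<^bsub>?U\<^esub> (czero A, 1))"
          using that by (simp add: us scale_zero add_zero)
        ultimately show ?thesis
          using tri[of "(a, t)" "(s - t) \<boxdot>\<^bsub>?U\<^esub> (czero A, 1)"] scale[of "(czero A, 1)" "s - t"] that
          by (simp add: us(1) us(4) scale_zero zero_closed)
      qed
      have fst_le: "cnorm A (fst (x m) \<boxminus> fst (x n)) \<le> 2 * cdist ?U (x m) (x n)" for m n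
      proof -
        have a: "fst (x m) \<boxminus> fst (x n) \<in> carrier A" using fA by (simp add: minus_closed)
        show ?thesis
          using shift[OF a, of 0 "snd (x m) - snd (x n)"] snd_le[of m n] xU norm_minus_commute[of "snd (x n)" "snd (x m)"]
          by (simp add: norm_unitization[OF a] cdist_def diff)
      qed
      have "Cauchy (\<lambda>n. snd (x n))"
      proof (rule metric_CauchyI)
        fix e :: real assume "e > 0"
        then obtain N where "\<forall>m\<ge>N. \<forall>n\<ge>N. cdist ?U (x m) (x n) < e" using C by blast
        then show "\<exists>N. \<forall>m\<ge>N. \<forall>n\<ge>N. dist (snd (x m)) (snd (x n)) < e"
          unfolding dist_norm using snd_le le_less_trans by blast
      qed
      then obtain s where s: "(\<lambda>n. snd (x n)) \<longlonglongrightarrow> s" by (auto simp: Cauchy_convergent_iff convergent_def)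
      have "\<exists>N. \<forall>m\<ge>N. \<forall>n\<ge>N. cnorm A (fst (x m) \<boxminus> fst (x n)) < e" if e: "e > 0" for e
      proof -
        obtain N where N: "\<forall>m\<ge>N. \<forall>n\<ge>N. cdist ?U (x m) (x n) < e/2" using C[OF half_gt_zero[OF e]] by blast
        have "cnorm A (fst (x m) \<boxminus> fst (x n)) < e" if "m \<ge> N" "n \<ge> N" for m n
          using fst_le[of m n] N that by fastforce
        then show ?thesis by blast
      qed
      then obtain l where l: "l \<in> carrier A" "\<And>e. e > 0 \<Longrightarrow> \<exists>N. \<forall>n\<ge>N. cnorm A (fst (x n) \<boxminus> l) < e"
        using convergent_of_Cauchy[of "\<lambda>n. fst (x n)"] fA by blast
      have "limitin M.mtopology x (l, s) sequentially"
        unfolding M.limit_metric_sequentially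
      proof (intro conjI allI impI)
        show "(l, s) \<in> carrier ?U" using l by (simp add: us)
        fix e :: real assume e: "e > 0"
        obtain N1 where N1: "\<forall>n\<ge>N1. cnorm A (fst (x n) \<boxminus> l) < e/2" using l(2)[of "e/2"] e by auto
        obtain N2 where N2: "\<forall>n\<ge>N2. cmod (snd (x n) - s) < e/2"
          using LIMSEQ_D[OF s, of "e/2"] e by auto
        have "cdist ?U (x n) (l, s) < e" if n: "n \<ge> max N1 N2" for n
        proof -
          have a: "fst (x n) \<boxminus> l \<in> carrier A" using fA l by (simp add: minus_closed)
          have "cdist ?U (x n) (l, s) = cnorm ?U (fst (x n) \<boxminus> l, snd (x n) - s)"
            using xU l by (simp add: cdist_def us cminus_def)
          also have "\<dots> \<le> cnorm A (fst (x n) \<boxminus> l) + cmod (snd (x n) - s)"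
            using shift[OF a, of "snd (x n) - s" 0] by (simp add: norm_unitization[OF a])
          finally show ?thesis using N1 N2 n by (smt (verit) field_sum_of_halves max.boundedE)
        qed
        then show "\<exists>N. \<forall>n\<ge>N. x n \<in> carrier ?U \<and> cdist ?U (x n) (l, s) < e" using xU by blast
      qed
      then show "\<exists>l. limitin M.mtopology x l sequentially" by blast
    qed
  qed (use nonneg zero tri scale in \<open>auto simp: us(1-6) closed expand scale_one distrib_left distrib_right mult.commute mult.left_commute\<close>)
qed

end

section \<open>One C*-algebra containing all C*-algebras over a type\<close>

text \<open>The index type \<open>'a calg\<close> makes the set of all C*-algebras over \<open>'a\<close> available as a type, so
that sections need no side condition on the index. It is inhabited by the zero algebra.\<close>

typedef 'a calg = "{A :: 'a cstar. cstar_algebra A}"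
proof
  define Z :: "'a cstar" where "Z = \<lparr>carrier = {undefined}, cadd = \<lambda>_ _. undefined, czero = undefined,
    cscale = \<lambda>_ _. undefined, cmult = \<lambda>_ _. undefined, cstar = \<lambda>_. undefined, cnorm = \<lambda>_. 0\<rparr>"
  have "cstar_algebra Z"
  proof (rule cstar_algebra.intro)
    show "comm_group (additive_monoid Z)"
      by (rule comm_groupI) (auto simp: Z_def additive_monoid_def)
    interpret M: Metric_space "carrier Z" "cdist Z"
      by standard (auto simp: Z_def cdist_def)
    show "M.mcomplete"
      unfolding M.mcomplete_def M.limit_metric_sequentially M.MCauchy_def
      by (auto simp: Z_def cdist_def image_subset_iff)
  qed (auto simp: Z_def)
  then show "Z \<in> {A. cstar_algebra A}" by simp
qed

abbreviation fibre :: "'a calg \<Rightarrow> ('a \<times> complex) cstar" where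
  "fibre i \<equiv> unitization (Rep_calg i)"

interpretation fibre: cstar_algebra "fibre i" for i :: "'a calg"
  using cstar_algebra.cstar_algebra_unitization Rep_calg by blast

interpretation base: cstar_algebra "Rep_calg i" for i :: "'a calg"
  using Rep_calg by blast

typedef 'a ambient = "{f :: 'a calg \<Rightarrow> 'a \<times> complex.
    (\<forall>i. f i \<in> carrier (fibre i)) \<and> (\<exists>B. \<forall>i. cnorm (fibre i) (f i) \<le> B)}"
  morphisms val Abs_ambient
proof
  show "(\<lambda>i. czero (fibre i)) \<in> {f. (\<forall>i. f i \<in> carrier (fibre i)) \<and> (\<exists>B. \<forall>i. cnorm (fibre i) (f i) \<le> B)}"
    by (auto simp: fibre.zero_closed fibre.norm_zero)
qed

lemma val_in [simp]: "val f i \<in> carrier (fibre i)"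
  using val[of f] by auto

lemma val_bounded: "\<exists>B. \<forall>i. cnorm (fibre i) (val f i) \<le> B"
  using val[of f] by auto

lemma val_Abs:
  assumes "\<And>i. f i \<in> carrier (fibre i)" "\<And>i. cnorm (fibre i) (f i) \<le> B"
  shows "val (Abs_ambient f) = f"
  using assms by (intro Abs_ambient_inverse) auto

lemma ambient_eqI: "(\<And>i. val f i = val g i) \<Longrightarrow> f = g"
  by (simp add: val_inject[symmetric] ext)

abbreviation unit_of :: "'a calg \<Rightarrow> 'a \<times> complex" where
  "unit_of i \<equiv> unitization_one (Rep_calg i)"

lemma unit_closed: "unit_of i \<in> carrier (fibre i)"
  by (simp add: unitization_one_def base.unitization_simps base.zero_closed)

lemma unit_mult: "x \<in> carrier (fibre i) \<Longrightarrow> unit_of i \<boxtimes>\<^bsub>fibre i\<^esub> x = x"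
  "x \<in> carrier (fibre i) \<Longrightarrow> x \<boxtimes>\<^bsub>fibre i\<^esub> unit_of i = x"
  by (auto simp: unitization_one_def base.unitization_simps base.zero_closed base.zero_mult base.mult_zero
      base.scale_zero base.scale_one base.zero_add base.add_zero)

lemma norm_unit: "cnorm (fibre i) (unit_of i) = 1"
proof -
  have "cstar (fibre i) (unit_of i) = unit_of i"
    by (simp add: unitization_one_def base.unitization_simps base.star_zero)
  then have "(cnorm (fibre i) (unit_of i))\<^sup>2 = cnorm (fibre i) (unit_of i)"
    using fibre.cstar_identity[OF unit_closed[of i]] unit_mult[OF unit_closed[of i]] by simp
  moreover have "cnorm (fibre i) (unit_of i) \<ge> 1"
    by (simp add: unitization_one_def base.unitization_simps le_max_iff_disj)
  ultimately show ?thesis by (simp add: power2_eq_square)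
qed

instantiation ambient :: (type) "{zero, one, plus, minus, uminus, times, scaleR}"
begin

definition "0 = Abs_ambient (\<lambda>i. czero (fibre i))"
definition "1 = Abs_ambient unit_of"
definition "f + g = Abs_ambient (\<lambda>i. val f i \<boxplus>\<^bsub>fibre i\<^esub> val g i)"
definition "f - g = Abs_ambient (\<lambda>i. val f i \<boxminus>\<^bsub>fibre i\<^esub> val g i)"
definition "- f = Abs_ambient (\<lambda>i. (- 1) \<boxdot>\<^bsub>fibre i\<^esub> val f i)"
definition "f * g = Abs_ambient (\<lambda>i. val f i \<boxtimes>\<^bsub>fibre i\<^esub> val g i)"
definition "c *\<^sub>R f = Abs_ambient (\<lambda>i. complex_of_real c \<boxdot>\<^bsub>fibre i\<^esub> val f i)"
instance ..

end

lemma val_scale: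
  "val (Abs_ambient (\<lambda>i. c \<boxdot>\<^bsub>fibre i\<^esub> val f i)) = (\<lambda>i. c \<boxdot>\<^bsub>fibre i\<^esub> val f i)"
proof -
  obtain B where B: "\<And>i. cnorm (fibre i) (val f i) \<le> B" using val_bounded[of f] by blast
  show ?thesis
    by (rule val_Abs[where B = "cmod c * B"])
      (auto simp: fibre.closed fibre.norm_scale intro!: mult_left_mono B)
qed

lemma val_add: "val (f + g) i = val f i \<boxplus>\<^bsub>fibre i\<^esub> val g i"
proof -
  obtain B C where B: "\<And>i. cnorm (fibre i) (val f i) \<le> B" "\<And>i. cnorm (fibre i) (val g i) \<le> C"
    using val_bounded[of f] val_bounded[of g] by blast
  have "val (f + g) = (\<lambda>i. val f i \<boxplus>\<^bsub>fibre i\<^esub> val g i)"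
    unfolding plus_ambient_def
    by (rule val_Abs[where B = "B + C"])
      (auto simp: fibre.closed intro: order_trans[OF fibre.norm_triangle[OF val_in val_in] add_mono[OF B]])
  then show ?thesis by simp
qed

lemma val_mult: "val (f * g) i = val f i \<boxtimes>\<^bsub>fibre i\<^esub> val g i"
proof -
  obtain B C where B: "\<And>i. cnorm (fibre i) (val f i) \<le> B" "\<And>i. cnorm (fibre i) (val g i) \<le> C"
    using val_bounded[of f] val_bounded[of g] by blast
  have "cnorm (fibre i) (val f i \<boxtimes>\<^bsub>fibre i\<^esub> val g i) \<le> B * C" for i
    using B[of i] fibre.norm_nonneg[OF val_in[of f i]] fibre.norm_nonneg[OF val_in[of g i]]
    by (intro order_trans[OF fibre.norm_mult] mult_mono) auto
  then have "val (f * g) = (\<lambda>i. val f i \<boxtimes>\<^bsub>fibre i\<^esub> val g i)"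
    unfolding times_ambient_def by (intro val_Abs) (auto simp: fibre.closed)
  then show ?thesis by simp
qed

lemma val_zero: "val 0 i = czero (fibre i)"
  unfolding zero_ambient_def by (subst val_Abs[where B = 0]) (auto simp: fibre.closed fibre.norm_zero)
lemma val_one: "val 1 i = unit_of i"
  unfolding one_ambient_def by (subst val_Abs[where B = 1]) (auto simp: unit_closed norm_unit)
lemma val_uminus: "val (- f) i = (- 1) \<boxdot>\<^bsub>fibre i\<^esub> val f i"
  unfolding uminus_ambient_def by (simp add: val_scale)
lemma val_scaleR: "val (c *\<^sub>R f) i = complex_of_real c \<boxdot>\<^bsub>fibre i\<^esub> val f i"
  unfolding scaleR_ambient_def by (simp add: val_scale)
lemma minus_ambient: "f - g = f + (- g :: 'a ambient)"
  unfolding minus_ambient_def plus_ambient_def by (simp add: val_uminus cminus_def)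

lemmas val_simps = val_add val_mult val_zero val_one val_uminus val_scaleR

text \<open>The supremum norm is named separately so that its properties can be stated before \<open>'a ambient\<close> is
known to be a normed space.\<close>

definition sup_norm :: "'a ambient \<Rightarrow> real" where
  "sup_norm f = (SUP i. cnorm (fibre i) (val f i))"

lemma val_le_sup_norm: "cnorm (fibre i) (val f i) \<le> sup_norm f"
  unfolding sup_norm_def using val_bounded[of f] by (intro cSUP_upper) (auto intro: bdd_aboveI2)

lemma sup_norm_le: "(\<And>i. cnorm (fibre i) (val f i) \<le> B) \<Longrightarrow> sup_norm f \<le> B"
  unfolding sup_norm_def by (rule cSUP_least) auto

lemma sup_norm_nonneg: "0 \<le> sup_norm f"
  using order_trans[OF fibre.norm_nonneg[OF val_in] val_le_sup_norm] .

lemma fibre_minus: "x \<in> carrier (fibre i) \<Longrightarrow> (- 1) \<boxdot>\<^bsub>fibre i\<^esub> x \<boxplus>\<^bsub>fibre i\<^esub> x = czero (fibre i)"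
  using fibre.minus_self[of x i] by (simp add: cminus_def fibre.add_commute fibre.closed)

instantiation ambient :: (type) real_normed_algebra_1
begin

definition "norm f = sup_norm (f :: 'a ambient)"
definition "dist f g = norm (f - g :: 'a ambient)"
definition "sgn f = inverse (norm f) *\<^sub>R (f :: 'a ambient)"
definition "uniformity = (INF e\<in>{0<..}. principal {(f, g :: 'a ambient). dist f g < e})"
definition "open (U :: 'a ambient set) \<longleftrightarrow>
  (\<forall>f\<in>U. eventually (\<lambda>(f', g). f' = f \<longrightarrow> g \<in> U) uniformity)"

instance
proof
  fix f g h :: "'a ambient" and a b :: real
  show "f + g + h = f + (g + h)" "f + g = g + f" "0 + f = f" "- f + f = 0"
    by (rule ambient_eqI; simp add: val_simps fibre.add_assoc fibre.add_commute fibre.zero_add fibre_minus)+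
  show "f - g = f + - g" by (rule minus_ambient)
  show "a *\<^sub>R (f + g) = a *\<^sub>R f + a *\<^sub>R g" "(a + b) *\<^sub>R f = a *\<^sub>R f + b *\<^sub>R f"
    "a *\<^sub>R b *\<^sub>R f = (a * b) *\<^sub>R f" "1 *\<^sub>R f = f"
    by (rule ambient_eqI; simp add: val_simps fibre.scale_add_right fibre.scale_add_left fibre.scale_scale fibre.scale_one)+
  show "f * g * h = f * (g * h)" "(f + g) * h = f * h + g * h" "f * (g + h) = f * g + f * h"
    by (rule ambient_eqI; simp add: val_simps fibre.mult_assoc fibre.mult_add_left fibre.mult_add_right)+
  show "1 * f = f" "f * 1 = f"
    by (rule ambient_eqI; simp add: val_simps unit_mult)+
  show "a *\<^sub>R f * g = a *\<^sub>R (f * g)" "f * a *\<^sub>R g = a *\<^sub>R (f * g)"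
    by (rule ambient_eqI; simp add: val_simps fibre.mult_scale_left fibre.mult_scale_right)+
  show n1: "norm (1 :: 'a ambient) = 1"
    unfolding norm_ambient_def sup_norm_def by (simp add: val_one norm_unit)
  have n0: "norm (0 :: 'a ambient) = 0"
    unfolding norm_ambient_def sup_norm_def by (simp add: val_zero fibre.norm_zero)
  show "(0 :: 'a ambient) \<noteq> 1" using n0 n1 by auto
  show "dist f g = norm (f - g)" "sgn f = inverse (norm f) *\<^sub>R f"
    by (simp_all add: dist_ambient_def sgn_ambient_def)
  show "(uniformity :: ('a ambient \<times> 'a ambient) filter) = (INF e\<in>{0<..}. principal {(x, y). dist x y < e})"
    by (rule uniformity_ambient_def)
  show "open U \<longleftrightarrow> (\<forall>x\<in>U. \<forall>\<^sub>F (x', y) in uniformity. x' = x \<longrightarrow> y \<in> U)" for U :: "'a ambient set"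
    by (rule open_ambient_def)
  show "norm f = 0 \<longleftrightarrow> f = 0"
  proof
    assume "norm f = 0"
    then have "cnorm (fibre i) (val f i) = 0" for i
      using val_le_sup_norm[of i f] norm_ambient_def[of f] fibre.norm_nonneg[OF val_in[of f i]] by simp
    then show "f = 0" by (intro ambient_eqI) (simp add: val_zero fibre.norm_zero_iff)
  qed (simp add: n0)
  show "norm (f + g) \<le> norm f + norm g"
    by (unfold norm_ambient_def, rule sup_norm_le)
      (unfold val_add, rule order_trans[OF fibre.norm_triangle[OF val_in val_in] add_mono[OF val_le_sup_norm val_le_sup_norm]])
  have sc: "norm (a *\<^sub>R f) \<le> \<bar>a\<bar> * norm f" for a and f :: "'a ambient"
    by (unfold norm_ambient_def, rule sup_norm_le) (simp add: val_scaleR fibre.norm_scale mult_left_mono val_le_sup_norm)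
  show "norm (a *\<^sub>R f) = \<bar>a\<bar> * norm f"
  proof (cases "a = 0")
    case True
    then show ?thesis using sc[of a f] sup_norm_nonneg[of "a *\<^sub>R f"] by (simp add: norm_ambient_def)
  next
    case False
    have "inverse a *\<^sub>R (a *\<^sub>R f) = f"
      using False by (intro ambient_eqI) (simp add: val_simps fibre.scale_scale fibre.scale_one flip: of_real_mult)
    then have "norm f \<le> \<bar>inverse a\<bar> * norm (a *\<^sub>R f)" by (metis sc)
    then have "\<bar>a\<bar> * norm f \<le> norm (a *\<^sub>R f)" using False by (simp add: field_simps)
    then show ?thesis using sc[of a f] by simp
  qed
  show "norm (f * g) \<le> norm f * norm g"
    by (unfold norm_ambient_def, rule sup_norm_le)
      (unfold val_mult, rule order_trans[OF fibre.norm_mult[OF val_in val_in]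
        mult_mono[OF val_le_sup_norm val_le_sup_norm sup_norm_nonneg fibre.norm_nonneg[OF val_in]]])
qed

end

lemma norm_val_le: "cnorm (fibre i) (val f i) \<le> norm f"
  unfolding norm_ambient_def by (rule val_le_sup_norm)

lemma norm_ambient_le: "(\<And>i. cnorm (fibre i) (val f i) \<le> B) \<Longrightarrow> norm f \<le> B"
  unfolding norm_ambient_def by (rule sup_norm_le)

lemma val_diff: "val (f - g) i = val f i \<boxminus>\<^bsub>fibre i\<^esub> val g i"
  unfolding minus_ambient val_add val_uminus cminus_def ..

instance ambient :: (type) banach
proof
  fix F :: "nat \<Rightarrow> 'a ambient" assume C: "Cauchy F"
  have "\<exists>l. l \<in> carrier (fibre i) \<and> (\<forall>e>0. \<exists>N. \<forall>n\<ge>N. cnorm (fibre i) (val (F n) i \<boxminus>\<^bsub>fibre i\<^esub> l) < e)" for i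
  proof -
    have "\<exists>N. \<forall>m\<ge>N. \<forall>n\<ge>N. cnorm (fibre i) (val (F m) i \<boxminus>\<^bsub>fibre i\<^esub> val (F n) i) < e" if e: "e > 0" for e
    proof -
      obtain N where N: "\<forall>m\<ge>N. \<forall>n\<ge>N. dist (F m) (F n) < e" using metric_CauchyD[OF C e] by blast
      have "cnorm (fibre i) (val (F m) i \<boxminus>\<^bsub>fibre i\<^esub> val (F n) i) < e" if "m \<ge> N" "n \<ge> N" for m n
        using norm_val_le[of i "F m - F n"] N that by (fastforce simp: val_diff dist_norm)
      then show ?thesis by blast
    qed
    then show ?thesis
      using fibre.convergent_of_Cauchy[of "\<lambda>n. val (F n) i" i] val_in by metis
  qed
  then obtain l where l: "\<And>i. l i \<in> carrier (fibre i)"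
    "\<And>i e. e > 0 \<Longrightarrow> \<exists>N. \<forall>n\<ge>N. cnorm (fibre i) (val (F n) i \<boxminus>\<^bsub>fibre i\<^esub> l i) < e"
    by metis
  \<comment> \<open>The convergence is uniform over the fibres: compare with a far member of the sequence, chosen
depending on the fibre, and let the remaining error \<open>d\<close> tend to zero.\<close>
  have close: "cnorm (fibre i) (val (F m) i \<boxminus>\<^bsub>fibre i\<^esub> l i) \<le> e"
    if N: "\<forall>m\<ge>N. \<forall>n\<ge>N. dist (F m) (F n) < e" and m: "m \<ge> N" for N m e i
  proof (rule field_le_epsilon)
    fix d :: real assume "d > 0"
    then obtain M where M: "\<forall>n\<ge>M. cnorm (fibre i) (val (F n) i \<boxminus>\<^bsub>fibre i\<^esub> l i) < d" using l(2) by blast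
    define n where "n = max M N"
    have "val (F m) i \<boxminus>\<^bsub>fibre i\<^esub> l i = (val (F m) i \<boxminus>\<^bsub>fibre i\<^esub> val (F n) i) \<boxplus>\<^bsub>fibre i\<^esub> (val (F n) i \<boxminus>\<^bsub>fibre i\<^esub> l i)"
      using fibre.minus_add_cancel[of "val (F m) i" i "val (F n) i"] l(1)[of i] val_in
      by (metis fibre.add_assoc fibre.minus_closed fibre.scale_closed cminus_def)
    then have "cnorm (fibre i) (val (F m) i \<boxminus>\<^bsub>fibre i\<^esub> l i)
        \<le> cnorm (fibre i) (val (F m) i \<boxminus>\<^bsub>fibre i\<^esub> val (F n) i) + cnorm (fibre i) (val (F n) i \<boxminus>\<^bsub>fibre i\<^esub> l i)"
      using fibre.norm_triangle fibre.minus_closed val_in l(1) by metis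
    also have "cnorm (fibre i) (val (F m) i \<boxminus>\<^bsub>fibre i\<^esub> val (F n) i) \<le> dist (F m) (F n)"
      using norm_val_le[of i "F m - F n"] by (simp add: val_diff dist_norm)
    also have "dist (F m) (F n) < e" using N m by (simp add: n_def)
    also have "cnorm (fibre i) (val (F n) i \<boxminus>\<^bsub>fibre i\<^esub> l i) < d" using M by (simp add: n_def)
    finally show "cnorm (fibre i) (val (F m) i \<boxminus>\<^bsub>fibre i\<^esub> l i) \<le> e + d" by simp
  qed
  have val_l: "val (Abs_ambient l) = l"
  proof -
    obtain N where N: "\<forall>m\<ge>N. \<forall>n\<ge>N. dist (F m) (F n) < 1" using metric_CauchyD[OF C, of 1] by auto
    have "cnorm (fibre i) (l i) \<le> 1 + norm (F N)" for i
    proof -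
      let ?x = "val (F N) i"
      have "l i = (- 1) \<boxdot>\<^bsub>fibre i\<^esub> (?x \<boxminus>\<^bsub>fibre i\<^esub> l i) \<boxplus>\<^bsub>fibre i\<^esub> ?x"
        using l(1)[of i] val_in[of "F N" i] fibre_minus[of ?x i]
        by (simp add: cminus_def fibre.scale_add_right fibre.scale_scale fibre.scale_one fibre.closed fibre.add_assoc
            fibre.add_commute fibre.add_left_commute fibre.add_zero)
      then have "cnorm (fibre i) (l i) \<le> cnorm (fibre i) ((- 1) \<boxdot>\<^bsub>fibre i\<^esub> (?x \<boxminus>\<^bsub>fibre i\<^esub> l i)) + cnorm (fibre i) ?x"
        using fibre.norm_triangle[of "(- 1) \<boxdot>\<^bsub>fibre i\<^esub> (?x \<boxminus>\<^bsub>fibre i\<^esub> l i)" i ?x] l(1)[of i] by (simp add: fibre.closed fibre.minus_closed)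
      also have "\<dots> \<le> 1 + norm (F N)"
        using close[OF N order_refl, of i] norm_val_le[of i "F N"] l(1)[of i]
        by (simp add: fibre.norm_scale fibre.minus_closed)
      finally show ?thesis .
    qed
    then show ?thesis using l(1) by (intro val_Abs)
  qed
  have "F \<longlonglongrightarrow> Abs_ambient l"
  proof (rule metric_LIMSEQ_I)
    fix e :: real assume e: "e > 0"
    obtain N where N: "\<forall>m\<ge>N. \<forall>n\<ge>N. dist (F m) (F n) < e/2" using metric_CauchyD[OF C, of "e/2"] e by auto
    have "dist (F n) (Abs_ambient l) < e" if "n \<ge> N" for n
    proof -
      have "dist (F n) (Abs_ambient l) \<le> e/2"
        unfolding dist_norm by (rule norm_ambient_le) (unfold val_diff val_l, rule close[OF N that])
      then show ?thesis using e by simp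
    qed
    then show "\<exists>N. \<forall>n\<ge>N. dist (F n) (Abs_ambient l) < e" by blast
  qed
  then show "convergent F" by (rule convergentI)
qed

instantiation ambient :: (type) unital_cstar
begin

definition "adj f = Abs_ambient (\<lambda>i. cstar (fibre i) (val f i))"
definition "imu = Abs_ambient (\<lambda>i. \<i> \<boxdot>\<^bsub>fibre i\<^esub> val 1 i)"

lemma val_adj: "val (adj f) i = cstar (fibre i) (val f i)"
  unfolding adj_ambient_def
  by (subst val_Abs[where B = "norm f"]) (auto simp: fibre.closed fibre.norm_star norm_val_le)

lemma val_imu: "val imu i = \<i> \<boxdot>\<^bsub>fibre i\<^esub> unit_of i"
  unfolding imu_ambient_def unfolding val_scale unfolding val_one by (rule refl)

instance
proof
  fix f g :: "'a ambient" and a :: real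
  show "adj (adj f) = f" "adj (f + g) = adj f + adj g" "adj (f * g) = adj g * adj f"
    "adj (a *\<^sub>R f) = a *\<^sub>R adj f"
    by (rule ambient_eqI; simp add: val_adj val_simps fibre.star_star fibre.star_add fibre.star_mult fibre.star_scale)+
  have "cstar (fibre i) (unit_of i) = unit_of i" for i :: "'a calg"
    by (simp add: unitization_one_def base.unitization_simps base.star_zero)
  then show "adj imu = - (imu :: 'a ambient)"
    by (intro ambient_eqI) (simp add: val_adj val_simps val_imu fibre.star_scale unit_closed fibre.scale_scale)
  show "imu * imu = (- 1 :: 'a ambient)"
    by (rule ambient_eqI) (simp add: val_simps val_imu fibre.mult_scale_left fibre.mult_scale_right unit_closed
        fibre.closed fibre.scale_scale unit_mult)
  show "imu * f = f * imu"
    by (rule ambient_eqI) (simp add: val_simps val_imu fibre.mult_scale_left fibre.mult_scale_right unit_closed unit_mult)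
  show "norm (adj f * f) = (norm f)\<^sup>2"
  proof (rule antisym)
    show "norm (adj f * f) \<le> (norm f)\<^sup>2"
      by (rule norm_ambient_le)
        (simp add: val_mult val_adj fibre.cstar_identity power_mono norm_val_le fibre.norm_nonneg)
    have "norm f \<le> sqrt (norm (adj f * f))"
    proof (rule norm_ambient_le)
      fix i
      have "(cnorm (fibre i) (val f i))\<^sup>2 \<le> norm (adj f * f)"
        using norm_val_le[of i "adj f * f"] by (simp add: val_mult val_adj fibre.cstar_identity)
      then show "cnorm (fibre i) (val f i) \<le> sqrt (norm (adj f * f))" by (rule real_le_rsqrt)
    qed
    then have "(norm f)\<^sup>2 \<le> (sqrt (norm (adj f * f)))\<^sup>2" by (intro power_mono norm_ge_zero)
    then show "(norm f)\<^sup>2 \<le> norm (adj f * f)" by simp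
  qed
qed

end

section \<open>Embedding C*-algebras and their homomorphisms\<close>

text \<open>The scalar part of \<open>a + s 1\<close> is placed in every fibre, so that the embedding is unital; the part \<open>a\<close> lives
in the fibre of \<open>A\<close> only.\<close>

definition embed :: "'a cstar \<Rightarrow> 'a \<times> complex \<Rightarrow> 'a ambient" where
  "embed A x = Abs_ambient (\<lambda>i. if Rep_calg i = A then x else snd x \<boxdot>\<^bsub>fibre i\<^esub> unit_of i)"

definition emb :: "'a cstar \<Rightarrow> 'a \<Rightarrow> 'a ambient" where
  "emb A a = embed A (a, 0)"

definition proj :: "'a cstar \<Rightarrow> 'a ambient \<Rightarrow> 'a" where
  "proj A f = fst (val f (Abs_calg A))"

abbreviation alg :: "'a cstar \<Rightarrow> 'a ambient set" where
  "alg A \<equiv> emb A ` carrier A"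

context cstar_algebra
begin

lemma Rep_Abs_calg: "Rep_calg (Abs_calg A) = A"
  using cstar_algebra_axioms by (simp add: Abs_calg_inverse)

lemma val_embed:
  assumes x: "x \<in> carrier U"
  shows "val (embed A x) i = (if Rep_calg i = A then x else snd x \<boxdot>\<^bsub>fibre i\<^esub> unit_of i)"
proof -
  have "val (embed A x) = (\<lambda>i. if Rep_calg i = A then x else snd x \<boxdot>\<^bsub>fibre i\<^esub> unit_of i)"
    unfolding embed_def
    by (rule val_Abs[where B = "cnorm U x"])
      (use x in \<open>auto simp: fibre.closed unit_closed fibre.norm_scale norm_unit unitization_simps(7)\<close>)
  then show ?thesis by simp
qed

lemma U_closed: "x \<in> carrier U \<Longrightarrow> y \<in> carrier U \<Longrightarrow> x \<boxplus>\<^bsub>U\<^esub> y \<in> carrier U"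
  "x \<in> carrier U \<Longrightarrow> y \<in> carrier U \<Longrightarrow> x \<boxtimes>\<^bsub>U\<^esub> y \<in> carrier U"
  "x \<in> carrier U \<Longrightarrow> c \<boxdot>\<^bsub>U\<^esub> x \<in> carrier U" "x \<in> carrier U \<Longrightarrow> cstar U x \<in> carrier U"
  "unitization_one A \<in> carrier U"
  by (auto simp: unitization_simps closed unitization_one_def)

lemma snd_U: "snd (x \<boxplus>\<^bsub>U\<^esub> y) = snd x + snd y" "snd (c \<boxdot>\<^bsub>U\<^esub> x) = c * snd x"
  "snd (x \<boxtimes>\<^bsub>U\<^esub> y) = snd x * snd y" "snd (cstar U x) = cnj (snd x)" "snd (unitization_one A) = 1"
  by (simp_all add: unitization_simps unitization_one_def)

lemma embed_add: "x \<in> carrier U \<Longrightarrow> y \<in> carrier U \<Longrightarrow> embed A (x \<boxplus>\<^bsub>U\<^esub> y) = embed A x + embed A y"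
  by (rule ambient_eqI)
    (simp add: val_embed val_simps U_closed fibre.scale_add_left unit_closed snd_U)

lemma embed_mult: "x \<in> carrier U \<Longrightarrow> y \<in> carrier U \<Longrightarrow> embed A (x \<boxtimes>\<^bsub>U\<^esub> y) = embed A x * embed A y"
  by (rule ambient_eqI)
    (simp add: val_embed val_simps U_closed fibre.mult_scale_left fibre.mult_scale_right fibre.scale_scale
      fibre.closed unit_closed unit_mult snd_U mult.commute)

lemma embed_scaleR: "x \<in> carrier U \<Longrightarrow> embed A (complex_of_real c \<boxdot>\<^bsub>U\<^esub> x) = c *\<^sub>R embed A x"
  by (rule ambient_eqI)
    (simp add: val_embed val_simps U_closed fibre.scale_scale unit_closed snd_U)

lemma embed_imu: "x \<in> carrier U \<Longrightarrow> embed A (\<i> \<boxdot>\<^bsub>U\<^esub> x) = imu * embed A x"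
proof (rule ambient_eqI)
  fix i assume x: "x \<in> carrier U"
  show "val (embed A (\<i> \<boxdot>\<^bsub>U\<^esub> x)) i = val (imu * embed A x) i"
  proof (cases "Rep_calg i = A")
    case True
    have "val imu i \<boxtimes>\<^bsub>fibre i\<^esub> val (embed A x) i = \<i> \<boxdot>\<^bsub>fibre i\<^esub> val (embed A x) i"
      by (simp add: val_imu fibre.mult_scale_left unit_closed unit_mult)
    then show ?thesis using x True by (simp add: val_mult val_embed U_closed)
  next
    case False
    then show ?thesis using x
      by (simp add: val_embed val_mult val_imu U_closed fibre.mult_scale_left fibre.scale_scale unit_closed
          fibre.closed unit_mult snd_U)
  qed
qed

lemma embed_adj: "x \<in> carrier U \<Longrightarrow> embed A (cstar U x) = adj (embed A x)"
proof (rule ambient_eqI)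
  fix i :: "'a calg" assume x: "x \<in> carrier U"
  have "cstar (fibre i) (unit_of i) = unit_of i"
    by (simp add: unitization_one_def base.unitization_simps base.star_zero)
  then show "val (embed A (cstar U x)) i = val (adj (embed A x)) i"
    using x by (simp add: val_embed val_adj U_closed fibre.star_scale unit_closed snd_U)
qed

lemma embed_one: "embed A (unitization_one A) = 1"
proof (rule ambient_eqI)
  show "val (embed A (unitization_one A)) i = val 1 i" for i
    by (cases "Rep_calg i = A") (simp_all add: val_embed U_closed val_one snd_U fibre.scale_one unit_closed)
qed

lemma norm_embed:
  assumes x: "x \<in> carrier U" shows "norm (embed A x) = cnorm U x"
proof (rule antisym)
  show "norm (embed A x) \<le> cnorm U x"
    by (rule norm_ambient_le)
      (use x in \<open>auto simp: val_embed fibre.norm_scale unit_closed norm_unit unitization_simps(7)\<close>)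
  show "cnorm U x \<le> norm (embed A x)"
    using norm_val_le[of "Abs_calg A" "embed A x"] x by (simp add: val_embed Rep_Abs_calg)
qed

lemma embed_eq_iff: "x \<in> carrier U \<Longrightarrow> y \<in> carrier U \<Longrightarrow> embed A x = embed A y \<longleftrightarrow> x = y"
  by (metis Rep_Abs_calg val_embed)

lemma embed_diff:
  "x \<in> carrier U \<Longrightarrow> y \<in> carrier U \<Longrightarrow> embed A (x \<boxminus>\<^bsub>U\<^esub> y) = embed A x - embed A y"
  using embed_scaleR[of y "-1"] by (simp add: cminus_def embed_add U_closed)

lemma embed_scale:
  assumes x: "x \<in> carrier U"
  shows "embed A (c \<boxdot>\<^bsub>U\<^esub> x) = Re c *\<^sub>R embed A x + Im c *\<^sub>R (imu * embed A x)"
proof -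
  have "c \<boxdot>\<^bsub>U\<^esub> x = (complex_of_real (Re c) \<boxdot>\<^bsub>U\<^esub> x) \<boxplus>\<^bsub>U\<^esub> (complex_of_real (Im c) \<boxdot>\<^bsub>U\<^esub> (\<i> \<boxdot>\<^bsub>U\<^esub> x))"
  proof -
    have a: "fst x \<in> carrier A" using x by (auto simp: unitization_simps)
    have c: "c = complex_of_real (Re c) + complex_of_real (Im c) * \<i>" by (simp add: complex_eq_iff)
    show ?thesis
      by (subst (1) c)
        (simp only: unitization_simps fst_conv snd_conv scale_scale[OF a] scale_add_left[OF a] distrib_right mult.assoc)
  qed
  then show ?thesis using x by (simp add: embed_add U_closed embed_scaleR embed_imu)
qed

lemma in_U: "a \<in> carrier A \<Longrightarrow> (a, s) \<in> carrier U"
  by (simp add: unitization_simps)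

lemma proj_emb: "a \<in> carrier A \<Longrightarrow> proj A (emb A a) = a"
  by (simp add: proj_def emb_def val_embed in_U Rep_Abs_calg)

lemma emb_proj: "x \<in> alg A \<Longrightarrow> emb A (proj A x) = x"
  using proj_emb by auto

lemma proj_closed: "x \<in> alg A \<Longrightarrow> proj A x \<in> carrier A"
  using proj_emb by auto

lemma emb_eq_iff: "a \<in> carrier A \<Longrightarrow> b \<in> carrier A \<Longrightarrow> emb A a = emb A b \<longleftrightarrow> a = b"
  by (metis proj_emb)

lemma emb_add: "a \<in> carrier A \<Longrightarrow> b \<in> carrier A \<Longrightarrow> emb A (a \<boxplus> b) = emb A a + emb A b"
  using embed_add[OF in_U in_U, of a b 0 0] by (simp add: emb_def unitization_simps)

lemma emb_mult: "a \<in> carrier A \<Longrightarrow> b \<in> carrier A \<Longrightarrow> emb A (a \<boxtimes> b) = emb A a * emb A b"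
  using embed_mult[OF in_U in_U, of a b 0 0]
  by (simp add: emb_def unitization_simps zero_scale closed add_zero)

lemma emb_scale: "a \<in> carrier A \<Longrightarrow> emb A (c \<boxdot> a) = Re c *\<^sub>R emb A a + Im c *\<^sub>R (imu * emb A a)"
  using embed_scale[OF in_U, of a c 0] by (simp add: emb_def unitization_simps)

lemma emb_star: "a \<in> carrier A \<Longrightarrow> emb A (cstar A a) = adj (emb A a)"
  using embed_adj[OF in_U, of a 0] by (simp add: emb_def unitization_simps)

lemma norm_emb: "a \<in> carrier A \<Longrightarrow> norm (emb A a) = cnorm A a"
  by (simp add: emb_def norm_embed in_U norm_unitization)

lemma emb_diff: "a \<in> carrier A \<Longrightarrow> b \<in> carrier A \<Longrightarrow> emb A (a \<boxminus> b) = emb A a - emb A b"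
  by (simp add: cminus_def emb_add emb_scale closed)

lemma emb_zero: "emb A (czero A) = 0"
  using norm_emb[OF zero_closed] norm_zero by simp

lemma emb_sum:
  assumes "\<And>i. i \<in> I \<Longrightarrow> r i \<in> carrier A" "finite I"
  shows "csum A r I \<in> carrier A \<and> emb A (csum A r I) = (\<Sum>i\<in>I. emb A (r i))"
proof -
  interpret M: comm_monoid "additive_monoid A" using additive by (rule comm_group.axioms)
  have c: "carrier (additive_monoid A) = carrier A" by (simp add: additive_monoid_def)
  show ?thesis using assms(2,1)
  proof (induction I)
    case empty
    then show ?case by (simp add: csum_def emb_zero zero_closed) (simp add: additive_monoid_def emb_zero zero_closed)
  next
    case (insert i I)
    then have "csum A r (insert i I) = r i \<boxplus> csum A r I"
      unfolding csum_def by (subst M.finprod_insert) (auto simp: c, simp add: additive_monoid_def)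
    then show ?case using insert by (simp add: emb_add closed)
  qed
qed

lemma cstar_sub_alg: "cstar_sub (alg A)"
proof
  show "0 \<in> alg A" using emb_zero zero_closed by (metis imageI)
  fix x y c assume x: "x \<in> alg A"
  then obtain a where a: "a \<in> carrier A" "x = emb A a" by auto
  show "c *\<^sub>R x \<in> alg A"
    using emb_scale[OF a(1), of "complex_of_real c"] scale_closed[OF a(1), of "complex_of_real c"] a(2)
    by (metis Im_complex_of_real Re_complex_of_real add.right_neutral imageI scale_zero_left)
  show "imu * x \<in> alg A"
    using emb_scale[OF a(1), of \<i>] scale_closed[OF a(1), of \<i>] a(2) by (auto intro!: image_eqI)
  show "adj x \<in> alg A" using emb_star[OF a(1)] star_closed[OF a(1)] a(2) by (metis imageI)
  assume "y \<in> alg A"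
  then obtain b where b: "b \<in> carrier A" "y = emb A b" by auto
  show "x + y \<in> alg A" using emb_add[OF a(1) b(1)] closed a b by (metis imageI)
  show "x * y \<in> alg A" using emb_mult[OF a(1) b(1)] closed a b by (metis imageI)
next
  have "complete (alg A)"
    unfolding complete_def
  proof (intro allI impI, elim conjE)
    fix f assume f: "\<forall>n. f n \<in> alg A" and C: "Cauchy f"
    define x where "x n = proj A (f n)" for n
    have x: "x n \<in> carrier A" "f n = emb A (x n)" for n
      using f proj_closed emb_proj by (auto simp: x_def)
    have dist: "cnorm A (x m \<boxminus> x n) = dist (f m) (f n)" for m n
      using x by (simp add: dist_norm norm_emb minus_closed flip: emb_diff)
    have "\<exists>N. \<forall>m\<ge>N. \<forall>n\<ge>N. cnorm A (x m \<boxminus> x n) < e" if "e > 0" for e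
      unfolding dist using metric_CauchyD[OF C that] .
    then obtain l where l: "l \<in> carrier A" "\<And>e. e > 0 \<Longrightarrow> \<exists>N. \<forall>n\<ge>N. cnorm A (x n \<boxminus> l) < e"
      using convergent_of_Cauchy[of x] x(1) by blast
    have "f \<longlonglongrightarrow> emb A l"
    proof (rule metric_LIMSEQ_I)
      fix e :: real assume "e > 0"
      then obtain N where "\<forall>n\<ge>N. cnorm A (x n \<boxminus> l) < e" using l(2) by blast
      then show "\<exists>N. \<forall>n\<ge>N. dist (f n) (emb A l) < e"
        using x l(1) by (auto simp: dist_norm norm_emb minus_closed simp flip: emb_diff)
    qed
    then show "\<exists>l\<in>alg A. f \<longlonglongrightarrow> l" using l(1) by blast
  qed
  then show "closed (alg A)" by (rule complete_imp_closed)
qed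

lemma alg_separable:
  assumes "separable_space (Metric_space.mtopology (carrier A) (cdist A))"
  shows "\<exists>d::nat \<Rightarrow> 'a ambient. range d \<subseteq> alg A \<and> alg A \<subseteq> closure (range d)"
proof -
  interpret M: Metric_space "carrier A" "cdist A" by (rule Metric_space_cdist)
  obtain C where C: "countable C" "C \<subseteq> carrier A" "M.mtopology closure_of C = carrier A"
    using assms unfolding separable_space_def by auto
  have near: "\<exists>y\<in>C. cnorm A (x \<boxminus> y) < e" if "x \<in> carrier A" "e > 0" for x e
  proof -
    have "x \<in> M.mtopology closure_of C" using C that by simp
    then obtain y where "y \<in> C" "y \<in> M.mball x e" using \<open>e > 0\<close> unfolding M.metric_closure_of by blast
    then show ?thesis using C that by (auto simp: cdist_def)
  qed
  then have ne: "C \<noteq> {}" using zero_closed zero_less_one by blast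
  define d where "d n = emb A (from_nat_into C n)" for n
  have r: "range d = emb A ` C"
    unfolding d_def using range_from_nat_into[OF ne C(1)] by (metis image_image)
  have "alg A \<subseteq> closure (range d)"
  proof
    fix x assume "x \<in> alg A"
    then obtain a where a: "a \<in> carrier A" "x = emb A a" by auto
    show "x \<in> closure (range d)"
      unfolding closure_approachable r
    proof (intro allI impI)
      fix e :: real assume "e > 0"
      then obtain y where y: "y \<in> C" "cnorm A (a \<boxminus> y) < e" using near[OF a(1)] by blast
      then have "dist (emb A y) x < e"
        using C a by (subst dist_commute) (auto simp: dist_norm norm_emb minus_closed simp flip: emb_diff)
      then show "\<exists>y\<in>emb A ` C. dist y x < e" using y by blast
    qed
  qed
  then show ?thesis using r C(2) by blast
qed

end

text \<open>Homomorphisms between C*-algebras correspond to homomorphisms between their images, through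
\<open>lift_hom\<close> and \<open>drop_hom\<close>. Only the values of the latter on the image matter, and \<open>drop_hom\<close>
forgets the others.\<close>

definition lift_hom :: "'a cstar \<Rightarrow> 'a cstar \<Rightarrow> ('a \<Rightarrow> 'a) \<Rightarrow> 'a ambient \<Rightarrow> 'a ambient" where
  "lift_hom A B \<phi> x = emb B (\<phi> (proj A x))"

definition drop_hom :: "'a cstar \<Rightarrow> 'a cstar \<Rightarrow> ('a ambient \<Rightarrow> 'a ambient) \<Rightarrow> 'a \<Rightarrow> 'a" where
  "drop_hom A B \<Phi> = (\<lambda>a\<in>carrier A. proj B (\<Phi> (emb A a)))"

locale two_algebras = A: cstar_algebra A + B: cstar_algebra B for A B :: "'a cstar"
begin

lemma star_homsD:
  assumes "\<phi> \<in> star_homs A B"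
  shows "a \<in> carrier A \<Longrightarrow> \<phi> a \<in> carrier B"
    "a \<in> carrier A \<Longrightarrow> b \<in> carrier A \<Longrightarrow> \<phi> (a \<boxplus>\<^bsub>A\<^esub> b) = \<phi> a \<boxplus>\<^bsub>B\<^esub> \<phi> b"
    "a \<in> carrier A \<Longrightarrow> b \<in> carrier A \<Longrightarrow> \<phi> (a \<boxtimes>\<^bsub>A\<^esub> b) = \<phi> a \<boxtimes>\<^bsub>B\<^esub> \<phi> b"
    "a \<in> carrier A \<Longrightarrow> \<phi> (s \<boxdot>\<^bsub>A\<^esub> a) = s \<boxdot>\<^bsub>B\<^esub> \<phi> a"
    "a \<in> carrier A \<Longrightarrow> \<phi> (cstar A a) = cstar B (\<phi> a)"
  using assms by (auto simp: star_homs_def)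

lemma lift_emb: "a \<in> carrier A \<Longrightarrow> lift_hom A B \<phi> (emb A a) = emb B (\<phi> a)"
  by (simp add: lift_hom_def A.proj_emb)

lemma lift_star_hom:
  assumes "\<phi> \<in> star_homs A B" shows "lift_hom A B \<phi> \<in> star_hom (alg A) (alg B)"
proof -
  note h = star_homsD[OF assms]
  have re: "c *\<^sub>R emb A a = emb A (complex_of_real c \<boxdot>\<^bsub>A\<^esub> a)" if "a \<in> carrier A" for a c
    using A.emb_scale[OF that, of "complex_of_real c"] by simp
  have im: "imu * emb A a = emb A (\<i> \<boxdot>\<^bsub>A\<^esub> a)" if "a \<in> carrier A" for a
    using A.emb_scale[OF that, of \<i>] by simp
  show ?thesis
    unfolding star_hom_def
    by (auto simp: lift_emb h A.closed B.closed re im B.emb_scale B.emb_add B.emb_mult B.emb_star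
        simp flip: A.emb_add A.emb_mult A.emb_star)
qed

lemma emb_drop:
  assumes "\<Phi> \<in> star_hom (alg A) (alg B)" "a \<in> carrier A"
  shows "emb B (drop_hom A B \<Phi> a) = \<Phi> (emb A a)" "drop_hom A B \<Phi> a \<in> carrier B"
  using star_homD(1)[OF assms(1), of "emb A a"] assms(2)
  by (auto simp: drop_hom_def B.emb_proj B.proj_closed simp del: image_iff)

lemma drop_star_homs:
  assumes \<Phi>: "\<Phi> \<in> star_hom (alg A) (alg B)" shows "drop_hom A B \<Phi> \<in> star_homs A B"
proof -
  note e = emb_drop[OF \<Phi>] and h = star_homD[OF \<Phi>]
  let ?f = "drop_hom A B \<Phi>"
  have "?f (a \<boxplus>\<^bsub>A\<^esub> b) = ?f a \<boxplus>\<^bsub>B\<^esub> ?f b" "?f (a \<boxtimes>\<^bsub>A\<^esub> b) = ?f a \<boxtimes>\<^bsub>B\<^esub> ?f b"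
    if "a \<in> carrier A" "b \<in> carrier A" for a b
    using that by (subst B.emb_eq_iff[symmetric]; simp add: e A.closed B.closed A.emb_add B.emb_add
        A.emb_mult B.emb_mult h)+
  moreover have "?f (s \<boxdot>\<^bsub>A\<^esub> a) = s \<boxdot>\<^bsub>B\<^esub> ?f a" "?f (cstar A a) = cstar B (?f a)"
    if "a \<in> carrier A" for a s
  proof -
    have im: "imu * emb A a \<in> alg A" "c *\<^sub>R emb A a \<in> alg A" "c *\<^sub>R (imu * emb A a) \<in> alg A" for c
      using that by (auto intro!: cstar_sub.closure_rules[OF A.cstar_sub_alg])
    show "?f (s \<boxdot>\<^bsub>A\<^esub> a) = s \<boxdot>\<^bsub>B\<^esub> ?f a"
      using that im by (subst B.emb_eq_iff[symmetric]) (simp_all add: e A.closed B.closed A.emb_scale B.emb_scale h)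
    show "?f (cstar A a) = cstar B (?f a)"
      using that by (subst B.emb_eq_iff[symmetric]) (simp_all add: e A.closed B.closed A.emb_star B.emb_star h)
  qed
  moreover have "?f \<in> carrier A \<rightarrow>\<^sub>E carrier B" using e(2) by (auto simp: drop_hom_def)
  ultimately show ?thesis by (simp add: star_homs_def)
qed

lemma drop_lift:
  assumes "\<phi> \<in> star_homs A B" shows "drop_hom A B (lift_hom A B \<phi>) = \<phi>"
proof (rule extensionalityI[of _ "carrier A"])
  show "\<phi> \<in> extensional (carrier A)" using assms by (auto simp: star_homs_def PiE_iff)
  show "drop_hom A B (lift_hom A B \<phi>) a = \<phi> a" if "a \<in> carrier A" for a
    using that star_homsD(1)[OF assms that] by (simp add: drop_hom_def lift_emb B.proj_emb)
qed (simp add: drop_hom_def)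

lemma embed_conj:
  assumes u: "u \<in> carrier B.U" and ab: "a \<in> carrier B" "b \<in> carrier B"
  shows "cnorm B.U ((a, 0) \<boxminus>\<^bsub>B.U\<^esub>
      cstar B.U u \<boxtimes>\<^bsub>B.U\<^esub> (b, 0) \<boxtimes>\<^bsub>B.U\<^esub> u) =
    norm (emb B a - adj (embed B u) * emb B b * embed B u)"
proof -
  have "(a, 0) \<in> carrier B.U" "(b, 0) \<in> carrier B.U" using ab by (auto simp: B.in_U)
  then show ?thesis
    using u B.embed_scaleR[of _ "-1"]
    by (subst B.norm_embed[symmetric])
      (simp_all add: emb_def B.embed_diff B.embed_mult B.embed_adj B.U_closed cminus_def B.embed_add)
qed

lemma unitaries_iff: "u \<in> unitaries B \<longleftrightarrow> u \<in> carrier B.U \<and> unitary (embed B u)"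
proof -
  have "cstar B.U u \<boxtimes>\<^bsub>B.U\<^esub> u = unitization_one B \<longleftrightarrow> adj (embed B u) * embed B u = 1"
    "u \<boxtimes>\<^bsub>B.U\<^esub> cstar B.U u = unitization_one B \<longleftrightarrow> embed B u * adj (embed B u) = 1"
    if u: "u \<in> carrier B.U"
    using u by (subst B.embed_eq_iff[symmetric]; simp add: B.embed_mult B.embed_adj B.embed_one B.U_closed)+
  then show ?thesis by (auto simp: unitaries_def unitary_def)
qed

text \<open>In the applications \<open>X\<close> is \<open>B\<close> itself or the fixed point algebra. A unitary \<open>b + s 1\<close> of the
unitization of \<open>X\<close> is replaced by its multiple with scalar part 1, which conjugates in the same
way.\<close>

lemma approx_equiv_iff:
  assumes X: "X \<subseteq> carrier B" "\<And>s a. a \<in> X \<Longrightarrow> s \<boxdot>\<^bsub>B\<^esub> a \<in> X"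
    and \<Phi>: "\<Phi> \<in> star_hom (alg A) (alg B)" and \<Psi>: "\<Psi> \<in> star_hom (alg A) (alg B)"
  shows "approx_unitarily_equivalent (B\<lparr>carrier := X\<rparr>) A B (drop_hom A B \<Phi>) (drop_hom A B \<Psi>)
     \<longleftrightarrow> approx_equiv (emb B ` X) (alg A) \<Phi> \<Psi>"
    (is "?L \<longleftrightarrow> ?R")
proof -
  have un: "unitaries (B\<lparr>carrier := X\<rparr>) = {u \<in> unitaries B. fst u \<in> X}"
    using X(1) by (auto simp: unitaries_def unitization_def unitization_one_def split_beta)
  note e1 = emb_drop[OF \<Phi>] and e2 = emb_drop[OF \<Psi>]
  have small_conj: "cnorm B.U ((drop_hom A B \<Phi> a, 0) \<boxminus>\<^bsub>B.U\<^esub>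
      cstar B.U u \<boxtimes>\<^bsub>B.U\<^esub> (drop_hom A B \<Psi> a, 0) \<boxtimes>\<^bsub>B.U\<^esub> u) =
    norm (\<Phi> (emb A a) - adj (embed B u) * \<Psi> (emb A a) * embed B u)"
    if "a \<in> carrier A" "u \<in> carrier B.U" for a u
    using embed_conj[OF that(2) e1(2)[OF that(1)] e2(2)[OF that(1)]]
    unfolding e1(1)[OF that(1)] e2(1)[OF that(1)] .
  show ?thesis
  proof
    assume L: ?L
    show ?R
      unfolding approx_equiv_def
    proof (intro allI impI)
      fix F and \<epsilon> :: real assume \<epsilon>: "\<epsilon> > 0" and F: "finite F" "F \<subseteq> alg A"
      have F': "finite (proj A ` F) \<and> proj A ` F \<subseteq> carrier A" using F A.proj_closed by auto
      note ex = L[unfolded approx_unitarily_equivalent_def un, THEN spec, THEN spec, THEN mp, THEN mp, OF \<epsilon> F']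
      obtain u where u: "u \<in> unitaries B" "fst u \<in> X" and
        small: "\<And>a. a \<in> proj A ` F \<Longrightarrow> cnorm B.U ((drop_hom A B \<Phi> a, 0) \<boxminus>\<^bsub>B.U\<^esub>
          cstar B.U u \<boxtimes>\<^bsub>B.U\<^esub> (drop_hom A B \<Psi> a, 0) \<boxtimes>\<^bsub>B.U\<^esub> u) < \<epsilon>"
        by (rule bexE[OF ex]) auto
      define s where "s = snd u"
      have uU: "u \<in> carrier B.U" and un: "unitary (embed B u)" using u(1) unitaries_iff by auto
      have "cnj s * s = 1"
        using u(1) by (auto simp: unitaries_def B.unitization_simps unitization_one_def s_def)
      \<comment> \<open>The central unitary by which \<open>u\<close> is multiplied to normalise its scalar part.\<close>
      define z where "z = embed B (cnj s \<boxdot>\<^bsub>B.U\<^esub> unitization_one B)"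
      have zU: "cnj s \<boxdot>\<^bsub>B.U\<^esub> unitization_one B \<in> carrier B.U" by (intro B.U_closed)
      have zx: "z * embed B x = embed B (cnj s \<boxdot>\<^bsub>B.U\<^esub> x)" "embed B x * z = embed B (cnj s \<boxdot>\<^bsub>B.U\<^esub> x)"
        if x: "x \<in> carrier B.U" for x
      proof -
        have "(cnj s \<boxdot>\<^bsub>B.U\<^esub> unitization_one B) \<boxtimes>\<^bsub>B.U\<^esub> x = cnj s \<boxdot>\<^bsub>B.U\<^esub> x"
          "x \<boxtimes>\<^bsub>B.U\<^esub> (cnj s \<boxdot>\<^bsub>B.U\<^esub> unitization_one B) = cnj s \<boxdot>\<^bsub>B.U\<^esub> x"
          using x by (auto simp: B.unitization_simps unitization_one_def B.scale_zero B.zero_mult B.mult_zero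
              B.zero_add B.add_zero B.closed mult.commute)
        then show "z * embed B x = embed B (cnj s \<boxdot>\<^bsub>B.U\<^esub> x)" "embed B x * z = embed B (cnj s \<boxdot>\<^bsub>B.U\<^esub> x)"
          unfolding z_def using B.embed_mult[OF zU x] B.embed_mult[OF x zU] by simp_all
      qed
      have zz: "adj z * z = 1"
      proof -
        have "adj z * z = embed B (cnj s \<boxdot>\<^bsub>B.U\<^esub> cstar B.U (cnj s \<boxdot>\<^bsub>B.U\<^esub> unitization_one B))"
          using zx(2)[OF B.U_closed(4)[OF zU]] B.embed_adj[OF zU] by (simp add: z_def)
        also have "cnj s \<boxdot>\<^bsub>B.U\<^esub> cstar B.U (cnj s \<boxdot>\<^bsub>B.U\<^esub> unitization_one B) = unitization_one B"
          using \<open>cnj s * s = 1\<close> by (simp add: B.unitization_simps unitization_one_def B.scale_zero B.star_zero)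
        finally show ?thesis by (simp add: B.embed_one)
      qed
      moreover have "z * adj z = adj z * z"
        unfolding z_def B.embed_adj[OF zU, symmetric]
        using zx[OF B.U_closed(4)[OF zU]] by (simp add: z_def)
      ultimately have zun: "unitary z" by (simp add: unitary_def)
      define v where "v = z * embed B u"
      have v1: "unitary v" unfolding v_def by (rule unitary_mult[OF zun un])
      have "v - 1 = emb B (cnj s \<boxdot>\<^bsub>B\<^esub> fst u)"
      proof -
        have "v - 1 = embed B ((cnj s \<boxdot>\<^bsub>B.U\<^esub> u) \<boxminus>\<^bsub>B.U\<^esub> unitization_one B)"
          unfolding v_def zx(1)[OF uU] by (simp add: B.embed_diff B.U_closed uU B.embed_one)
        also have "(cnj s \<boxdot>\<^bsub>B.U\<^esub> u) \<boxminus>\<^bsub>B.U\<^esub> unitization_one B = (cnj s \<boxdot>\<^bsub>B\<^esub> fst u, 0)"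
          using uU \<open>cnj s * s = 1\<close>
          by (auto simp: cminus_def B.unitization_simps unitization_one_def B.scale_zero B.add_zero B.closed s_def)
        finally show ?thesis by (simp add: emb_def)
      qed
      then have v2: "v - 1 \<in> emb B ` X" using X(2)[OF u(2)] by blast
      have "norm (\<Phi> x - adj v * \<Psi> x * v) < \<epsilon>" if x: "x \<in> F" for x
      proof -
        define a where "a = proj A x"
        have a: "a \<in> carrier A" "x = emb A a" "a \<in> proj A ` F"
          using x F A.proj_closed A.emb_proj by (auto simp: a_def)
        have "\<Psi> x \<in> alg B" using star_homD(1)[OF \<Psi>] a by auto
        then obtain y where y: "y \<in> carrier B" "\<Psi> x = emb B y" by auto
        have "z * \<Psi> x = \<Psi> x * z" unfolding y(2) emb_def using zx[OF B.in_U[OF y(1)]] by simp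
        then have "adj v * \<Psi> x * v = adj (embed B u) * (adj z * z) * \<Psi> x * embed B u"
          by (simp add: v_def adj_mult mult.assoc)
        then show ?thesis
          using small[OF a(3)] small_conj[OF a(1) uU] a(2) by (simp add: zz)
      qed
      then show "\<exists>u. unitary u \<and> u - 1 \<in> emb B ` X \<and> (\<forall>a\<in>F. norm (\<Phi> a - adj u * \<Psi> a * u) < \<epsilon>)"
        using v1 v2 by blast
    qed
  next
    assume R: ?R
    show ?L
      unfolding approx_unitarily_equivalent_def un
    proof (intro allI impI, elim conjE)
      fix F and \<epsilon> :: real assume \<epsilon>: "\<epsilon> > 0" and F: "finite F" "F \<subseteq> carrier A"
      have "finite (emb A ` F)" "emb A ` F \<subseteq> alg A" using F by auto
      then obtain v where v: "unitary v" "v - 1 \<in> emb B ` X"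
        "\<And>x. x \<in> emb A ` F \<Longrightarrow> norm (\<Phi> x - adj v * \<Psi> x * v) < \<epsilon>"
        using approx_equivD[OF R \<epsilon>] by metis
      then obtain b where b: "b \<in> X" "v - 1 = emb B b" by auto
      have bU: "(b, 1) \<in> carrier B.U" "(b, 0) \<in> carrier B.U" using b X(1) by (auto intro: B.in_U)
      have "embed B (b, 1) = embed B ((b, 0) \<boxplus>\<^bsub>B.U\<^esub> unitization_one B)"
        using b X(1) by (auto simp: B.unitization_simps unitization_one_def B.add_zero)
      also have "\<dots> = emb B b + 1" by (simp add: B.embed_add bU B.U_closed B.embed_one emb_def)
      also have "\<dots> = v" by (simp add: b(2)[symmetric])
      finally have bv: "embed B (b, 1) = v" .
      have "(b, 1) \<in> {u \<in> unitaries B. fst u \<in> X}" using unitaries_iff bU v(1) bv b(1) by simp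
      moreover have "cnorm B.U ((drop_hom A B \<Phi> a, 0) \<boxminus>\<^bsub>B.U\<^esub>
          cstar B.U (b, 1) \<boxtimes>\<^bsub>B.U\<^esub> (drop_hom A B \<Psi> a, 0) \<boxtimes>\<^bsub>B.U\<^esub> (b, 1)) < \<epsilon>"
        if "a \<in> F" for a
        using small_conj[OF _ bU(1), of a] v(3)[of "emb A a"] that F bv by auto
      ultimately show "\<exists>u\<in>{u \<in> unitaries B. fst u \<in> X}. \<forall>a\<in>F. cnorm B.U ((drop_hom A B \<Phi> a, 0) \<boxminus>\<^bsub>B.U\<^esub>
          cstar B.U u \<boxtimes>\<^bsub>B.U\<^esub> (drop_hom A B \<Psi> a, 0) \<boxtimes>\<^bsub>B.U\<^esub> u) < \<epsilon>"
        by blast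
    qed
  qed
qed

lemma au_equiv_iff:
  assumes "\<Phi> \<in> star_hom (alg A) (alg B)" "\<Psi> \<in> star_hom (alg A) (alg B)"
  shows "au_equiv A B (drop_hom A B \<Phi>) (drop_hom A B \<Psi>) \<longleftrightarrow> approx_equiv (alg B) (alg A) \<Phi> \<Psi>"
  using approx_equiv_iff[OF order_refl B.scale_closed assms] by (simp add: au_equiv_def)

end

lemma drop_comp:
  assumes AB: "two_algebras A B" and BD: "two_algebras B D"
    and \<Phi>: "\<Phi> \<in> star_hom (alg A) (alg B)"
  shows "drop_hom A D (\<lambda>x. \<Psi> (\<Phi> x)) = compose (carrier A) (drop_hom B D \<Psi>) (drop_hom A B \<Phi>)"
proof -
  interpret AB: two_algebras A B by fact
  show ?thesis
    using AB.emb_drop[OF \<Phi>] by (auto simp: fun_eq_iff compose_def drop_hom_def[of A D] drop_hom_def[of B D])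
qed

section \<open>Embedding dynamical systems\<close>

locale algebra_system = cstar_algebra A + group G
  for A :: "'a cstar" and G :: "'g monoid" (structure) +
  fixes \<alpha> :: "'g \<Rightarrow> 'a \<Rightarrow> 'a"
  assumes finite_carrier: "finite (carrier G)"
    and separable_space: "separable_space (Metric_space.mtopology (carrier A) (cdist A))"
    and hom: "g \<in> carrier G \<Longrightarrow> \<alpha> g \<in> star_homs A A"
    and hom_mult: "g \<in> carrier G \<Longrightarrow> h \<in> carrier G \<Longrightarrow> a \<in> carrier A \<Longrightarrow> \<alpha> (g \<otimes> h) a = \<alpha> g (\<alpha> h a)"
    and hom_one: "a \<in> carrier A \<Longrightarrow> \<alpha> \<one> a = a"
begin

sublocale AA: two_algebras A A ..

abbreviation "act_on \<equiv> \<lambda>g. lift_hom A A (\<alpha> g)"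

lemma act_carrier: "g \<in> carrier G \<Longrightarrow> a \<in> carrier A \<Longrightarrow> \<alpha> g a \<in> carrier A"
  using AA.star_homsD(1)[OF hom] .

sublocale S: dynamical_system "alg A" G act_on
proof (intro dynamical_system.intro dynamical_system_axioms.intro)
  show "cstar_sub (alg A)" by (rule cstar_sub_alg)
  show "\<exists>d::nat \<Rightarrow> 'a ambient. range d \<subseteq> alg A \<and> alg A \<subseteq> closure (range d)"
    by (rule alg_separable[OF separable_space])
  show "lift_hom A A (\<alpha> g) \<in> star_hom (alg A) (alg A)" if "g \<in> carrier G" for g
    by (rule AA.lift_star_hom[OF hom[OF that]])
qed (auto simp: AA.lift_emb hom_mult hom_one act_carrier finite_carrier group_axioms)

lemma fixed_eq: "S.fixed = emb A ` {a \<in> carrier A. \<forall>g\<in>carrier G. \<alpha> g a = a}"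
  by (auto simp: AA.lift_emb emb_eq_iff act_carrier)

lemma rokhlin_transfer:
  assumes "rokhlin_property G A \<alpha>" shows "rokhlin G (alg A) act_on"
  unfolding rokhlin_def
proof (intro allI impI, elim conjE)
  fix \<epsilon> :: real and F assume \<epsilon>: "\<epsilon> > 0" and F: "finite F" "F \<subseteq> alg A"
  define F' where "F' = proj A ` F"
  have F': "finite F' \<and> F' \<subseteq> carrier A" "F = emb A ` F'"
  proof -
    show "finite F' \<and> F' \<subseteq> carrier A" using F proj_closed by (auto simp: F'_def)
    have "emb A ` F' = (\<lambda>x. emb A (proj A x)) ` F" by (simp add: F'_def image_image)
    also have "\<dots> = (\<lambda>x. x) ` F" using F emb_proj by (intro image_cong) auto
    finally show "F = emb A ` F'" by simp
  qed
  from assms[unfolded rokhlin_property_def, THEN spec, THEN mp, THEN spec, THEN mp, OF \<epsilon> F'(1)]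
  obtain r where r1: "\<forall>g\<in>carrier G. positive A (r g) \<and> cnorm A (r g) \<le> 1"
    and r2: "\<forall>g\<in>carrier G. \<forall>h\<in>carrier G. g \<noteq> h \<longrightarrow> r g \<boxtimes>\<^bsub>A\<^esub> r h = czero A"
    and r3: "\<forall>g\<in>carrier G. \<forall>h\<in>carrier G. cnorm A (\<alpha> g (r h) \<boxminus>\<^bsub>A\<^esub> r (g \<otimes> h)) < \<epsilon>"
    and r4: "\<forall>a\<in>F'. \<forall>g\<in>carrier G. cnorm A (r g \<boxtimes>\<^bsub>A\<^esub> a \<boxminus>\<^bsub>A\<^esub> a \<boxtimes>\<^bsub>A\<^esub> r g) < \<epsilon>"
    and r5: "\<forall>a\<in>F'. cnorm A (csum A r (carrier G) \<boxtimes>\<^bsub>A\<^esub> a \<boxminus>\<^bsub>A\<^esub> a) < \<epsilon>"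
    by (elim exE conjE)
  have r: "r g \<in> carrier A" "cstar A (r g) = r g" if "g \<in> carrier G" for g
    using r1 that by (auto simp: positive_def)
  have F'A: "a \<in> carrier A" if "a \<in> F'" for a using F' that by auto
  have s: "csum A r (carrier G) \<in> carrier A"
    "emb A (csum A r (carrier G)) = (\<Sum>g\<in>carrier G. emb A (r g))"
    using emb_sum[OF r(1) finite_carrier] by auto
  have tr: "norm (emb A x - emb A y) = cnorm A (x \<boxminus>\<^bsub>A\<^esub> y)" if "x \<in> carrier A" "y \<in> carrier A" for x y
    using that by (simp add: norm_emb minus_closed flip: emb_diff)
  show "\<exists>r. approx_tower G (alg A) act_on \<epsilon> F r"
    unfolding approx_tower_def
  proof (intro exI[of _ "\<lambda>g. emb A (r g)"] conjI ballI impI)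
    fix g assume g: "g \<in> carrier G"
    show "emb A (r g) \<in> alg A" using r(1)[OF g] by simp
    show "adj (emb A (r g)) = emb A (r g)" using emb_star[OF r(1)[OF g]] r(2)[OF g] by simp
    show "norm (emb A (r g)) \<le> 1" using r1 g norm_emb[OF r(1)[OF g]] by simp
    fix h assume h: "h \<in> carrier G"
    show "emb A (r g) * emb A (r h) = 0" if "g \<noteq> h"
      using r2 g h that emb_zero by (simp add: r flip: emb_mult)
    show "norm (act_on g (emb A (r h)) - emb A (r (g \<otimes> h))) < \<epsilon>"
      using r3 g h by (simp add: AA.lift_emb r tr act_carrier)
  next
    fix x assume "x \<in> F"
    then obtain a where a: "a \<in> F'" "x = emb A a" using F' by auto
    show "norm (emb A (r g) * x - x * emb A (r g)) < \<epsilon>" if g: "g \<in> carrier G" for g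
      using r4 a(1) g F'A[OF a(1)] r(1)[OF g]
      by (simp add: a(2) tr mult_closed flip: emb_mult)
    show "norm ((\<Sum>g\<in>carrier G. emb A (r g)) * x - x) < \<epsilon>"
      using r5 a(1) F'A[OF a(1)] s(1)
      by (simp add: a(2) tr mult_closed flip: emb_mult s(2))
  qed
qed

end

section \<open>Lifting isomorphisms along the functor\<close>

lemma isos_functor:
  assumes F: "is_functor C D F" and x: "x \<in> ob C" "y \<in> ob C" and f: "f \<in> isos C x y"
  shows "fmor F x y f \<in> isos D (fob F x) (fob F y)"
proof -
  obtain g where g: "f \<in> mor C x y" "g \<in> mor C y x" "comp C x y x g f = ident C x" "comp C y x y f g = ident C y"
    using f by (auto simp: isos_def)
  have m: "fmor F x y f \<in> mor D (fob F x) (fob F y)" "fmor F y x g \<in> mor D (fob F y) (fob F x)"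
    using F x g by (auto simp: is_functor_def)
  have "comp D (fob F x) (fob F y) (fob F x) (fmor F y x g) (fmor F x y f) = fmor F x x (comp C x y x g f)"
    "comp D (fob F y) (fob F x) (fob F y) (fmor F x y f) (fmor F y x g) = fmor F y y (comp C y x y f g)"
    using F x g(1,2) unfolding is_functor_def by metis+
  moreover have "fmor F x x (ident C x) = ident D (fob F x)" "fmor F y y (ident C y) = ident D (fob F y)"
    using F x by (auto simp: is_functor_def)
  ultimately show ?thesis using m g(3,4) by (auto simp: isos_def)
qed

lemma is_functor_full_subcategory:
  assumes "is_functor C D F" "full_subcategory S C" shows "is_functor S D F"
  using assms unfolding is_functor_def full_subcategory_def by (simp add: subset_iff)

locale classified = group G for G :: "'g monoid" (structure) +
  fixes B :: "('a cstar, 'a \<Rightarrow> 'a) category"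
    and C :: "('o, 'm) category"
    and F :: "('a cstar, 'a \<Rightarrow> 'a, 'o, 'm) functor_data"
  assumes finite: "finite (carrier G)"
    and full: "full_subcategory B separable_cstar_category"
    and C: "is_category C" and F: "is_functor B C F"
    and classifies: "classifies_homomorphisms B C F au_equiv"
begin

lemma B: "is_category B"
  using is_category_full_subcategory[OF is_category_separable_cstar full] .

lemma obB: "A \<in> ob B \<Longrightarrow> cstar_algebra A" "A \<in> ob B \<Longrightarrow> separable_cstar_algebra A"
  using full by (auto simp: full_subcategory_def separable_cstar_category_def separable_cstar_algebra_def)

lemma morB: "A \<in> ob B \<Longrightarrow> A' \<in> ob B \<Longrightarrow> mor B A A' = star_homs A A'"
  "A \<in> ob B \<Longrightarrow> ident B A = (\<lambda>x\<in>carrier A. x)"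
  using full by (auto simp: full_subcategory_def separable_cstar_category_def)

lemma compB: "\<lbrakk>A \<in> ob B; A' \<in> ob B; A'' \<in> ob B; \<phi> \<in> star_homs A A'; \<psi> \<in> star_homs A' A''\<rbrakk>
    \<Longrightarrow> comp B A A' A'' \<psi> \<phi> = compose (carrier A) \<psi> \<phi>"
  using full morB by (simp add: full_subcategory_def separable_cstar_category_def)

lemma two_algebras: "A \<in> ob B \<Longrightarrow> A' \<in> ob B \<Longrightarrow> two_algebras A A'"
  by (intro two_algebras.intro obB)

lemma F_comp:
  assumes "A \<in> ob B" "A' \<in> ob B" "A'' \<in> ob B" "\<phi> \<in> star_homs A A'" "\<psi> \<in> star_homs A' A''"
  shows "fmor F A A'' (compose (carrier A) \<psi> \<phi>) =
    comp C (fob F A) (fob F A') (fob F A'') (fmor F A' A'' \<psi>) (fmor F A A' \<phi>)"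
  using F assms morB compB[OF assms] unfolding is_functor_def by metis

lemma F_mor:
  "A \<in> ob B \<Longrightarrow> A' \<in> ob B \<Longrightarrow> \<phi> \<in> star_homs A A' \<Longrightarrow> fmor F A A' \<phi> \<in> mor C (fob F A) (fob F A')"
  "A \<in> ob B \<Longrightarrow> fob F A \<in> ob C"
  "A \<in> ob B \<Longrightarrow> fmor F A A (\<lambda>x\<in>carrier A. x) = ident C (fob F A)"
  using F morB unfolding is_functor_def by (simp, simp, metis)

lemma F_eq_iff:
  "\<lbrakk>A \<in> ob B; A' \<in> ob B; \<phi> \<in> star_homs A A'; \<psi> \<in> star_homs A A'\<rbrakk>
    \<Longrightarrow> fmor F A A' \<phi> = fmor F A A' \<psi> \<longleftrightarrow> au_equiv A A' \<phi> \<psi>"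
  using classifies morB by (simp add: classifies_homomorphisms_def)

lemma F_full:
  assumes "A \<in> ob B" "A' \<in> ob B" "l \<in> mor C (fob F A) (fob F A')"
  shows "\<exists>\<phi>\<in>star_homs A A'. fmor F A A' \<phi> = l"
  using classifies morB assms by (auto simp: classifies_homomorphisms_def)

lemma ob_rokhlin:
  assumes "(A, \<alpha>) \<in> ob (rokhlin_category G B)"
  shows "A \<in> ob B" "algebra_system A G \<alpha>" "rokhlin_property G A \<alpha>"
proof -
  have 1: "A \<in> ob B" "\<alpha> \<in> hom G (Aut B A)" "rokhlin_property G A \<alpha>"
    using assms by (auto simp: rokhlin_category_def equivariant_category_def)
  have m: "\<alpha> g \<in> star_homs A A" if "g \<in> carrier G" for g
    using 1 that morB by (auto simp: hom_def Aut_def isos_def Pi_iff)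
  interpret cstar_algebra A using 1 obB by blast
  interpret group_hom G "Aut B A" \<alpha>
    using group_axioms group_Aut[OF B 1(1)] 1(2) by (intro group_hom.intro group_hom_axioms.intro)
  have "\<alpha> (g \<otimes> h) = compose (carrier A) (\<alpha> g) (\<alpha> h)" if "g \<in> carrier G" "h \<in> carrier G" for g h
    using 1(2) that compB[OF 1(1) 1(1) 1(1) m m] by (simp add: hom_def Aut_def)
  moreover have "\<alpha> \<one> = (\<lambda>x\<in>carrier A. x)"
    using hom_one morB(2)[OF 1(1)] by (simp add: Aut_def)
  ultimately show "algebra_system A G \<alpha>"
    using m group_axioms finite obB(2)[OF 1(1)] cstar_algebra_axioms
    by (intro algebra_system.intro algebra_system_axioms.intro)
      (auto simp: separable_cstar_algebra_def compose_def)
  show "A \<in> ob B" "rokhlin_property G A \<alpha>" using 1 by auto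
qed

lemma rokhlin_tower_alg:
  assumes "(A, \<alpha>) \<in> ob (rokhlin_category G B)"
  obtains r where "tower (alg A) G (\<lambda>g. lift_hom A A (\<alpha> g)) r"
proof -
  interpret algebra_system A G \<alpha> using ob_rokhlin[OF assms] by simp
  show ?thesis using S.rokhlin_tower[OF rokhlin_transfer[OF ob_rokhlin(3)[OF assms]]] that by blast
qed

lemma mor_rokhlin:
  assumes "(A, \<alpha>) \<in> ob (rokhlin_category G B)" "(A', \<beta>) \<in> ob (rokhlin_category G B)"
  shows "\<phi> \<in> mor (rokhlin_category G B) (A, \<alpha>) (A', \<beta>) \<longleftrightarrow>
    \<phi> \<in> star_homs A A' \<and> (\<forall>g\<in>carrier G. \<forall>a\<in>carrier A. \<phi> (\<alpha> g a) = \<beta> g (\<phi> a))"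
proof -
  note o = ob_rokhlin[OF assms(1)] ob_rokhlin[OF assms(2)]
  interpret A: algebra_system A G \<alpha> by (rule o)
  interpret A': algebra_system A' G \<beta> by (rule o)
  have "comp B A A A' \<phi> (\<alpha> g) = comp B A A' A' (\<beta> g) \<phi> \<longleftrightarrow> (\<forall>a\<in>carrier A. \<phi> (\<alpha> g a) = \<beta> g (\<phi> a))"
    if "\<phi> \<in> star_homs A A'" "g \<in> carrier G" for g
    using that o(1,4) A.hom A'.hom by (auto simp: compB compose_def fun_eq_iff restrict_def)
  then show ?thesis
    using morB(1)[OF o(1) o(4)] by (auto simp: rokhlin_category_def equivariant_category_def)
qed

text \<open>The inverse of an equivariant bijection is automatically equivariant, so isomorphisms in the
Rokhlin category are the equivariant isomorphisms of C*-algebras.\<close>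

lemma isos_rokhlin:
  assumes "(A, \<alpha>) \<in> ob (rokhlin_category G B)" "(A', \<beta>) \<in> ob (rokhlin_category G B)"
  shows "isos (rokhlin_category G B) (A, \<alpha>) (A', \<beta>) =
    {\<phi> \<in> star_homs A A'. bij_betw \<phi> (carrier A) (carrier A') \<and>
      (\<forall>g\<in>carrier G. \<forall>a\<in>carrier A. \<phi> (\<alpha> g a) = \<beta> g (\<phi> a))}"
proof -
  note o = ob_rokhlin[OF assms(1)] ob_rokhlin[OF assms(2)]
  interpret A: algebra_system A G \<alpha> by (rule o)
  interpret A': algebra_system A' G \<beta> by (rule o)
  let ?R = "rokhlin_category G B"
  have ops: "ident ?R (A, \<alpha>) = ident separable_cstar_category A" "ident ?R (A', \<beta>) = ident separable_cstar_category A'"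
    using morB o by (simp_all add: rokhlin_category_def equivariant_category_def separable_cstar_category_def)
  have comp1: "comp ?R (A, \<alpha>) (A', \<beta>) (A, \<alpha>) \<psi> \<phi> = comp separable_cstar_category A A' A \<psi> \<phi>"
    "comp ?R (A', \<beta>) (A, \<alpha>) (A', \<beta>) \<phi> \<psi> = comp separable_cstar_category A' A A' \<phi> \<psi>"
    if "\<phi> \<in> star_homs A A'" "\<psi> \<in> star_homs A' A" for \<phi> \<psi>
    using that o(1,4) by (simp_all add: rokhlin_category_def equivariant_category_def compB separable_cstar_category_def)
  have sep: "mor separable_cstar_category = star_homs" by (simp add: separable_cstar_category_def)
  have "\<phi> \<in> isos ?R (A, \<alpha>) (A', \<beta>) \<longleftrightarrow> \<phi> \<in> isos separable_cstar_category A A' \<and>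
      (\<forall>g\<in>carrier G. \<forall>a\<in>carrier A. \<phi> (\<alpha> g a) = \<beta> g (\<phi> a))" for \<phi>
  proof
    assume "\<phi> \<in> isos ?R (A, \<alpha>) (A', \<beta>)"
    then show "\<phi> \<in> isos separable_cstar_category A A' \<and> (\<forall>g\<in>carrier G. \<forall>a\<in>carrier A. \<phi> (\<alpha> g a) = \<beta> g (\<phi> a))"
      using mor_rokhlin[OF assms] mor_rokhlin[OF assms(2,1)] comp1 ops
      unfolding isos_def sep by auto
  next
    assume \<phi>: "\<phi> \<in> isos separable_cstar_category A A' \<and> (\<forall>g\<in>carrier G. \<forall>a\<in>carrier A. \<phi> (\<alpha> g a) = \<beta> g (\<phi> a))"
    then obtain \<psi> where \<psi>: "\<phi> \<in> star_homs A A'" "\<psi> \<in> star_homs A' A"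
      "comp separable_cstar_category A A' A \<psi> \<phi> = ident separable_cstar_category A"
      "comp separable_cstar_category A' A A' \<phi> \<psi> = ident separable_cstar_category A'"
      unfolding isos_def sep by auto
    have inv: "\<psi> (\<phi> a) = a" "\<phi> (\<psi> b) = b" if "a \<in> carrier A" "b \<in> carrier A'" for a b
      using fun_cong[OF \<psi>(3), of a] fun_cong[OF \<psi>(4), of b] that
      by (auto simp: separable_cstar_category_def compose_def)
    have "\<psi> (\<beta> g b) = \<alpha> g (\<psi> b)" if g: "g \<in> carrier G" and b: "b \<in> carrier A'" for g b
    proof -
      have c: "\<psi> b \<in> carrier A" using \<psi>(2) b by (auto simp: star_homs_def)
      have "\<psi> (\<beta> g (\<phi> (\<psi> b))) = \<psi> (\<phi> (\<alpha> g (\<psi> b)))" using \<phi> g c by simp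
      then show ?thesis using inv[OF c b] inv[OF A.act_carrier[OF g c] b] by simp
    qed
    then have "\<psi> \<in> mor ?R (A', \<beta>) (A, \<alpha>)" "\<phi> \<in> mor ?R (A, \<alpha>) (A', \<beta>)"
      using mor_rokhlin[OF assms(2,1)] mor_rokhlin[OF assms] \<psi> \<phi> by auto
    then show "\<phi> \<in> isos ?R (A, \<alpha>) (A', \<beta>)"
      using \<psi> ops comp1[OF \<psi>(1,2)] unfolding isos_def by auto
  qed
  then show ?thesis
    using isos_separable_cstar[OF obB(2)[OF o(1)] obB(2)[OF o(4)]] by auto
qed

lemma isos_rokhlin_iff_conjugate:
  assumes "(A, \<alpha>) \<in> ob (rokhlin_category G B)" "(A', \<beta>) \<in> ob (rokhlin_category G B)"
  shows "conjugate G (A, \<alpha>) (A', \<beta>) \<longleftrightarrow> isos (rokhlin_category G B) (A, \<alpha>) (A', \<beta>) \<noteq> {}"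
  unfolding isos_rokhlin[OF assms] by (auto simp: conjugate_def)

text \<open>The functor detects approximate unitary equivalence; for equivariant homomorphisms into a
Rokhlin system this is the same as equivalence through fixed unitaries, by
\<open>equivariant_approx_equiv\<close>.\<close>

lemma F_eq_iff_G_au_equiv:
  assumes x: "(A, \<alpha>) \<in> ob (rokhlin_category G B)" "(A', \<beta>) \<in> ob (rokhlin_category G B)"
    and \<phi>: "\<phi> \<in> mor (rokhlin_category G B) (A, \<alpha>) (A', \<beta>)"
    and \<psi>: "\<psi> \<in> mor (rokhlin_category G B) (A, \<alpha>) (A', \<beta>)"
  shows "fmor F A A' \<phi> = fmor F A A' \<psi> \<longleftrightarrow> G_au_equiv G (A, \<alpha>) (A', \<beta>) \<phi> \<psi>"
proof -
  note o = ob_rokhlin[OF x(1)] ob_rokhlin[OF x(2)]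
  interpret A: algebra_system A G \<alpha> by (rule o)
  interpret A': algebra_system A' G \<beta> by (rule o)
  interpret two_algebras A A' by (rule two_algebras[OF o(1) o(4)])
  obtain r where "tower (alg A') G A'.act_on r" using rokhlin_tower_alg[OF x(2)] .
  then interpret T: tower "alg A'" G A'.act_on r .
  note h = \<phi>[unfolded mor_rokhlin[OF x]] \<psi>[unfolded mor_rokhlin[OF x]]
  let ?\<Phi> = "lift_hom A A' \<phi>" and ?\<Psi> = "lift_hom A A' \<psi>"
  have hom: "?\<Phi> \<in> star_hom (alg A) (alg A')" "?\<Psi> \<in> star_hom (alg A) (alg A')"
    using h lift_star_hom by auto
  have d: "drop_hom A A' ?\<Phi> = \<phi>" "drop_hom A A' ?\<Psi> = \<psi>" using h drop_lift by auto
  have eqv: "lift_hom A A' \<theta> (A.act_on g x) = A'.act_on g (lift_hom A A' \<theta> x)"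
    if \<theta>: "\<theta> \<in> star_homs A A' \<and> (\<forall>g\<in>carrier G. \<forall>a\<in>carrier A. \<theta> (\<alpha> g a) = \<beta> g (\<theta> a))"
      and g: "g \<in> carrier G" and x: "x \<in> alg A" for \<theta> g x
  proof -
    obtain a where a: "a \<in> carrier A" "x = emb A a" using x by auto
    have "\<theta> a \<in> carrier A'" using \<theta> a star_homsD(1) by blast
    then show ?thesis
      using \<theta> g a A.act_carrier[OF g a(1)] by (simp add: A.AA.lift_emb A'.AA.lift_emb lift_emb)
  qed
  let ?X = "{a \<in> carrier A'. \<forall>g\<in>carrier G. \<beta> g a = a}"
  have X: "s \<boxdot>\<^bsub>A'\<^esub> a \<in> ?X" if "a \<in> ?X" for s a
    using that A'.AA.star_homsD(4)[OF A'.hom] by (auto simp: A'.scale_closed)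
  have "G_au_equiv G (A, \<alpha>) (A', \<beta>) \<phi> \<psi> \<longleftrightarrow> approx_equiv (emb A' ` ?X) (alg A) ?\<Phi> ?\<Psi>"
    using approx_equiv_iff[of ?X, OF _ X hom] unfolding d G_au_equiv_def fixed_point_algebra_def by auto
  also have "\<dots> \<longleftrightarrow> approx_equiv A'.S.fixed (alg A) ?\<Phi> ?\<Psi>"
    unfolding A'.fixed_eq ..
  also have "\<dots> \<longleftrightarrow> approx_equiv (alg A') (alg A) ?\<Phi> ?\<Psi>"
  proof
    assume "approx_equiv A'.S.fixed (alg A) ?\<Phi> ?\<Psi>"
    then show "approx_equiv (alg A') (alg A) ?\<Phi> ?\<Psi>"
      unfolding approx_equiv_def by (metis (no_types, lifting) mem_Collect_eq)
  next
    assume "approx_equiv (alg A') (alg A) ?\<Phi> ?\<Psi>"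
    then show "approx_equiv A'.S.fixed (alg A) ?\<Phi> ?\<Psi>"
      using eqv[OF h(1)] eqv[OF h(2)]
      by (intro T.equivariant_approx_equiv[OF A.S.dynamical_system_axioms hom(1) _ hom(2)])
  qed
  also have "\<dots> \<longleftrightarrow> au_equiv A A' \<phi> \<psi>" using au_equiv_iff[OF hom] unfolding d by simp
  also have "\<dots> \<longleftrightarrow> fmor F A A' \<phi> = fmor F A A' \<psi>" using F_eq_iff[OF o(1) o(4)] h by simp
  finally show ?thesis by simp
qed

text \<open>The lifts of a morphism of \<open>C\<close> to homomorphisms between embedded algebras. For an isomorphism and its
inverse these are the classes \<open>P\<close> and \<open>Q\<close> of \<open>equivariant_bijection\<close>.\<close>

definition lifts :: "'a cstar \<Rightarrow> 'a cstar \<Rightarrow> 'm \<Rightarrow> ('a ambient \<Rightarrow> 'a ambient) set" where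
  "lifts A A' l = {\<Phi> \<in> star_hom (alg A) (alg A'). fmor F A A' (drop_hom A A' \<Phi>) = l}"

lemma lifts_nonempty:
  assumes "A \<in> ob B" "A' \<in> ob B" "l \<in> mor C (fob F A) (fob F A')"
  shows "lifts A A' l \<noteq> {}"
proof -
  interpret two_algebras A A' by (rule two_algebras[OF assms(1,2)])
  obtain \<phi> where "\<phi> \<in> star_homs A A'" "fmor F A A' \<phi> = l" using F_full[OF assms] by blast
  then have "lift_hom A A' \<phi> \<in> lifts A A' l" by (simp add: lifts_def lift_star_hom drop_lift)
  then show ?thesis by blast
qed

lemma F_drop_eq_iff:
  assumes "A \<in> ob B" "A' \<in> ob B" "\<Phi> \<in> star_hom (alg A) (alg A')" "\<Psi> \<in> star_hom (alg A) (alg A')"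
  shows "fmor F A A' (drop_hom A A' \<Phi>) = fmor F A A' (drop_hom A A' \<Psi>) \<longleftrightarrow> approx_equiv (alg A') (alg A) \<Phi> \<Psi>"
proof -
  interpret two_algebras A A' by (rule two_algebras[OF assms(1,2)])
  show ?thesis
    using F_eq_iff[OF assms(1,2) drop_star_homs[OF assms(3)] drop_star_homs[OF assms(4)]] au_equiv_iff[OF assms(3,4)]
    by simp
qed

lemma F_drop_comp:
  assumes "A \<in> ob B" "A' \<in> ob B" "A'' \<in> ob B" "\<Phi> \<in> star_hom (alg A) (alg A')" "\<Psi> \<in> star_hom (alg A') (alg A'')"
  shows "fmor F A A'' (drop_hom A A'' (\<lambda>x. \<Psi> (\<Phi> x))) =
    comp C (fob F A) (fob F A') (fob F A'') (fmor F A' A'' (drop_hom A' A'' \<Psi>)) (fmor F A A' (drop_hom A A' \<Phi>))"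
  using drop_comp[OF two_algebras[OF assms(1,2)] two_algebras[OF assms(2,3)] assms(4), of \<Psi>]
    F_comp[OF assms(1-3) two_algebras.drop_star_homs[OF two_algebras[OF assms(1,2)] assms(4)]
      two_algebras.drop_star_homs[OF two_algebras[OF assms(2,3)] assms(5)]] by simp

text \<open>Functoriality sends the twist of a lift of \<open>l\<close> to \<open>F(\<beta>\<^sub>g) l F(\<alpha>\<^sub>g\<inverse>)\<close>, which equals \<open>l\<close> by equivariance of \<open>l\<close>.\<close>

lemma lifts_twist:
  assumes x: "(A, \<alpha>) \<in> ob (rokhlin_category G B)" "(A', \<beta>) \<in> ob (rokhlin_category G B)"
    and l: "l \<in> mor (equivariant_category G C) (fob (equivariant_functor G F) (A, \<alpha>)) (fob (equivariant_functor G F) (A', \<beta>))"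
    and \<Phi>: "\<Phi> \<in> lifts A A' l" and g: "g \<in> carrier G"
  shows "(\<lambda>x. lift_hom A' A' (\<beta> g) (\<Phi> (lift_hom A A (\<alpha> (inv g)) x))) \<in> lifts A A' l"
proof -
  note o = ob_rokhlin[OF x(1)] ob_rokhlin[OF x(2)]
  interpret A: algebra_system A G \<alpha> by (rule o)
  interpret A': algebra_system A' G \<beta> by (rule o)
  have g': "inv g \<in> carrier G" using g by simp
  have lm: "l \<in> mor C (fob F A) (fob F A')"
    and leq: "comp C (fob F A) (fob F A) (fob F A') l (fmor F A A (\<alpha> g))
      = comp C (fob F A) (fob F A') (fob F A') (fmor F A' A' (\<beta> g)) l"
    using l g by (auto simp: equivariant_category_def equivariant_functor_def)
  have \<Phi>h: "\<Phi> \<in> star_hom (alg A) (alg A')" and \<Phi>l: "fmor F A A' (drop_hom A A' \<Phi>) = l"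
    using \<Phi> by (auto simp: lifts_def)
  let ?a = "A.act_on (inv g)" and ?b = "A'.act_on g"
  have ah: "?a \<in> star_hom (alg A) (alg A)" and bh: "?b \<in> star_hom (alg A') (alg A')"
    using A.S.action_hom[OF g'] A'.S.action_hom[OF g] by auto
  have \<Phi>a: "(\<lambda>x. \<Phi> (?a x)) \<in> star_hom (alg A) (alg A')" by (rule star_hom_comp[OF ah \<Phi>h])
  have da: "drop_hom A A ?a = \<alpha> (inv g)" "drop_hom A' A' ?b = \<beta> g"
    using A.AA.drop_lift[OF A.hom[OF g']] A'.AA.drop_lift[OF A'.hom[OF g]] by auto
  let ?c = "comp C (fob F A) (fob F A) (fob F A)"
  have Fm: "fmor F A A (\<alpha> g) \<in> mor C (fob F A) (fob F A)" "fmor F A A (\<alpha> (inv g)) \<in> mor C (fob F A) (fob F A)"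
    "fmor F A' A' (\<beta> g) \<in> mor C (fob F A') (fob F A')"
    using F_mor(1) o(1,4) A.hom[OF g] A.hom[OF g'] A'.hom[OF g] by auto
  have FA: "fob F A \<in> ob C" "fob F A' \<in> ob C" using F_mor(2) o by auto
  have assoc: "\<And>w x y z f g h. \<lbrakk>w \<in> ob C; x \<in> ob C; y \<in> ob C; z \<in> ob C;
      f \<in> mor C w x; g \<in> mor C x y; h \<in> mor C y z\<rbrakk>
      \<Longrightarrow> comp C w y z h (comp C w x y g f) = comp C w x z (comp C x y z h g) f"
    and idr: "\<And>x y f. \<lbrakk>x \<in> ob C; y \<in> ob C; f \<in> mor C x y\<rbrakk> \<Longrightarrow> comp C x x y f (ident C x) = f"
    using C by (simp_all add: is_category_def)
  have inv: "?c (fmor F A A (\<alpha> g)) (fmor F A A (\<alpha> (inv g))) = ident C (fob F A)"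
  proof -
    have "compose (carrier A) (\<alpha> g) (\<alpha> (inv g)) = (\<lambda>x\<in>carrier A. x)"
      using g g' A.hom_mult[OF g g'] A.hom_one by (auto simp: compose_def fun_eq_iff restrict_def)
    then show ?thesis
      using F_comp[OF o(1) o(1) o(1) A.hom[OF g'] A.hom[OF g]] F_mor(3)[OF o(1)] by simp
  qed
  have "fmor F A A' (drop_hom A A' (\<lambda>x. ?b (\<Phi> (?a x)))) =
    comp C (fob F A) (fob F A') (fob F A') (fmor F A' A' (\<beta> g))
      (comp C (fob F A) (fob F A) (fob F A') l (fmor F A A (\<alpha> (inv g))))"
    using F_drop_comp[OF o(1) o(4) o(4) \<Phi>a bh] F_drop_comp[OF o(1) o(1) o(4) ah \<Phi>h] da \<Phi>l by simp
  also have "\<dots> = comp C (fob F A) (fob F A) (fob F A')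
      (comp C (fob F A) (fob F A') (fob F A') (fmor F A' A' (\<beta> g)) l) (fmor F A A (\<alpha> (inv g)))"
    by (rule assoc[OF FA(1,1,2,2) Fm(2) lm Fm(3)])
  also have "\<dots> = comp C (fob F A) (fob F A) (fob F A') l (?c (fmor F A A (\<alpha> g)) (fmor F A A (\<alpha> (inv g))))"
    unfolding leq[symmetric] by (rule assoc[OF FA(1,1,1,2) Fm(2,1) lm, symmetric])
  also have "\<dots> = l" unfolding inv by (rule idr[OF FA lm])
  finally show ?thesis using star_hom_comp[OF \<Phi>a bh] by (simp add: lifts_def)
qed

lemma lift_isomorphism:
  assumes x: "(A, \<alpha>) \<in> ob (rokhlin_category G B)" "(A', \<beta>) \<in> ob (rokhlin_category G B)"
    and l: "l \<in> isos (equivariant_category G C) (fob (equivariant_functor G F) (A, \<alpha>)) (fob (equivariant_functor G F) (A', \<beta>))"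
  shows "\<exists>\<phi>\<in>isos (rokhlin_category G B) (A, \<alpha>) (A', \<beta>). fmor F A A' \<phi> = l"
proof -
  note o = ob_rokhlin[OF x(1)] ob_rokhlin[OF x(2)]
  interpret A: algebra_system A G \<alpha> by (rule o)
  interpret A': algebra_system A' G \<beta> by (rule o)
  interpret two_algebras A A' by (rule two_algebras[OF o(1) o(4)])
  obtain r where r: "tower (alg A) G A.act_on r" using rokhlin_tower_alg[OF x(1)] .
  obtain s where s: "tower (alg A') G A'.act_on s" using rokhlin_tower_alg[OF x(2)] .
  let ?E = "equivariant_category G C" and ?F = "equivariant_functor G F"
  obtain m where lE: "l \<in> mor ?E (fob ?F (A, \<alpha>)) (fob ?F (A', \<beta>))" and mE: "m \<in> mor ?E (fob ?F (A', \<beta>)) (fob ?F (A, \<alpha>))"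
    and ml: "comp C (fob F A) (fob F A') (fob F A) m l = ident C (fob F A)"
      "comp C (fob F A') (fob F A) (fob F A') l m = ident C (fob F A')"
    using l by (auto simp: isos_def equivariant_category_def equivariant_functor_def)
  have lC: "l \<in> mor C (fob F A) (fob F A')" and mC: "m \<in> mor C (fob F A') (fob F A)"
    using lE mE by (auto simp: equivariant_category_def equivariant_functor_def)
  have id: "(\<lambda>x. x) \<in> star_hom W W" for W :: "'a ambient set" by (simp add: star_hom_def)
  have did: "drop_hom A A (\<lambda>x. x) = (\<lambda>x\<in>carrier A. x)" "drop_hom A' A' (\<lambda>x. x) = (\<lambda>x\<in>carrier A'. x)"
    by (auto simp: drop_hom_def fun_eq_iff A.proj_emb A'.proj_emb)
  have equiv: "approx_equiv (alg E') (alg E) \<Phi> \<Psi>"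
    if "E \<in> ob B" "E' \<in> ob B" "\<Phi> \<in> lifts E E' k" "\<Psi> \<in> lifts E E' k" for E E' k \<Phi> \<Psi>
    using that F_drop_eq_iff[OF that(1,2), of \<Phi> \<Psi>] by (auto simp: lifts_def)
  have cl: "\<Phi> \<in> lifts E E' k"
    if "E \<in> ob B" "E' \<in> ob B" "\<Phi> \<in> star_hom (alg E) (alg E')" "\<Psi> \<in> lifts E E' k" "approx_equiv (alg E') (alg E) \<Phi> \<Psi>"
    for E E' k \<Phi> \<Psi>
    using that F_drop_eq_iff[OF that(1,2,3), of \<Psi>] by (auto simp: lifts_def)
  obtain \<Phi> where \<Phi>: "\<Phi> \<in> lifts A A' l" "bij_betw \<Phi> (alg A) (alg A')"
    "\<And>g x. g \<in> carrier G \<Longrightarrow> x \<in> alg A \<Longrightarrow> \<Phi> (A.act_on g x) = A'.act_on g (\<Phi> x)"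
  proof (rule equivariant_bijection[OF r s, where P = "lifts A A' l" and Q = "lifts A' A m"])
    show "lifts A A' l \<subseteq> star_hom (alg A) (alg A')" "lifts A' A m \<subseteq> star_hom (alg A') (alg A)"
      by (auto simp: lifts_def)
    show "lifts A A' l \<noteq> {}" by (rule lifts_nonempty[OF o(1) o(4) lC])
    show "lifts A' A m \<noteq> {}" by (rule lifts_nonempty[OF o(4) o(1) mC])
    show "(\<lambda>x. A'.act_on g (\<phi> (A.act_on (inv g) x))) \<in> lifts A A' l"
      if "\<phi> \<in> lifts A A' l" "g \<in> carrier G" for \<phi> g by (rule lifts_twist[OF x lE that])
    show "(\<lambda>x. A.act_on g (\<phi> (A'.act_on (inv g) x))) \<in> lifts A' A m"
      if "\<phi> \<in> lifts A' A m" "g \<in> carrier G" for \<phi> g by (rule lifts_twist[OF x(2,1) mE that])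
    fix \<phi> \<psi> assume \<phi>: "\<phi> \<in> lifts A A' l" and \<psi>: "\<psi> \<in> lifts A' A m"
    then have h: "\<phi> \<in> star_hom (alg A) (alg A')" "\<psi> \<in> star_hom (alg A') (alg A)"
      and e: "fmor F A A' (drop_hom A A' \<phi>) = l" "fmor F A' A (drop_hom A' A \<psi>) = m"
      by (auto simp: lifts_def)
    show "approx_equiv (alg A) (alg A) (\<lambda>x. x) (\<lambda>x. \<psi> (\<phi> x))"
      using F_drop_eq_iff[OF o(1) o(1) id star_hom_comp[OF h]] F_drop_comp[OF o(1) o(4) o(1) h]
        F_mor(3)[OF o(1)] by (simp add: did e ml)
    show "approx_equiv (alg A') (alg A') (\<lambda>x. x) (\<lambda>x. \<phi> (\<psi> x))"
      using F_drop_eq_iff[OF o(4) o(4) id star_hom_comp[OF h(2,1)]] F_drop_comp[OF o(4) o(1) o(4) h(2,1)]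
        F_mor(3)[OF o(4)] by (simp add: did e ml)
  qed (use equiv cl o(1,4) in \<open>blast+\<close>)
  define \<phi> where "\<phi> = drop_hom A A' \<Phi>"
  have \<Phi>h: "\<Phi> \<in> star_hom (alg A) (alg A')" and Fl: "fmor F A A' \<phi> = l"
    using \<Phi>(1) by (auto simp: lifts_def \<phi>_def)
  note e = emb_drop[OF \<Phi>h, folded \<phi>_def]
  have "bij_betw \<phi> (carrier A) (carrier A')"
    unfolding bij_betw_def
  proof
    show "inj_on \<phi> (carrier A)"
    proof (rule inj_onI)
      fix a b assume ab: "a \<in> carrier A" "b \<in> carrier A" "\<phi> a = \<phi> b"
      then have "\<Phi> (emb A a) = \<Phi> (emb A b)" using e(1) by metis
      then have "emb A a = emb A b" using \<Phi>(2) ab by (auto simp: bij_betw_def inj_on_def)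
      then show "a = b" using ab A.emb_eq_iff by blast
    qed
    show "\<phi> ` carrier A = carrier A'"
    proof
      show "\<phi> ` carrier A \<subseteq> carrier A'" using e(2) by auto
      show "carrier A' \<subseteq> \<phi> ` carrier A"
      proof
        fix b assume b: "b \<in> carrier A'"
        then have "emb A' b \<in> \<Phi> ` alg A" using \<Phi>(2) by (auto simp: bij_betw_def)
        then obtain a where a: "a \<in> carrier A" "emb A' b = \<Phi> (emb A a)" by auto
        then have "emb A' b = emb A' (\<phi> a)" using e(1) by simp
        then have "b = \<phi> a" using b e(2)[OF a(1)] A'.emb_eq_iff by blast
        then show "b \<in> \<phi> ` carrier A" using a(1) by blast
      qed
    qed
  qed
  moreover have "\<phi> (\<alpha> g a) = \<beta> g (\<phi> a)" if g: "g \<in> carrier G" and a: "a \<in> carrier A" for g a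
  proof -
    have "emb A' (\<phi> (\<alpha> g a)) = \<Phi> (A.act_on g (emb A a))"
      using e(1) A.act_carrier[OF g a] A.AA.lift_emb[OF a] by simp
    also have "\<dots> = A'.act_on g (emb A' (\<phi> a))" using \<Phi>(3)[OF g] a e(1) by simp
    also have "\<dots> = emb A' (\<beta> g (\<phi> a))" using A'.AA.lift_emb e(2)[OF a] by simp
    finally show ?thesis
      using e(2)[OF A.act_carrier[OF g a]] A'.act_carrier[OF g e(2)[OF a]] A'.emb_eq_iff by blast
  qed
  moreover have "\<phi> \<in> star_homs A A'" unfolding \<phi>_def by (rule drop_star_homs[OF \<Phi>h])
  ultimately have "\<phi> \<in> isos (rokhlin_category G B) (A, \<alpha>) (A', \<beta>)" using isos_rokhlin[OF x] by blast
  then show ?thesis using Fl by blast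
qed

end

theorem theorem3p3:
  fixes G :: "'g monoid"
    and B :: "('a cstar, 'a \<Rightarrow> 'a) category"
    and C :: "('o, 'm) category"
    and F :: "('a cstar, 'a \<Rightarrow> 'a, 'o, 'm) functor_data"
  assumes "group G" and "finite (carrier G)"
    and "full_subcategory B separable_cstar_category"
    and "is_category C" and "has_inductive_limits C"
    and "is_functor B C F" and "sequentially_continuous B C F"
    and "classifies_homomorphisms B C F au_equiv"
  shows "classifies_isomorphisms (rokhlin_category G B) (equivariant_category G C)
           (equivariant_functor G F) (G_au_equiv G) \<and>
         (\<forall>A \<alpha> B' \<beta>.
           (A, \<alpha>) \<in> ob (rokhlin_category G B) \<longrightarrow> (B', \<beta>) \<in> ob (rokhlin_category G B) \<longrightarrow>
           (conjugate G (A, \<alpha>) (B', \<beta>) \<longleftrightarrow>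
            (\<exists>\<rho>. \<rho> \<in> isos (equivariant_category G C)
              (fob (equivariant_functor G F) (A, \<alpha>)) (fob (equivariant_functor G F) (B', \<beta>)))))"
proof -
  interpret classified G B C F using assms by (intro classified.intro classified_axioms.intro)
  let ?R = "rokhlin_category G B" and ?E = "equivariant_category G C" and ?F = "equivariant_functor G F"
  have fm: "fmor ?F (A, \<alpha>) (A', \<beta>) = fmor F A A'" for A \<alpha> A' \<beta>
    by (simp add: equivariant_functor_def)
  have restr: "is_functor ?R ?E ?F"
    using is_functor_full_subcategory[OF is_functor_equivariant[OF B F assms(1)] full_subcategory_rokhlin] .
  have "classifies_isomorphisms ?R ?E ?F (G_au_equiv G)"
    unfolding classifies_isomorphisms_def
  proof (intro conjI ballI restr)
    fix x y l assume xy: "x \<in> ob ?R" "y \<in> ob ?R" "l \<in> isos ?E (fob ?F x) (fob ?F y)"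
    then show "\<exists>\<phi>\<in>isos ?R x y. fmor ?F x y \<phi> = l"
      using lift_isomorphism by (cases x; cases y) (simp add: fm)
  next
    fix x y \<phi> \<psi> assume "x \<in> ob ?R" "y \<in> ob ?R" "\<phi> \<in> isos ?R x y" "\<psi> \<in> isos ?R x y"
    then show "fmor ?F x y \<phi> = fmor ?F x y \<psi> \<longleftrightarrow> G_au_equiv G x y \<phi> \<psi>"
      using F_eq_iff_G_au_equiv by (cases x; cases y) (simp add: fm isos_def)
  qed
  moreover have "conjugate G (A, \<alpha>) (A', \<beta>) \<longleftrightarrow> (\<exists>\<rho>. \<rho> \<in> isos ?E (fob ?F (A, \<alpha>)) (fob ?F (A', \<beta>)))"
    if x: "(A, \<alpha>) \<in> ob ?R" "(A', \<beta>) \<in> ob ?R" for A \<alpha> A' \<beta>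
    using isos_rokhlin_iff_conjugate[OF x] isos_functor[OF restr x] lift_isomorphism[OF x] by blast
  ultimately show ?thesis by blast
qed

end
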